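(* Let $n+1\ge 2$ and $q\ge 2$ ($q\in\mathbb N\cup\{\infty\}$). Let $\Gamma$ be a $(q,n+1)$-Koszul partial Artin–Schelter $n$-regular algebra and $\mathcal Q=\mathrm{add}\,\Gamma$ the category of finitely generated projective $\Gamma$-modules. Assume that the complex $$0\to P^{n+1}(S(i))\xrightarrow{f_{n+1}}\cdots\xrightarrow{f_2}P^1(S(i))\xrightarrow{f_1}P^0(S(i))\to0\qquad( * )$$ is truncated from a minimal projective resolution of the simple $\Gamma$-module $S(i)$. Then $( * )$ is a source sequence in $\mathcal Q$ if and only if it is exact at position $n+1$ (i.e. at $P^{n+1}(S(i))$). In this case, $( * )$ is an $n$-almost split sequence.
   Context: Let $k$ be a field. Algebras are graded algebras $\Gamma=\Gamma_0+\Gamma_1+\cdots$ with $\Gamma_0=\bigoplus_{i\in Q_0}k e_i$, generated by $\Gamma_1$ over $\Gamma_0$, locally finite (only finitely many arrows at each vertex of the quiver) and connected; $S(i)=\Gamma_0e_i$ is the simple module at $i\in Q_0$. $[\;]$ is the degree shift, $M[r]_t=M_{t+r}$. **$(p,q)$-Koszul.** For $p,q\in\mathbb N\cup\{\infty\}$, an algebra $\Lambda$ is $(p,q)$-Koszul if $\Lambda_t=0$ for $t>p$ and for each $i\in Q_0$ there is a graded complex $0\to P^q(i)\to\cdots\to P^1(i)\to P^0(i)\to0$ of projective left $\Lambda$-modules with $P^t(i)$ generated by its component of degree $t$, whose only non-zero homologies are $S(i)=\Lambda_0e_i$ in degree $0$ and possibly one other in degree $p+q$, which in that case is $\Lambda_p\otimes_{\Lambda_0}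 P^q_q(i)$ (components of degree $\infty$ are $0$; for $q=\infty$ the complex may be infinite to the left). **Partial Artin–Schelter $n$-regular algebra.** $\Gamma$ is partial Artin–Schelter $n$-regular if there are subsets $\mathcal P,\mathcal I\subset Q_0$, a bijection $\nu:Q_0\setminus\mathcal I\to Q_0\setminus\mathcal P$ (Nakayama translation) and an integer $l\ge 0$ (Gorenstein parameter) such that for each $i\in Q_0\setminus\mathcal I$: (i) $\mathrm{Ext}^t_\Gamma(\Gamma_0e_i,\Gamma)=0$ for $0<t<n+1$; (ii) $\mathrm{Ext}^{n+1}_\Gamma(\Gamma_0e_i,\Gamma)[l]\simeq e_{\nu i}\Gamma_0$ as $\Gamma^{op}$-modules. **Source, sink and $n$-almost split sequences.** Let $\mathcal C$ be a Krull–Schmidt category with radical $J_{\mathcal C}$. A complex $M\xrightarrow{f_0}C_1\xrightarrow{f_1}C_2\xrightarrow{f_2}\cdots$ is a source sequence of $M\in\mathcal C$ if all $C_i\in\mathcal C$, all $f_i\in J_{\mathcal C}$, and $\cdots\to\mathrm{Hom}_{\mathcal C}(C_2,-)\to\mathrm{Hom}_{\mathcal C}(C_1,-)\to J_{\mathcal C}(M,-)\to0$ is exact on $\mathcal C$. Sink sequences are defined dually. A complex $0\to M\to C_1\to\cdots\to C_n\to N\to0$ is an $n$-almost split sequence if it is a source sequence of $M\in\mathcal C$ and a sink sequence of $N\in\mathcal C$. For $( * )$, "source sequence" means source sequence of $P^{n+1}(S(i))$ with $\mathcal C=\mathcal Q$.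
   Formalization: Stated for i in Q_0∖I, with Q the graded f.g. projectives; "exact at n+1 implies source" assumes Hom(S(i),Γ)=0, which every source sequence forces but the regularity axioms (0<t<n+1) do not give; without it the claim fails. The other implications are unconditional. *)

theory Defs
  imports Complex_Main "HOL-Library.Extended_Nat" "HOL-Library.Function_Algebras"
begin

section \<open>Sums of subsets of an abelian group\<close>

definition add_span :: "'m::ab_group_add set \<Rightarrow> 'm set" where
  "add_span S = {\<Sum>k<m. y k | (m::nat) y. \<forall>k<m. y k \<in> S}"

definition family_sum :: "('t \<Rightarrow> 'm::ab_group_add set) \<Rightarrow> 'm set" where
  "family_sum A = {\<Sum>t\<in>F. x t | F x. finite F \<and> (\<forall>t\<in>F. x t \<in> A t)}"

definition family_indep :: "('t \<Rightarrow> 'm::ab_group_add set) \<Rightarrow> bool" where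
  "family_indep A \<longleftrightarrow>
     (\<forall>F x. finite F \<and> (\<forall>t\<in>F. x t \<in> A t) \<and> (\<Sum>t\<in>F. x t) = 0 \<longrightarrow> (\<forall>t\<in>F. x t = 0))"


section \<open>Graded algebras\<close>

text \<open>
  The underlying ring of the algebra is a whole type of the class of possibly non-unital rings
  (there is no unit when there are infinitely many vertices), and the vertex set of the quiver
  is a whole type. \<open>idem \<Gamma> i\<close> is the idempotent at the vertex \<open>i\<close>.
\<close>

record ('k, 'v, 'a) galg =
  scl :: "'k \<Rightarrow> 'a \<Rightarrow> 'a"
  deg :: "nat \<Rightarrow> 'a set"
  idem :: "'v \<Rightarrow> 'a"

definition quiver_adjacent :: "('k::field, 'v, 'a::ring) galg \<Rightarrow> ('v \<times> 'v) set" where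
  "quiver_adjacent \<Gamma> =
     {(i, j). \<exists>a \<in> deg \<Gamma> 1. idem \<Gamma> j * a * idem \<Gamma> i \<noteq> 0 \<or> idem \<Gamma> i * a * idem \<Gamma> j \<noteq> 0}"

text \<open>
  The arrows between \<open>i\<close> and \<open>j\<close> are a basis of \<open>e\<^sub>j \<Gamma>\<^sub>1 e\<^sub>i\<close>; so finitely many arrows start (end) at
  \<open>i\<close> iff \<open>\<Gamma>\<^sub>1 e\<^sub>i\<close> (\<open>e\<^sub>i \<Gamma>\<^sub>1\<close>) is finite-dimensional.
\<close>

definition graded_quiver_algebra :: "('k::field, 'v, 'a::ring) galg \<Rightarrow> bool" where
  "graded_quiver_algebra \<Gamma> \<longleftrightarrow>
     vector_space (scl \<Gamma>) \<and>
     (\<forall>c a b. scl \<Gamma> c (a * b) = scl \<Gamma> c a * b \<and> scl \<Gamma> c (a * b) = a * scl \<Gamma> c b) \<and>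
     (\<forall>t. module.subspace (scl \<Gamma>) (deg \<Gamma> t)) \<and>
     family_sum (deg \<Gamma>) = UNIV \<and> family_indep (deg \<Gamma>) \<and>
     (\<forall>s t. \<forall>a \<in> deg \<Gamma> s. \<forall>b \<in> deg \<Gamma> t. a * b \<in> deg \<Gamma> (s + t)) \<and>
     (\<forall>i j. idem \<Gamma> i * idem \<Gamma> j = (if i = j then idem \<Gamma> i else 0)) \<and>
     (\<forall>i. idem \<Gamma> i \<noteq> 0) \<and>
     deg \<Gamma> 0 = module.span (scl \<Gamma>) (range (idem \<Gamma>)) \<and>
     (\<forall>a. \<exists>F. finite F \<and> (\<Sum>i\<in>F. idem \<Gamma> i) * a = a \<and> a * (\<Sum>i\<in>F. idem \<Gamma> i) = a) \<and>
     (\<forall>S. module.subspace (scl \<Gamma>) S \<and> (\<forall>a\<in>S. \<forall>b\<in>S. a * b \<in> S) \<and> deg \<Gamma> 0 \<union> deg \<Gamma> 1 \<subseteq> S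
          \<longrightarrow> S = UNIV) \<and>
     (\<forall>i. \<exists>B. finite B \<and> {a * idem \<Gamma> i | a. a \<in> deg \<Gamma> 1} \<subseteq> module.span (scl \<Gamma>) B) \<and>
     (\<forall>i. \<exists>B. finite B \<and> {idem \<Gamma> i * a | a. a \<in> deg \<Gamma> 1} \<subseteq> module.span (scl \<Gamma>) B) \<and>
     (\<forall>i j. (i, j) \<in> (quiver_adjacent \<Gamma>)\<^sup>*)"

definition degree0_part :: "('k::field, 'v, 'a::ring) galg \<Rightarrow> 'a \<Rightarrow> 'a" where
  "degree0_part \<Gamma> a = (THE b. b \<in> deg \<Gamma> 0 \<and> a - b \<in> family_sum (\<lambda>t. deg \<Gamma> (Suc t)))"


section \<open>Graded left modules\<close>

text \<open>
  The underlying group of a graded module is a subgroup of an ambient group \<open>'m\<close>; the action is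
  arbitrary and matters only on the carrier. Modules are unitary over the local units, hence the
  action of the ground field is given by that of the elements \<open>scl \<Gamma> c (idem \<Gamma> i)\<close>, and
  \<open>\<Gamma>\<close>-linear maps are automatically linear over the ground field.
\<close>

record ('a, 'm) gmod =
  mdeg :: "int \<Rightarrow> 'm set"
  act :: "'a \<Rightarrow> 'm \<Rightarrow> 'm"

text \<open>
  The ambient group of the objects of the category of graded modules. It is large enough: every
  countably (in particular finitely) generated graded projective module is isomorphic to one
  whose underlying group is a subgroup of the group of sequences in \<open>\<Gamma>\<close>.
\<close>

type_synonym 'a umod = "('a, nat \<Rightarrow> 'a) gmod"

definition mcar :: "('a, 'm::ab_group_add) gmod \<Rightarrow> 'm set" where
  "mcar M = family_sum (mdeg M)"

definition gmodule :: "('k::field, 'v, 'a::ring) galg \<Rightarrow> ('a, 'm::ab_group_add) gmod \<Rightarrow> bool" where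
  "gmodule \<Gamma> M \<longleftrightarrow>
     (\<forall>t. 0 \<in> mdeg M t \<and> (\<forall>x \<in> mdeg M t. \<forall>y \<in> mdeg M t. x - y \<in> mdeg M t)) \<and>
     family_indep (mdeg M) \<and>
     (\<forall>s t. \<forall>a \<in> deg \<Gamma> s. \<forall>x \<in> mdeg M t. act M a x \<in> mdeg M (int s + t)) \<and>
     (\<forall>a. \<forall>x \<in> mcar M. \<forall>y \<in> mcar M. act M a (x + y) = act M a x + act M a y) \<and>
     (\<forall>a b. \<forall>x \<in> mcar M. act M (a + b) x = act M a x + act M b x) \<and>
     (\<forall>a b. \<forall>x \<in> mcar M. act M (a * b) x = act M a (act M b x)) \<and>
     (\<forall>x \<in> mcar M. \<exists>F. finite F \<and> act M (\<Sum>i\<in>F. idem \<Gamma> i) x = x)"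

definition shift :: "('a, 'm) gmod \<Rightarrow> int \<Rightarrow> ('a, 'm) gmod" where
  "shift M r = M\<lparr>mdeg := \<lambda>t. mdeg M (t + r)\<rparr>"

definition zero_mod :: "('a, 'm::zero) gmod" where
  "zero_mod = \<lparr>mdeg = \<lambda>_. {0}, act = \<lambda>_ _. 0\<rparr>"

definition regular_mod :: "('k::field, 'v, 'a::ring) galg \<Rightarrow> ('a, 'a) gmod" where
  "regular_mod \<Gamma> = \<lparr>mdeg = \<lambda>t. if 0 \<le> t then deg \<Gamma> (nat t) else {0}, act = (*)\<rparr>"

text \<open>\<open>S(i) = \<Gamma>\<^sub>0 e\<^sub>i\<close>, on which elements of positive degree act as zero\<close>

definition simple_mod :: "('k::field, 'v, 'a::ring) galg \<Rightarrow> 'v \<Rightarrow> ('a, 'a) gmod" where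
  "simple_mod \<Gamma> i =
     \<lparr>mdeg = \<lambda>t. if t = 0 then {a * idem \<Gamma> i | a. a \<in> deg \<Gamma> 0} else {0},
      act = \<lambda>a x. degree0_part \<Gamma> a * x\<rparr>"

definition gr_hom ::
  "('a, 'm::ab_group_add) gmod \<Rightarrow> ('a, 'n::ab_group_add) gmod \<Rightarrow> ('m \<Rightarrow> 'n) \<Rightarrow> bool" where
  "gr_hom M N f \<longleftrightarrow>
     (\<forall>t. f ` mdeg M t \<subseteq> mdeg N t) \<and>
     (\<forall>x \<in> mcar M. \<forall>y \<in> mcar M. f (x + y) = f x + f y) \<and>
     (\<forall>a. \<forall>x \<in> mcar M. f (act M a x) = act N a (f x))"

definition gr_projective :: "('k::field, 'v, 'a::ring) galg \<Rightarrow> 'a umod \<Rightarrow> bool" where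
  "gr_projective \<Gamma> P \<longleftrightarrow> gmodule \<Gamma> P \<and>
     (\<forall>(M :: 'a umod) (N :: 'a umod) g h.
        gmodule \<Gamma> M \<and> gmodule \<Gamma> N \<and> gr_hom M N g \<and> g ` mcar M = mcar N \<and> gr_hom P N h
        \<longrightarrow> (\<exists>k. gr_hom P M k \<and> (\<forall>x \<in> mcar P. g (k x) = h x)))"

definition fin_generated :: "('a, 'm::ab_group_add) gmod \<Rightarrow> bool" where
  "fin_generated M \<longleftrightarrow>
     (\<exists>B. finite B \<and> B \<subseteq> mcar M \<and> (\<forall>x \<in> mcar M. \<exists>c. x = (\<Sum>b\<in>B. act M (c b) b)))"

definition generated_in_degree :: "('a, 'm::ab_group_add) gmod \<Rightarrow> int \<Rightarrow> bool" where
  "generated_in_degree M t \<longleftrightarrow> mcar M = add_span {act M a x | a x. x \<in> mdeg M t}"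

text \<open>The graded radical \<open>(\<Gamma>\<^sub>1 + \<Gamma>\<^sub>2 + \<cdots>) M\<close>\<close>

definition graded_radical ::
  "('k::field, 'v, 'a::ring) galg \<Rightarrow> ('a, 'm::ab_group_add) gmod \<Rightarrow> 'm set" where
  "graded_radical \<Gamma> M = add_span {act M a x | a x. (\<exists>s. a \<in> deg \<Gamma> (Suc s)) \<and> x \<in> mcar M}"


section \<open>Projective resolutions and Ext\<close>

text \<open>
  Complexes are indexed homologically: \<open>d (Suc t)\<close> maps \<open>P (Suc t)\<close> to \<open>P t\<close>, and \<open>d 0\<close> is ignored.
\<close>

definition proj_resolution ::
  "('k::field, 'v, 'a::ring) galg \<Rightarrow> ('a, 'm::ab_group_add) gmod \<Rightarrow>
   (nat \<Rightarrow> 'a umod) \<Rightarrow> (nat \<Rightarrow> (nat \<Rightarrow> 'a) \<Rightarrow> nat \<Rightarrow> 'a) \<Rightarrow> ((nat \<Rightarrow> 'a) \<Rightarrow> 'm) \<Rightarrow> bool" where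
  "proj_resolution \<Gamma> M P d \<epsilon> \<longleftrightarrow>
     (\<forall>t. gr_projective \<Gamma> (P t)) \<and>
     (\<forall>t. gr_hom (P (Suc t)) (P t) (d (Suc t))) \<and>
     gr_hom (P 0) M \<epsilon> \<and>
     \<epsilon> ` mcar (P 0) = mcar M \<and>
     {x \<in> mcar (P 0). \<epsilon> x = 0} = d 1 ` mcar (P 1) \<and>
     (\<forall>t. {x \<in> mcar (P (Suc t)). d (Suc t) x = 0} = d (Suc (Suc t)) ` mcar (P (Suc (Suc t))))"

definition minimal_resolution ::
  "('k::field, 'v, 'a::ring) galg \<Rightarrow> ('a, 'm::ab_group_add) gmod \<Rightarrow>
   (nat \<Rightarrow> 'a umod) \<Rightarrow> (nat \<Rightarrow> (nat \<Rightarrow> 'a) \<Rightarrow> nat \<Rightarrow> 'a) \<Rightarrow> ((nat \<Rightarrow> 'a) \<Rightarrow> 'm) \<Rightarrow> bool" where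
  "minimal_resolution \<Gamma> M P d \<epsilon> \<longleftrightarrow>
     proj_resolution \<Gamma> M P d \<epsilon> \<and>
     {x \<in> mcar (P 0). \<epsilon> x = 0} \<subseteq> graded_radical \<Gamma> (P 0) \<and>
     (\<forall>t. d (Suc t) ` mcar (P (Suc t)) \<subseteq> graded_radical \<Gamma> (P t))"

text \<open>
  \<open>Ext\<^sup>t(M, \<Gamma>)\<close> is the graded group with component \<open>Ext\<^sup>t(M[r], \<Gamma>)\<close> in degree \<open>r\<close>, the cocycles
  modulo the coboundaries below. This sign is the one for which a Gorenstein parameter
  \<open>l \<ge> 0\<close> makes sense: if \<open>P t\<close> is \<open>\<Gamma>e\<^sub>j\<close> generated in degree \<open>t\<close>, then \<open>Hom(P t, \<Gamma>) = e\<^sub>j\<Gamma>\<close> has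
  its generator in degree \<open>t\<close>, which \<open>[t]\<close> moves to degree 0.
\<close>

definition ext_cocycles ::
  "('k::field, 'v, 'a::ring) galg \<Rightarrow> (nat \<Rightarrow> 'a umod) \<Rightarrow> (nat \<Rightarrow> (nat \<Rightarrow> 'a) \<Rightarrow> nat \<Rightarrow> 'a)
   \<Rightarrow> nat \<Rightarrow> int \<Rightarrow> ((nat \<Rightarrow> 'a) \<Rightarrow> 'a) set" where
  "ext_cocycles \<Gamma> P d t r =
     {g. gr_hom (shift (P t) r) (regular_mod \<Gamma>) g \<and>
         (\<forall>x \<in> mcar (P (Suc t)). g (d (Suc t) x) = 0)}"

definition ext_coboundaries ::
  "('k::field, 'v, 'a::ring) galg \<Rightarrow> (nat \<Rightarrow> 'a umod) \<Rightarrow> (nat \<Rightarrow> (nat \<Rightarrow> 'a) \<Rightarrow> nat \<Rightarrow> 'a)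
   \<Rightarrow> nat \<Rightarrow> int \<Rightarrow> ((nat \<Rightarrow> 'a) \<Rightarrow> 'a) set" where
  "ext_coboundaries \<Gamma> P d t r =
     {g. gr_hom (shift (P t) r) (regular_mod \<Gamma>) g \<and>
         (case t of
            0 \<Rightarrow> (\<forall>x \<in> mcar (P 0). g x = 0)
          | Suc u \<Rightarrow> (\<exists>h. gr_hom (shift (P u) r) (regular_mod \<Gamma>) h \<and>
                          (\<forall>x \<in> mcar (P t). g x = h (d t x))))}"

text \<open>
  Ext is computed by any projective resolution; the conditions on it are independent of the
  choice.
\<close>

definition ext_to_algebra_zero ::
  "('k::field, 'v, 'a::ring) galg \<Rightarrow> ('a, 'm::ab_group_add) gmod \<Rightarrow> nat \<Rightarrow> bool" where
  "ext_to_algebra_zero \<Gamma> M t \<longleftrightarrow>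
     (\<forall>P d \<epsilon>. proj_resolution \<Gamma> M P d \<epsilon> \<longrightarrow>
        (\<forall>r. ext_cocycles \<Gamma> P d t r \<subseteq> ext_coboundaries \<Gamma> P d t r))"

text \<open>
  \<open>Ext\<^sup>t(M, \<Gamma>)[l] \<simeq> e\<^sub>j\<Gamma>\<^sub>0\<close> as graded \<open>\<Gamma>\<^sup>o\<^sup>p\<close>-modules, the right action on cocycles being
  \<open>(g \<cdot> a) x = g x * a\<close>. Off degree 0 both sides vanish. In degree 0 the map \<open>\<phi>\<close> induces the
  isomorphism; there it remains to ask for compatibility with \<open>\<Gamma>\<^sub>0\<close>, since elements of positive
  degree act as zero on both sides.
\<close>

definition ext_to_algebra_iso ::
  "('k::field, 'v, 'a::ring) galg \<Rightarrow> ('a, 'm::ab_group_add) gmod \<Rightarrow> nat \<Rightarrow> nat \<Rightarrow> 'v \<Rightarrow> bool" where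
  "ext_to_algebra_iso \<Gamma> M t l j \<longleftrightarrow>
     (\<forall>P d \<epsilon>. proj_resolution \<Gamma> M P d \<epsilon> \<longrightarrow>
        (\<forall>r. r \<noteq> 0 \<longrightarrow> ext_cocycles \<Gamma> P d t (r + int l) \<subseteq> ext_coboundaries \<Gamma> P d t (r + int l)) \<and>
        (\<exists>\<phi>. \<phi> ` ext_cocycles \<Gamma> P d t (int l) = {idem \<Gamma> j * a | a. a \<in> deg \<Gamma> 0} \<and>
             (\<forall>g \<in> ext_cocycles \<Gamma> P d t (int l). \<forall>h \<in> ext_cocycles \<Gamma> P d t (int l).
                \<phi> (\<lambda>x. g x + h x) = \<phi> g + \<phi> h) \<and>
             (\<forall>g \<in> ext_cocycles \<Gamma> P d t (int l). \<forall>a \<in> deg \<Gamma> 0. \<phi> (\<lambda>x. g x * a) = \<phi> g * a) \<and>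
             (\<forall>g \<in> ext_cocycles \<Gamma> P d t (int l).
                \<phi> g = 0 \<longleftrightarrow> g \<in> ext_coboundaries \<Gamma> P d t (int l))))"

text \<open>
  \<open>II\<close>, \<open>PP\<close> are the subsets of injective and projective vertices, \<open>\<nu>\<close> is the Nakayama translation
  and \<open>l\<close> the Gorenstein parameter. An algebra is partial Artin--Schelter \<open>n\<close>-regular if such
  data exist.
\<close>

definition partial_AS_regular ::
  "('k::field, 'v, 'a::ring) galg \<Rightarrow> nat \<Rightarrow> 'v set \<Rightarrow> 'v set \<Rightarrow> ('v \<Rightarrow> 'v) \<Rightarrow> nat \<Rightarrow> bool" where
  "partial_AS_regular \<Gamma> n PP II \<nu> l \<longleftrightarrow>
     bij_betw \<nu> (- II) (- PP) \<and>
     (\<forall>i \<in> - II.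
        (\<forall>t. 0 < t \<and> t < n + 1 \<longrightarrow> ext_to_algebra_zero \<Gamma> (simple_mod \<Gamma> i) t) \<and>
        ext_to_algebra_iso \<Gamma> (simple_mod \<Gamma> i) (n + 1) l (\<nu> i))"

text \<open>
  The case \<open>t = 0\<close> of the vanishing of Ext, which partial Artin--Schelter regularity does not
  require. It is the exactness of \<open>Hom(-, \<Gamma>)\<close> of a projective resolution at \<open>Hom(P 0, \<Gamma>)\<close>.
\<close>

definition hom_to_algebra_zero ::
  "('k::field, 'v, 'a::ring) galg \<Rightarrow> ('a, 'm::ab_group_add) gmod \<Rightarrow> bool" where
  "hom_to_algebra_zero \<Gamma> M \<longleftrightarrow>
     (\<forall>r g. gr_hom (shift M r) (regular_mod \<Gamma>) g \<longrightarrow> (\<forall>x \<in> mcar M. g x = 0))"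


section \<open>Koszul algebras of type (p,q)\<close>

definition balanced ::
  "('k::field, 'v, 'a::ring) galg \<Rightarrow> ('a, 'm::ab_group_add) gmod \<Rightarrow> 'a set \<Rightarrow> 'm set
   \<Rightarrow> ('a \<Rightarrow> 'm \<Rightarrow> 'm) \<Rightarrow> bool" where
  "balanced \<Gamma> M A V \<beta> \<longleftrightarrow>
     (\<forall>a \<in> A. \<forall>b \<in> A. \<forall>v \<in> V. \<beta> (a + b) v = \<beta> a v + \<beta> b v) \<and>
     (\<forall>a \<in> A. \<forall>v \<in> V. \<forall>w \<in> V. \<beta> a (v + w) = \<beta> a v + \<beta> a w) \<and>
     (\<forall>a \<in> A. \<forall>v \<in> V. \<forall>c \<in> deg \<Gamma> 0. \<beta> (a * c) v = \<beta> a (act M c v))"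

text \<open>\<open>W\<close>, with the multiplication map, is the tensor product of \<open>A\<close> and \<open>V\<close> over \<open>\<Gamma>\<^sub>0\<close>.\<close>

definition is_tensor_over_degree0 ::
  "('k::field, 'v, 'a::ring) galg \<Rightarrow> ('a, 'm::ab_group_add) gmod \<Rightarrow> 'a set \<Rightarrow> 'm set \<Rightarrow> 'm set
   \<Rightarrow> bool" where
  "is_tensor_over_degree0 \<Gamma> M A V W \<longleftrightarrow>
     W = add_span {act M a v | a v. a \<in> A \<and> v \<in> V} \<and>
     (\<forall>\<beta>. balanced \<Gamma> M A V \<beta> \<longrightarrow>
        (\<exists>\<phi>. (\<forall>x \<in> W. \<forall>y \<in> W. \<phi> (x + y) = \<phi> x + \<phi> y) \<and>
             (\<forall>a \<in> A. \<forall>v \<in> V. \<phi> (act M a v) = \<beta> a v)))"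

definition cycles ::
  "(nat \<Rightarrow> 'a umod) \<Rightarrow> (nat \<Rightarrow> (nat \<Rightarrow> 'a) \<Rightarrow> nat \<Rightarrow> 'a::ring) \<Rightarrow> nat \<Rightarrow> int \<Rightarrow> (nat \<Rightarrow> 'a) set" where
  "cycles P d t r = {x \<in> mdeg (P t) r. t = 0 \<or> d t x = 0}"

definition boundaries ::
  "(nat \<Rightarrow> 'a umod) \<Rightarrow> (nat \<Rightarrow> (nat \<Rightarrow> 'a) \<Rightarrow> nat \<Rightarrow> 'a::ring) \<Rightarrow> nat \<Rightarrow> int \<Rightarrow> (nat \<Rightarrow> 'a) set" where
  "boundaries P d t r = d (Suc t) ` mdeg (P (Suc t)) r"

text \<open>
  Since \<open>P t\<close> lives in the degrees from \<open>t\<close> to \<open>p + t\<close>, homology in degree 0 occurs at position 0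
  only and homology in degree \<open>p + q\<close> at position \<open>q\<close> only; there the boundaries vanish, so that
  the homology is the group of cycles. It does not occur if \<open>p\<close> or \<open>q\<close> is infinite.
\<close>

definition pq_koszul :: "('k::field, 'v, 'a::ring) galg \<Rightarrow> enat \<Rightarrow> enat \<Rightarrow> bool" where
  "pq_koszul \<Gamma> p q \<longleftrightarrow>
     (\<forall>t. p < enat t \<longrightarrow> deg \<Gamma> t = {0}) \<and>
     (\<forall>i. \<exists>(P :: nat \<Rightarrow> 'a umod) d.
        (\<forall>t. gr_projective \<Gamma> (P t) \<and> generated_in_degree (P t) (int t)) \<and>
        (\<forall>t. q < enat t \<longrightarrow> mcar (P t) = {0}) \<and>
        (\<forall>t. gr_hom (P (Suc t)) (P t) (d (Suc t))) \<and>
        (\<forall>t. \<forall>x \<in> mcar (P (Suc (Suc t))). d (Suc t) (d (Suc (Suc t)) x) = 0) \<and>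
        (\<exists>\<epsilon>. gr_hom (P 0) (simple_mod \<Gamma> i) \<epsilon> \<and>
             \<epsilon> ` mcar (P 0) = mcar (simple_mod \<Gamma> i) \<and>
             {x \<in> cycles P d 0 0. \<epsilon> x = 0} = boundaries P d 0 0) \<and>
        (\<forall>t r. (t, r) \<noteq> (0, 0) \<and> \<not> (\<exists>p'. p = enat p' \<and> q = enat t \<and> r = int (p' + t))
               \<longrightarrow> cycles P d t r = boundaries P d t r) \<and>
        (\<forall>p' q'. p = enat p' \<and> q = enat q' \<longrightarrow>
           cycles P d q' (int (p' + q')) = {0} \<or>
           is_tensor_over_degree0 \<Gamma> (P q') (deg \<Gamma> p') (mdeg (P q') (int q'))
             (cycles P d q' (int (p' + q')))))"


section \<open>Source, sink and almost split sequences in add of the algebra\<close>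

text \<open>
  Objects are the finitely generated graded projective modules, morphisms the homomorphisms of
  degree 0. (Without the grading the category need not be Krull--Schmidt.)
\<close>

definition in_add :: "('k::field, 'v, 'a::ring) galg \<Rightarrow> 'a umod \<Rightarrow> bool" where
  "in_add \<Gamma> X \<longleftrightarrow> gr_projective \<Gamma> X \<and> fin_generated X"

text \<open>The Jacobson radical of the category: \<open>1 - g f\<close> is invertible for each \<open>g\<close>.\<close>

definition radical_map :: "('a::ring) umod \<Rightarrow> 'a umod \<Rightarrow> ((nat \<Rightarrow> 'a) \<Rightarrow> nat \<Rightarrow> 'a) \<Rightarrow> bool" where
  "radical_map X Y f \<longleftrightarrow> gr_hom X Y f \<and>
     (\<forall>g. gr_hom Y X g \<longrightarrow>
        (\<exists>h. gr_hom X X h \<and>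
             (\<forall>x \<in> mcar X. h (x - g (f x)) = x \<and> h x - g (f (h x)) = x)))"

text \<open>Source sequence \<open>C 0 \<rightarrow> C 1 \<rightarrow> C 2 \<rightarrow> \<cdots>\<close> of \<open>C 0\<close>; finite ones are continued by zero.\<close>

definition source_sequence ::
  "('k::field, 'v, 'a::ring) galg \<Rightarrow> (nat \<Rightarrow> 'a umod) \<Rightarrow> (nat \<Rightarrow> (nat \<Rightarrow> 'a) \<Rightarrow> nat \<Rightarrow> 'a) \<Rightarrow> bool"
  where
  "source_sequence \<Gamma> C f \<longleftrightarrow>
     (\<forall>t. in_add \<Gamma> (C t)) \<and>
     (\<forall>t. radical_map (C t) (C (Suc t)) (f t)) \<and>
     (\<forall>t. \<forall>x \<in> mcar (C t). f (Suc t) (f t x) = 0) \<and>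
     (\<forall>X. in_add \<Gamma> X \<longrightarrow>
        (\<forall>g. radical_map (C 0) X g \<longrightarrow>
             (\<exists>h. gr_hom (C 1) X h \<and> (\<forall>x \<in> mcar (C 0). g x = h (f 0 x)))) \<and>
        (\<forall>t g. gr_hom (C (Suc t)) X g \<and> (\<forall>x \<in> mcar (C t). g (f t x) = 0) \<longrightarrow>
             (\<exists>h. gr_hom (C (Suc (Suc t))) X h \<and>
                  (\<forall>x \<in> mcar (C (Suc t)). g x = h (f (Suc t) x)))))"

text \<open>Sink sequence \<open>\<cdots> \<rightarrow> C 2 \<rightarrow> C 1 \<rightarrow> C 0\<close> of \<open>C 0\<close>, with \<open>f t\<close> from \<open>C (Suc t)\<close> to \<open>C t\<close>\<close>

definition sink_sequence ::
  "('k::field, 'v, 'a::ring) galg \<Rightarrow> (nat \<Rightarrow> 'a umod) \<Rightarrow> (nat \<Rightarrow> (nat \<Rightarrow> 'a) \<Rightarrow> nat \<Rightarrow> 'a) \<Rightarrow> bool"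
  where
  "sink_sequence \<Gamma> C f \<longleftrightarrow>
     (\<forall>t. in_add \<Gamma> (C t)) \<and>
     (\<forall>t. radical_map (C (Suc t)) (C t) (f t)) \<and>
     (\<forall>t. \<forall>x \<in> mcar (C (Suc (Suc t))). f t (f (Suc t) x) = 0) \<and>
     (\<forall>X. in_add \<Gamma> X \<longrightarrow>
        (\<forall>g. radical_map X (C 0) g \<longrightarrow>
             (\<exists>h. gr_hom X (C 1) h \<and> (\<forall>x \<in> mcar X. g x = f 0 (h x)))) \<and>
        (\<forall>t g. gr_hom X (C (Suc t)) g \<and> (\<forall>x \<in> mcar X. f t (g x) = 0) \<longrightarrow>
             (\<exists>h. gr_hom X (C (Suc (Suc t))) h \<and> (\<forall>x \<in> mcar X. g x = f (Suc t) (h x)))))"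

text \<open>
  The finite complex \<open>0 \<rightarrow> P m \<rightarrow> \<cdots> \<rightarrow> P 1 \<rightarrow> P 0 \<rightarrow> 0\<close> as a source sequence of \<open>P m\<close> and as a sink
  sequence of \<open>P 0\<close>
\<close>

definition is_source_of_top ::
  "('k::field, 'v, 'a::ring) galg \<Rightarrow> nat \<Rightarrow> (nat \<Rightarrow> 'a umod)
   \<Rightarrow> (nat \<Rightarrow> (nat \<Rightarrow> 'a) \<Rightarrow> nat \<Rightarrow> 'a) \<Rightarrow> bool" where
  "is_source_of_top \<Gamma> m P d \<longleftrightarrow>
     source_sequence \<Gamma>
       (\<lambda>t. if t \<le> m then P (m - t) else zero_mod)
       (\<lambda>t. if t < m then d (m - t) else (\<lambda>_. 0))"

definition is_sink_of_bottom ::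
  "('k::field, 'v, 'a::ring) galg \<Rightarrow> nat \<Rightarrow> (nat \<Rightarrow> 'a umod)
   \<Rightarrow> (nat \<Rightarrow> (nat \<Rightarrow> 'a) \<Rightarrow> nat \<Rightarrow> 'a) \<Rightarrow> bool" where
  "is_sink_of_bottom \<Gamma> m P d \<longleftrightarrow>
     sink_sequence \<Gamma>
       (\<lambda>t. if t \<le> m then P t else zero_mod)
       (\<lambda>t. if t < m then d (Suc t) else (\<lambda>_. 0))"

text \<open>\<open>0 \<rightarrow> P (n+1) \<rightarrow> P n \<rightarrow> \<cdots> \<rightarrow> P 1 \<rightarrow> P 0 \<rightarrow> 0\<close> is an \<open>n\<close>-almost split sequence.\<close>

definition almost_split_sequence ::
  "('k::field, 'v, 'a::ring) galg \<Rightarrow> nat \<Rightarrow> (nat \<Rightarrow> 'a umod)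
   \<Rightarrow> (nat \<Rightarrow> (nat \<Rightarrow> 'a) \<Rightarrow> nat \<Rightarrow> 'a) \<Rightarrow> bool" where
  "almost_split_sequence \<Gamma> n P d \<longleftrightarrow>
     is_source_of_top \<Gamma> (n + 1) P d \<and> is_sink_of_bottom \<Gamma> (n + 1) P d"

definition exact_at_left_end ::
  "nat \<Rightarrow> (nat \<Rightarrow> 'a umod) \<Rightarrow> (nat \<Rightarrow> (nat \<Rightarrow> 'a) \<Rightarrow> nat \<Rightarrow> 'a::ring) \<Rightarrow> bool" where
  "exact_at_left_end m P d \<longleftrightarrow> {x \<in> mcar (P m). d m x = 0} = {0}"

end

(* The graded Nakayama lemma makes a chain endomorphism of the minimal resolution invertible as soon
   as the map that it induces on S(i) is, and the Koszul complex, being minimal, is isomorphic to the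
   resolution up to position n+1; hence its terms P^t there are finitely generated and bounded below.

   If the complex is exact at P^(n+1), then maps out of its terms factor as required because Hom(-,Gamma) of the
   resolution is exact in the middle. At the top Ext^(n+1)(S(i),Gamma) is one-dimensional, so a map u to
   Gamma that does not factor through P^n generates all such maps modulo those that do and that have
   values in the radical; a dual basis of P^(n+1) then expresses the identity through u modulo the
   radical, and u is not radical.

   Conversely, a source sequence extends endomorphisms of P^(n+1) to the complex. A generator g of Ext^(n+1)
   is not radical, so 1 - wg is not invertible for some w; as S(i) is simple, wg is then invertible, and as
   it kills the kernel of P^(n+1) -> P^n, that kernel is zero. A radical map to P^0 cannot be onto S(i), so
   its image lies in the image of P^1; this gives the sink sequence. *)

theory Submission
  imports Defs
begin

section \<open>Graded groups\<close>

text \<open>A term of a resolution is only known to be graded projective, possibly unbounded below,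
  so Nakayama's lemma does not apply to it at the outset. The two halves of invertibility are
  therefore kept apart. Injectivity of \<open>1 - \<psi>\<close>, for an endomorphism \<psi> with
  radical image, needs no bound: a fixed vector of \<psi> lies in every step of the radical
  filtration, and a projective is separated for this filtration. Surjectivity needs a bound, which
  the Koszul terms have because each is generated in one degree. The Koszul terms are finitely
  generated because the generating degree of each embeds into what the arrows produce from the
  generating degree of the preceding one. Ext concerns maps of all degrees into the single module
  \<Gamma>, the category concerns degree 0 maps between finitely generated projectives. Dual bases
  translate from the former to the latter, and the objects \<open>\<Gamma>E[-l]\<close>, with
  \<open>E\<close> a finite sum of vertex idempotents, translate back.\<close>

lemma add_span_zero: "0 \<in> add_span S"
  unfolding add_span_def by (rule CollectI, rule exI[of _ 0]) auto

lemma add_span_base_add: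
  assumes "x \<in> S" "y \<in> add_span S" shows "x + y \<in> add_span S"
proof -
  from assms(2) obtain m z where y: "y = (\<Sum>k<(m::nat). z k)" "\<forall>k<m. z k \<in> S"
    unfolding add_span_def by blast
  have "x + y = (\<Sum>k<Suc m. (z(m := x)) k)" using y by (simp add: add.commute)
  moreover have "\<forall>k<Suc m. (z(m := x)) k \<in> S" using y assms by (auto simp: less_Suc_eq)
  ultimately show ?thesis unfolding add_span_def by blast
qed

lemma add_span_base: "x \<in> S \<Longrightarrow> x \<in> add_span S"
  using add_span_base_add[of x S 0] add_span_zero[of S] by simp

lemma add_span_induct [consumes 1, case_names zero add]:
  assumes "x \<in> add_span S" and "Q 0"
    and step: "\<And>x y. x \<in> S \<Longrightarrow> y \<in> add_span S \<Longrightarrow> Q y \<Longrightarrow> Q (x + y)"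
  shows "Q x"
proof -
  have "(\<forall>k<m. z k \<in> S) \<Longrightarrow> Q (\<Sum>k<m. z k) \<and> (\<Sum>k<m. z k) \<in> add_span S" for m :: nat and z
  proof (induction m)
    case 0 then show ?case using assms add_span_zero by auto
  next
    case (Suc m)
    then have "Q (\<Sum>k<m. z k)" "(\<Sum>k<m. z k) \<in> add_span S" "z m \<in> S" by auto
    then show ?case using step add_span_base_add by (simp add: add.commute)
  qed
  then show ?thesis using assms(1) unfolding add_span_def by blast
qed

lemma add_span_add: "x \<in> add_span S \<Longrightarrow> y \<in> add_span S \<Longrightarrow> x + y \<in> add_span S"
  by (induction rule: add_span_induct) (auto simp: add.assoc intro: add_span_base_add)

lemma add_span_uminus:
  assumes "\<And>x. x \<in> S \<Longrightarrow> - x \<in> S" shows "x \<in> add_span S \<Longrightarrow> - x \<in> add_span S"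
proof (induction rule: add_span_induct)
  case (add x y)
  have "- (x + y) = - x + - y" by simp
  then show ?case using add assms by (metis add_span_base_add)
qed (simp add: add_span_zero)

lemma add_span_sum:
  assumes "\<And>k. k \<in> F \<Longrightarrow> z k \<in> add_span S" shows "sum z F \<in> add_span S"
  using assms by (induction F rule: infinite_finite_induct) (auto intro: add_span_zero add_span_add)

lemma add_span_subset:
  assumes "S \<subseteq> T" "0 \<in> T" "\<And>x y. x \<in> T \<Longrightarrow> y \<in> T \<Longrightarrow> x + y \<in> T"
  shows "add_span S \<subseteq> T"
proof
  fix x assume "x \<in> add_span S" then show "x \<in> T"
    by (induction rule: add_span_induct) (use assms in auto)
qed

lemma add_span_mono: "S \<subseteq> T \<Longrightarrow> add_span S \<subseteq> add_span T"
  by (rule add_span_subset) (auto intro: add_span_base add_span_zero add_span_add)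

text \<open>The component of \<open>x\<close> in degree \<open>t\<close>. Summing over the support
  lets a total function replace a finite set with a family on it; the value is arbitrary for
  \<open>x\<close> outside the sum of the \<open>A t\<close>.\<close>

definition hcomp :: "('t \<Rightarrow> 'm::ab_group_add set) \<Rightarrow> 'm \<Rightarrow> 't \<Rightarrow> 'm" where
  "hcomp A x = (SOME g. finite {t. g t \<noteq> 0} \<and> (\<forall>t. g t \<in> A t) \<and> x = (\<Sum>t | g t \<noteq> 0. g t))"

locale graded_group =
  fixes A :: "'t \<Rightarrow> 'm::ab_group_add set"
  assumes zero_mem: "0 \<in> A t"
    and diff_mem: "x \<in> A t \<Longrightarrow> y \<in> A t \<Longrightarrow> x - y \<in> A t"
begin

lemma uminus_mem: "x \<in> A t \<Longrightarrow> - x \<in> A t"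
  using diff_mem[OF zero_mem] by fastforce

lemma add_mem: "x \<in> A t \<Longrightarrow> y \<in> A t \<Longrightarrow> x + y \<in> A t"
  using diff_mem[of x t "- y"] uminus_mem by fastforce

lemma sum_mem: "(\<And>k. k \<in> F \<Longrightarrow> z k \<in> A t) \<Longrightarrow> sum z F \<in> A t"
  by (induction F rule: infinite_finite_induct) (auto intro: zero_mem add_mem)

lemma family_sum_eq: "family_sum A = add_span (\<Union>t. A t)"
proof
  show "family_sum A \<subseteq> add_span (\<Union>t. A t)"
  proof
    fix x assume "x \<in> family_sum A"
    then obtain F y where "finite F" "\<forall>t\<in>F. y t \<in> A t" "x = (\<Sum>t\<in>F. y t)"
      unfolding family_sum_def by blast
    moreover have "(\<Sum>t\<in>F. y t) \<in> add_span (\<Union>t. A t)" if "\<forall>t\<in>F. y t \<in> A t"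
      using that by (intro add_span_sum add_span_base) blast
    ultimately show "x \<in> add_span (\<Union>t. A t)" by simp
  qed
next
  show "add_span (\<Union>t. A t) \<subseteq> family_sum A"
  proof
    fix x assume "x \<in> add_span (\<Union>t. A t)"
    then show "x \<in> family_sum A"
    proof (induction rule: add_span_induct)
      case zero show ?case unfolding family_sum_def by (rule CollectI) (rule exI[of _ "{}"], auto)
    next
      case (add x y)
      obtain s where s: "x \<in> A s" using add by auto
      obtain F z where F: "finite F" "\<forall>t\<in>F. z t \<in> A t" "y = (\<Sum>t\<in>F. z t)"
        using add unfolding family_sum_def by blast
      \<comment> \<open>The degree \<open>s\<close> may already occur in \<open>F\<close>, so
        \<open>x\<close> is added to the component there rather than appended.\<close>
      let ?z = "\<lambda>t. (if t \<in> F then z t else 0) + (if t = s then x else 0)"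
      have "(\<Sum>t\<in>insert s F. ?z t) = (\<Sum>t\<in>insert s F. (if t \<in> F then z t else 0)) + x"
        using F(1) by (simp add: sum.distrib)
      also have "(\<Sum>t\<in>insert s F. (if t \<in> F then z t else 0)) = y"
        unfolding F(3) using F(1) by (intro sum.mono_neutral_cong_right) auto
      finally have "x + y = (\<Sum>t\<in>insert s F. ?z t)" by (simp add: add.commute)
      moreover have "\<forall>t\<in>insert s F. ?z t \<in> A t" using F s by (auto intro: zero_mem add_mem)
      ultimately show ?case using F(1) unfolding family_sum_def by blast
    qed
  qed
qed

lemma family_sum_zero: "0 \<in> family_sum A"
  unfolding family_sum_eq by (rule add_span_zero)

lemma family_sum_add: "x \<in> family_sum A \<Longrightarrow> y \<in> family_sum A \<Longrightarrow> x + y \<in> family_sum A"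
  unfolding family_sum_eq by (rule add_span_add)

lemma family_sum_uminus: "x \<in> family_sum A \<Longrightarrow> - x \<in> family_sum A"
  unfolding family_sum_eq by (rule add_span_uminus) (auto intro: uminus_mem)

lemma family_sum_diff: "x \<in> family_sum A \<Longrightarrow> y \<in> family_sum A \<Longrightarrow> x - y \<in> family_sum A"
  using family_sum_add[of x "- y"] family_sum_uminus by simp

lemma family_sum_sum: "(\<And>k. k \<in> F \<Longrightarrow> z k \<in> family_sum A) \<Longrightarrow> sum z F \<in> family_sum A"
  unfolding family_sum_eq by (rule add_span_sum)

lemma mem_family_sum: "x \<in> A t \<Longrightarrow> x \<in> family_sum A"
  unfolding family_sum_eq by (rule add_span_base) auto

lemma family_sum_induct [consumes 1, case_names zero add]:
  assumes "x \<in> family_sum A" and "Q 0"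
    and "\<And>t x y. x \<in> A t \<Longrightarrow> y \<in> family_sum A \<Longrightarrow> Q y \<Longrightarrow> Q (x + y)"
  shows "Q x"
  using assms(1) unfolding family_sum_eq
  by (induction rule: add_span_induct) (use assms family_sum_eq in auto)

lemma subgroup_indep:
  assumes "family_indep B" "\<And>t. A t \<subseteq> B t" shows "family_indep A"
  using assms unfolding family_indep_def by (meson subsetD)

end

section \<open>Homogeneous components\<close>

locale indep_graded_group = graded_group +
  assumes indep: "family_indep A"
begin

lemma family_sum_decomp:
  assumes "x \<in> family_sum A"
  shows "\<exists>g. finite {t. g t \<noteq> 0} \<and> (\<forall>t. g t \<in> A t) \<and> x = (\<Sum>t | g t \<noteq> 0. g t)"
proof -
  obtain F z where F: "finite F" "\<forall>t\<in>F. z t \<in> A t" "x = (\<Sum>t\<in>F. z t)"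
    using assms unfolding family_sum_def by blast
  let ?z = "\<lambda>t. if t \<in> F then z t else 0"
  have "finite {t. ?z t \<noteq> 0}" by (rule finite_subset[OF _ F(1)]) auto
  moreover have "\<forall>t. ?z t \<in> A t" using F zero_mem by auto
  moreover have "x = (\<Sum>t | ?z t \<noteq> 0. ?z t)"
    unfolding F(3) using F(1) by (intro sum.mono_neutral_cong_right) auto
  ultimately show ?thesis by (intro exI[of _ ?z]) blast
qed

lemma hcomp_props:
  assumes "x \<in> family_sum A"
  shows "finite {t. hcomp A x t \<noteq> 0}" "hcomp A x t \<in> A t" "x = (\<Sum>t | hcomp A x t \<noteq> 0. hcomp A x t)"
proof -
  have "finite {t. hcomp A x t \<noteq> 0} \<and> (\<forall>t. hcomp A x t \<in> A t)
      \<and> x = (\<Sum>t | hcomp A x t \<noteq> 0. hcomp A x t)"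
    using someI_ex[OF family_sum_decomp[OF assms]] unfolding hcomp_def[symmetric] .
  then show "finite {t. hcomp A x t \<noteq> 0}" "hcomp A x t \<in> A t"
    "x = (\<Sum>t | hcomp A x t \<noteq> 0. hcomp A x t)" by blast+
qed

text \<open>Independence is applied to the difference of the two decompositions over a finite set
  that contains both supports.\<close>

lemma hcomp_unique:
  assumes "finite F" "\<And>t. t \<in> F \<Longrightarrow> g t \<in> A t" "\<And>t. t \<notin> F \<Longrightarrow> g t = 0" "x = (\<Sum>t\<in>F. g t)"
  shows "hcomp A x = g"
proof
  fix t
  have x: "x \<in> family_sum A" using assms unfolding family_sum_def by blast
  let ?G = "insert t (F \<union> {t. hcomp A x t \<noteq> 0})"
  have fin: "finite ?G" using assms(1) hcomp_props[OF x] by auto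
  have mem: "\<forall>t\<in>?G. hcomp A x t - g t \<in> A t"
    using assms hcomp_props[OF x] by (metis diff_mem zero_mem)
  have "(\<Sum>t | hcomp A x t \<noteq> 0. hcomp A x t) = (\<Sum>t\<in>?G. hcomp A x t)"
    by (rule sum.mono_neutral_left) (use fin in auto)
  then have "(\<Sum>t\<in>?G. hcomp A x t) = x" using hcomp_props(3)[OF x] by metis
  moreover have "(\<Sum>t\<in>F. g t) = (\<Sum>t\<in>?G. g t)"
    by (rule sum.mono_neutral_left) (use fin assms(3) in auto)
  then have "(\<Sum>t\<in>?G. g t) = x" using assms(4) by metis
  ultimately have "(\<Sum>t\<in>?G. hcomp A x t - g t) = 0" by (simp only: diff_self sum_subtractf)
  then have "hcomp A x t - g t = 0" using indep fin mem unfolding family_indep_def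
    by (metis (mono_tags, lifting) insertI1)
  then show "hcomp A x t = g t" by simp
qed

lemma hcomp_homogeneous: "x \<in> A s \<Longrightarrow> hcomp A x = (\<lambda>t. if t = s then x else 0)"
  by (rule hcomp_unique[of "{s}"]) auto

lemma hcomp_zero: "hcomp A 0 t = 0"
  using fun_cong[OF hcomp_unique[of "{}" "\<lambda>_. 0" 0]] by simp

lemma hcomp_add:
  assumes "x \<in> family_sum A" "y \<in> family_sum A"
  shows "hcomp A (x + y) t = hcomp A x t + hcomp A y t"
proof -
  let ?F = "{t. hcomp A x t \<noteq> 0} \<union> {t. hcomp A y t \<noteq> 0}"
  have fin: "finite ?F" using hcomp_props assms by simp
  have 1: "x = (\<Sum>t\<in>?F. hcomp A x t)"
  proof -
    have "(\<Sum>t | hcomp A x t \<noteq> 0. hcomp A x t) = (\<Sum>t\<in>?F. hcomp A x t)"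
      by (rule sum.mono_neutral_left) (use fin in auto)
    then show ?thesis using hcomp_props(3)[OF assms(1)] by metis
  qed
  have 2: "y = (\<Sum>t\<in>?F. hcomp A y t)"
  proof -
    have "(\<Sum>t | hcomp A y t \<noteq> 0. hcomp A y t) = (\<Sum>t\<in>?F. hcomp A y t)"
      by (rule sum.mono_neutral_left) (use fin in auto)
    then show ?thesis using hcomp_props(3)[OF assms(2)] by metis
  qed
  have "hcomp A (x + y) = (\<lambda>t. hcomp A x t + hcomp A y t)"
  proof (rule hcomp_unique[OF fin])
    have "(\<Sum>t\<in>?F. hcomp A x t + hcomp A y t)
        = (\<Sum>t\<in>?F. hcomp A x t) + (\<Sum>t\<in>?F. hcomp A y t)" by (rule sum.distrib)
    then show "x + y = (\<Sum>t\<in>?F. hcomp A x t + hcomp A y t)" using 1 2 by metis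
  qed (use hcomp_props(2) assms add_mem in auto)
  then show ?thesis by simp
qed

lemma hcomp_uminus:
  assumes "x \<in> family_sum A" shows "hcomp A (- x) t = - hcomp A x t"
  using hcomp_add[OF assms family_sum_uminus[OF assms], of t] hcomp_zero[of t]
  by (simp add: minus_unique)

lemma hcomp_diff:
  assumes "x \<in> family_sum A" "y \<in> family_sum A"
  shows "hcomp A (x - y) t = hcomp A x t - hcomp A y t"
  using hcomp_add[OF assms(1) family_sum_uminus[OF assms(2)]] hcomp_uminus[OF assms(2)] by simp

lemma hcomp_eq_zero: "x \<in> family_sum A \<Longrightarrow> (\<And>t. hcomp A x t = 0) \<Longrightarrow> x = 0"
  using hcomp_props(3)[of x] by (metis (mono_tags, lifting) sum.neutral)

end

lemma family_indepD:
  assumes "family_indep A" "finite F" "\<forall>t\<in>F. x t \<in> A t" "(\<Sum>t\<in>F. x t) = 0" "t \<in> F"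
  shows "x t = 0"
proof -
  have "finite F \<and> (\<forall>t\<in>F. x t \<in> A t) \<and> (\<Sum>t\<in>F. x t) = 0 \<longrightarrow> (\<forall>t\<in>F. x t = 0)"
    using assms(1) unfolding family_indep_def by (elim allE)
  then show ?thesis using assms by simp
qed

section \<open>Graded modules and their homomorphisms\<close>

locale graded_alg =
  fixes \<Gamma> :: "('k::field, 'v, 'a::ring) galg"
  assumes alg: "graded_quiver_algebra \<Gamma>"
begin

sublocale V: vector_space "scl \<Gamma>"
  using alg unfolding graded_quiver_algebra_def by (elim conjE)

lemma scl_left: "scl \<Gamma> c (a * b) = scl \<Gamma> c a * b"
  and scl_right: "scl \<Gamma> c (a * b) = a * scl \<Gamma> c b"
proof -
  have "\<forall>c a b. scl \<Gamma> c (a * b) = scl \<Gamma> c a * b \<and> scl \<Gamma> c (a * b) = a * scl \<Gamma> c b"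
    using alg unfolding graded_quiver_algebra_def by (elim conjE)
  then show "scl \<Gamma> c (a * b) = scl \<Gamma> c a * b" "scl \<Gamma> c (a * b) = a * scl \<Gamma> c b" by blast+
qed

lemma deg_subspace: "V.subspace (deg \<Gamma> t)"
proof -
  have "\<forall>t. V.subspace (deg \<Gamma> t)" using alg unfolding graded_quiver_algebra_def by (elim conjE)
  then show ?thesis by blast
qed

lemma deg_mult: "a \<in> deg \<Gamma> s \<Longrightarrow> b \<in> deg \<Gamma> t \<Longrightarrow> a * b \<in> deg \<Gamma> (s + t)"
proof -
  have "\<forall>s t. \<forall>a \<in> deg \<Gamma> s. \<forall>b \<in> deg \<Gamma> t. a * b \<in> deg \<Gamma> (s + t)"
    using alg unfolding graded_quiver_algebra_def by (elim conjE)
  then show "a \<in> deg \<Gamma> s \<Longrightarrow> b \<in> deg \<Gamma> t \<Longrightarrow> a * b \<in> deg \<Gamma> (s + t)" by blast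
qed

lemma idem_mult: "idem \<Gamma> i * idem \<Gamma> j = (if i = j then idem \<Gamma> i else 0)"
proof -
  have "\<forall>i j. idem \<Gamma> i * idem \<Gamma> j = (if i = j then idem \<Gamma> i else 0)"
    using alg unfolding graded_quiver_algebra_def by (elim conjE)
  then show ?thesis by blast
qed

lemma idem_nonzero: "idem \<Gamma> i \<noteq> 0"
proof -
  have "\<forall>i. idem \<Gamma> i \<noteq> 0" using alg unfolding graded_quiver_algebra_def by (elim conjE)
  then show ?thesis by blast
qed

lemma deg0: "deg \<Gamma> 0 = V.span (range (idem \<Gamma>))"
  using alg unfolding graded_quiver_algebra_def by (elim conjE)

lemma local_unit: "\<exists>F. finite F \<and> (\<Sum>i\<in>F. idem \<Gamma> i) * a = a \<and> a * (\<Sum>i\<in>F. idem \<Gamma> i) = a"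
proof -
  have "\<forall>a. \<exists>F. finite F \<and> (\<Sum>i\<in>F. idem \<Gamma> i) * a = a \<and> a * (\<Sum>i\<in>F. idem \<Gamma> i) = a"
    using alg unfolding graded_quiver_algebra_def by (elim conjE)
  then show ?thesis by blast
qed

lemma arrows_finite: "\<exists>B. finite B \<and> {a * idem \<Gamma> i | a. a \<in> deg \<Gamma> 1} \<subseteq> V.span B"
proof -
  have "\<forall>i. \<exists>B. finite B \<and> {a * idem \<Gamma> i | a. a \<in> deg \<Gamma> 1} \<subseteq> V.span B"
    using alg unfolding graded_quiver_algebra_def by (elim conjE)
  then show ?thesis by blast
qed

lemma deg_group: "indep_graded_group (deg \<Gamma>)"
proof
  show "family_indep (deg \<Gamma>)" using alg unfolding graded_quiver_algebra_def by (elim conjE)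
qed (auto intro: V.subspace_0 V.subspace_diff deg_subspace)

lemma deg_sum_UNIV: "family_sum (deg \<Gamma>) = UNIV"
  using alg unfolding graded_quiver_algebra_def by (elim conjE)

lemma alg_induct [case_names zero add]:
  assumes "Q 0" "\<And>s a b. a \<in> deg \<Gamma> s \<Longrightarrow> Q b \<Longrightarrow> Q (a + b)" shows "Q (a :: 'a)"
proof -
  interpret indep_graded_group "deg \<Gamma>" by (rule deg_group)
  have "a \<in> family_sum (deg \<Gamma>)" by (simp add: deg_sum_UNIV)
  then show ?thesis by (induction rule: family_sum_induct) (use assms in auto)
qed

lemma idem_deg0: "idem \<Gamma> i \<in> deg \<Gamma> 0" "scl \<Gamma> c (idem \<Gamma> i) \<in> deg \<Gamma> 0"
  unfolding deg0 by (auto intro: V.span_base V.span_scale)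

lemma idem_sum_deg0: "(\<Sum>i\<in>F. idem \<Gamma> i) \<in> deg \<Gamma> 0"
  by (intro V.subspace_sum deg_subspace idem_deg0)

lemma idem_sum_mult_idem: "finite F \<Longrightarrow> i \<in> F \<Longrightarrow> (\<Sum>i\<in>F. idem \<Gamma> i) * idem \<Gamma> i = idem \<Gamma> i"
  by (simp add: sum_distrib_right idem_mult sum.delta')

lemma idem_mult_idem_sum: "finite F \<Longrightarrow> i \<in> F \<Longrightarrow> idem \<Gamma> i * (\<Sum>i\<in>F. idem \<Gamma> i) = idem \<Gamma> i"
  by (simp add: sum_distrib_left idem_mult sum.delta)

lemma idem_sum_mult:
  assumes "finite G" "F \<subseteq> G"
  shows "(\<Sum>i\<in>G. idem \<Gamma> i) * (\<Sum>i\<in>F. idem \<Gamma> i) = (\<Sum>i\<in>F. idem \<Gamma> i)"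
    "(\<Sum>i\<in>F. idem \<Gamma> i) * (\<Sum>i\<in>G. idem \<Gamma> i) = (\<Sum>i\<in>F. idem \<Gamma> i)"
proof -
  show "(\<Sum>i\<in>G. idem \<Gamma> i) * (\<Sum>i\<in>F. idem \<Gamma> i) = (\<Sum>i\<in>F. idem \<Gamma> i)"
    unfolding sum_distrib_left using assms idem_sum_mult_idem by (intro sum.cong) auto
  show "(\<Sum>i\<in>F. idem \<Gamma> i) * (\<Sum>i\<in>G. idem \<Gamma> i) = (\<Sum>i\<in>F. idem \<Gamma> i)"
    unfolding sum_distrib_right using assms idem_mult_idem_sum by (intro sum.cong) auto
qed

text \<open>The union of the vertex sets that serve the single elements serves all of them, since a
  larger sum of idempotents acts as a unit on a smaller one.\<close>

lemma local_unit_finite: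
  assumes "finite B"
  shows "\<exists>F. finite F \<and> (\<forall>a\<in>B. (\<Sum>i\<in>F. idem \<Gamma> i) * a = a \<and> a * (\<Sum>i\<in>F. idem \<Gamma> i) = a)"
proof -
  obtain G where G: "\<And>a. finite (G a) \<and> (\<Sum>i\<in>G a. idem \<Gamma> i) * a = a \<and> a * (\<Sum>i\<in>G a. idem \<Gamma> i) = a"
    using local_unit by metis
  have fin: "finite (\<Union>a\<in>B. G a)" using assms G by blast
  have "(\<Sum>i\<in>(\<Union>a\<in>B. G a). idem \<Gamma> i) * a = a \<and> a * (\<Sum>i\<in>(\<Union>a\<in>B. G a). idem \<Gamma> i) = a"
    if "a \<in> B" for a
  proof -
    have sub: "G a \<subseteq> (\<Union>a\<in>B. G a)" using that by blast
    show ?thesis using idem_sum_mult[OF fin sub] G[of a] by (metis mult.assoc)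
  qed
  then show ?thesis using fin by blast
qed

section \<open>Graded modules\<close>

context
  fixes M :: "('a, 'm::ab_group_add) gmod"
  assumes M: "gmodule \<Gamma> M"
begin

lemma mdeg_group: "indep_graded_group (mdeg M)"
  using M unfolding gmodule_def by unfold_locales auto

interpretation indep_graded_group "mdeg M" by (rule mdeg_group)

lemmas mdeg_zero = zero_mem and mdeg_diff = diff_mem
  and mdeg_add = add_mem and mdeg_sum = sum_mem
lemmas mcar_zero = family_sum_zero[folded mcar_def] and mcar_add = family_sum_add[folded mcar_def]
  and mcar_uminus = family_sum_uminus[folded mcar_def] and mcar_diff = family_sum_diff[folded mcar_def]
  and mcar_sum = family_sum_sum[folded mcar_def] and mdeg_mcar = mem_family_sum[folded mcar_def]
  and comp_mdeg = hcomp_props(2)[folded mcar_def] and comp_finite = hcomp_props(1)[folded mcar_def]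
  and comp_sum = hcomp_props(3)[folded mcar_def] and comp_homogeneous = hcomp_homogeneous
  and comp_zero = hcomp_zero and comp_add = hcomp_add[folded mcar_def]
  and comp_diff = hcomp_diff[folded mcar_def] and comp_eq_zero = hcomp_eq_zero[folded mcar_def]

lemma act_mdeg: "a \<in> deg \<Gamma> s \<Longrightarrow> x \<in> mdeg M t \<Longrightarrow> act M a x \<in> mdeg M (int s + t)"
  using M unfolding gmodule_def by blast

lemma act_add_right: "x \<in> mcar M \<Longrightarrow> y \<in> mcar M \<Longrightarrow> act M a (x + y) = act M a x + act M a y"
  using M unfolding gmodule_def by blast

lemma act_add_left: "x \<in> mcar M \<Longrightarrow> act M (a + b) x = act M a x + act M b x"
  using M unfolding gmodule_def by blast

lemma act_mult: "x \<in> mcar M \<Longrightarrow> act M (a * b) x = act M a (act M b x)"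
  using M unfolding gmodule_def by blast

lemma act_local_unit: "x \<in> mcar M \<Longrightarrow> \<exists>F. finite F \<and> act M (\<Sum>i\<in>F. idem \<Gamma> i) x = x"
  using M unfolding gmodule_def by blast

lemma act_zero_right: "act M a 0 = 0"
  using act_add_right[OF mcar_zero mcar_zero, of a] by simp

lemma act_zero_left: "x \<in> mcar M \<Longrightarrow> act M 0 x = 0"
  using act_add_left[of x 0 0] by simp

lemma act_mcar:
  assumes "x \<in> mcar M" shows "act M a x \<in> mcar M"
proof (induction a rule: alg_induct)
  case zero then show ?case using act_zero_left assms mcar_zero by simp
next
  case (add s a b)
  have "act M a x \<in> mcar M" using assms unfolding mcar_def
  proof (induction rule: family_sum_induct)
    case zero then show ?case using act_zero_right family_sum_zero by simp
  next
    case (add t x y)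
    then show ?case
      using act_add_right[OF mdeg_mcar, unfolded mcar_def] family_sum_add
        mem_family_sum[OF act_mdeg] \<open>a \<in> deg \<Gamma> s\<close> by metis
  qed
  then show ?case using add act_add_left assms mcar_add by simp
qed

lemma act_uminus_right: "x \<in> mcar M \<Longrightarrow> act M a (- x) = - act M a x"
  using act_add_right[of x "- x" a] mcar_uminus act_zero_right by (simp add: minus_unique)

lemma act_uminus_left: "x \<in> mcar M \<Longrightarrow> act M (- a) x = - act M a x"
  using act_add_left[of x a "- a"] act_zero_left by (simp add: minus_unique)

lemma act_diff_right: "x \<in> mcar M \<Longrightarrow> y \<in> mcar M \<Longrightarrow> act M a (x - y) = act M a x - act M a y"
  using act_add_right[of x "- y" a] mcar_uminus act_uminus_right by simp

lemma act_diff_left: "x \<in> mcar M \<Longrightarrow> act M (a - b) x = act M a x - act M b x"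
  using act_add_left[of x a "- b"] act_uminus_left by simp

lemma act_sum_right:
  "(\<And>k. k \<in> F \<Longrightarrow> z k \<in> mcar M) \<Longrightarrow> act M a (sum z F) = (\<Sum>k\<in>F. act M a (z k))"
proof (induction F rule: infinite_finite_induct)
  case (insert x F)
  then have "act M a (z x + sum z F) = act M a (z x) + act M a (sum z F)"
    by (intro act_add_right mcar_sum) auto
  then show ?case using insert by simp
qed (auto simp: act_zero_right)

lemma act_sum_left:
  "x \<in> mcar M \<Longrightarrow> act M (sum c F) x = (\<Sum>k\<in>F. act M (c k) x)"
  by (induction F rule: infinite_finite_induct) (auto simp: act_zero_left act_add_left)

lemma act_unit_superset:
  assumes "x \<in> mcar M" "act M (\<Sum>i\<in>F. idem \<Gamma> i) x = x" "F \<subseteq> G" "finite G"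
  shows "act M (\<Sum>i\<in>G. idem \<Gamma> i) x = x"
  using act_mult[OF assms(1), of "\<Sum>i\<in>G. idem \<Gamma> i" "\<Sum>i\<in>F. idem \<Gamma> i"] assms idem_sum_mult(1)[OF assms(4,3)]
  by simp

lemma comp_act:
  assumes a: "a \<in> deg \<Gamma> s" and x: "x \<in> mcar M"
  shows "hcomp (mdeg M) (act M a x) t = act M a (hcomp (mdeg M) x (t - int s))"
  using x unfolding mcar_def
proof (induction rule: family_sum_induct)
  case zero then show ?case by (simp add: act_zero_right comp_zero)
next
  case (add r x y)
  note add = add[folded mcar_def]
  have "hcomp (mdeg M) (act M a (x + y)) t
      = hcomp (mdeg M) (act M a x) t + hcomp (mdeg M) (act M a y) t"
    using add act_add_right comp_add act_mcar mdeg_mcar by metis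
  also have "hcomp (mdeg M) (act M a x) t = act M a (hcomp (mdeg M) x (t - int s))"
    unfolding comp_homogeneous[OF add(1)] comp_homogeneous[OF act_mdeg[OF a add(1)]]
    by (auto simp: act_zero_right)
  finally show ?case using add act_add_right comp_add mdeg_mcar comp_mdeg by metis
qed

lemma submodule_gmodule:
  assumes sub: "\<And>t. D t \<subseteq> mdeg M t" and zero: "\<And>t. 0 \<in> D t"
    and diff: "\<And>t x y. x \<in> D t \<Longrightarrow> y \<in> D t \<Longrightarrow> x - y \<in> D t"
    and act: "\<And>s t a x. a \<in> deg \<Gamma> s \<Longrightarrow> x \<in> D t \<Longrightarrow> act M a x \<in> D (int s + t)"
  shows "gmodule \<Gamma> \<lparr>mdeg = D, act = act M\<rparr>" "mcar \<lparr>mdeg = D, act = act M\<rparr> \<subseteq> mcar M"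
proof -
  interpret D: graded_group D using zero diff by unfold_locales
  have sub': "family_sum D \<subseteq> mcar M"
    using sub unfolding family_sum_eq mcar_def D.family_sum_eq by (intro add_span_mono) blast
  then show "mcar \<lparr>mdeg = D, act = act M\<rparr> \<subseteq> mcar M" by (simp add: mcar_def)
  have "family_indep D" by (rule D.subgroup_indep[OF indep sub])
  then show "gmodule \<Gamma> \<lparr>mdeg = D, act = act M\<rparr>"
    unfolding gmodule_def mcar_def gmod.simps
    using subsetD[OF sub']
    by (auto simp: act_add_right act_add_left act_mult act_local_unit intro: zero diff act)
qed

end

section \<open>Induction over elements and graded homomorphisms\<close>

lemma mcar_induct [consumes 2, case_names zero add]:
  assumes "gmodule \<Gamma> M" "x \<in> mcar M" "Q 0"
    and "\<And>t x y. x \<in> mdeg M t \<Longrightarrow> y \<in> mcar M \<Longrightarrow> Q y \<Longrightarrow> Q (x + y)"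
  shows "Q x"
proof -
  interpret indep_graded_group "mdeg M" by (rule mdeg_group[OF assms(1)])
  show ?thesis
    using assms(2) unfolding mcar_def
    by (induction rule: family_sum_induct) (use assms in \<open>auto simp: mcar_def\<close>)
qed

text \<open>Both ends are required to be modules, so that the closure properties below carry few
  side conditions; \<open>gr_hom\<close> alone does not provide this.\<close>

definition ghom :: "('a, 'm::ab_group_add) gmod \<Rightarrow> ('a, 'n::ab_group_add) gmod \<Rightarrow> ('m \<Rightarrow> 'n) \<Rightarrow> bool"
  where "ghom M N f \<longleftrightarrow> gmodule \<Gamma> M \<and> gmodule \<Gamma> N \<and> gr_hom M N f"

lemma ghomI:
  assumes "gmodule \<Gamma> M" "gmodule \<Gamma> N" "\<And>t x. x \<in> mdeg M t \<Longrightarrow> f x \<in> mdeg N t"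
    "\<And>x y. x \<in> mcar M \<Longrightarrow> y \<in> mcar M \<Longrightarrow> f (x + y) = f x + f y"
    "\<And>a x. x \<in> mcar M \<Longrightarrow> f (act M a x) = act N a (f x)"
  shows "ghom M N f"
  using assms unfolding ghom_def gr_hom_def by blast

lemma ghom_gmodule: "ghom M N f \<Longrightarrow> gmodule \<Gamma> M" "ghom M N f \<Longrightarrow> gmodule \<Gamma> N"
  unfolding ghom_def by auto

lemma ghom_gr_hom: "ghom M N f \<Longrightarrow> gr_hom M N f"
  unfolding ghom_def by auto

lemma ghom_mdeg: "ghom M N f \<Longrightarrow> x \<in> mdeg M t \<Longrightarrow> f x \<in> mdeg N t"
  unfolding ghom_def gr_hom_def by auto

lemma ghom_add: "ghom M N f \<Longrightarrow> x \<in> mcar M \<Longrightarrow> y \<in> mcar M \<Longrightarrow> f (x + y) = f x + f y"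
  unfolding ghom_def gr_hom_def by blast

lemma ghom_act: "ghom M N f \<Longrightarrow> x \<in> mcar M \<Longrightarrow> f (act M a x) = act N a (f x)"
  unfolding ghom_def gr_hom_def by blast

lemma ghom_zero: assumes "ghom M N f" shows "f 0 = 0"
  using ghom_add[OF assms, of 0 0] mcar_zero[OF ghom_gmodule(1)[OF assms]] by simp

lemma ghom_mcar:
  assumes f: "ghom M N f" and "x \<in> mcar M" shows "f x \<in> mcar N"
  using ghom_gmodule(1)[OF f] assms(2)
proof (induction rule: mcar_induct)
  case zero show ?case using ghom_zero[OF f] mcar_zero[OF ghom_gmodule(2)[OF f]] by simp
next
  case (add t x y)
  then show ?case
    using ghom_add[OF f mdeg_mcar[OF ghom_gmodule(1)[OF f] add(1)] add(2)]
      mcar_add[OF ghom_gmodule(2)[OF f] mdeg_mcar[OF ghom_gmodule(2)[OF f] ghom_mdeg[OF f add(1)]] add(3)]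
    by simp
qed

lemma ghom_uminus:
  assumes "ghom M N f" "x \<in> mcar M" shows "f (- x) = - f x"
  using ghom_add[OF assms mcar_uminus[OF ghom_gmodule(1)[OF assms(1)] assms(2)]] ghom_zero[OF assms(1)]
  by (simp add: minus_unique)

lemma ghom_diff:
  assumes "ghom M N f" "x \<in> mcar M" "y \<in> mcar M" shows "f (x - y) = f x - f y"
  using ghom_add[OF assms(1,2) mcar_uminus[OF ghom_gmodule(1)[OF assms(1)] assms(3)]] ghom_uminus[OF assms(1,3)]
  by simp

lemma ghom_sum:
  assumes "ghom M N f" "\<And>k. k \<in> F \<Longrightarrow> z k \<in> mcar M" shows "f (sum z F) = (\<Sum>k\<in>F. f (z k))"
  using assms(2)
proof (induction F rule: infinite_finite_induct)
  case (insert x F)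
  then have "f (z x + sum z F) = f (z x) + f (sum z F)"
    by (intro ghom_add[OF assms(1)] mcar_sum[OF ghom_gmodule(1)[OF assms(1)]]) auto
  then show ?case using insert by simp
qed (auto simp: ghom_zero[OF assms(1)])

lemma ghom_comp:
  assumes f: "ghom M N f" and g: "ghom N L g" shows "ghom M L (\<lambda>x. g (f x))"
  by (rule ghomI) (use ghom_gmodule[OF f] ghom_gmodule[OF g] in
    \<open>auto simp: ghom_mdeg[OF f] ghom_mdeg[OF g] ghom_mcar[OF f] ghom_add[OF f] ghom_add[OF g]
       ghom_act[OF f] ghom_act[OF g]\<close>)

lemma ghom_id: "gmodule \<Gamma> M \<Longrightarrow> ghom M M (\<lambda>x. x)"
  by (rule ghomI) auto

lemma ghom_zero_map: "gmodule \<Gamma> M \<Longrightarrow> gmodule \<Gamma> N \<Longrightarrow> ghom M N (\<lambda>x. 0)"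
  by (rule ghomI) (auto simp: mdeg_zero act_zero_right)

lemma ghom_plus:
  assumes f: "ghom M N f" and g: "ghom M N g" shows "ghom M N (\<lambda>x. f x + g x)"
  by (rule ghomI) (use ghom_gmodule[OF f] in
    \<open>auto simp: ghom_add[OF f] ghom_add[OF g] ghom_act[OF f] ghom_act[OF g] act_add_right
       ghom_mcar[OF f] ghom_mcar[OF g] intro: mdeg_add ghom_mdeg[OF f] ghom_mdeg[OF g]\<close>)

lemma ghom_minus:
  assumes f: "ghom M N f" and g: "ghom M N g" shows "ghom M N (\<lambda>x. f x - g x)"
  by (rule ghomI) (use ghom_gmodule[OF f] in
    \<open>auto simp: ghom_add[OF f] ghom_add[OF g] ghom_act[OF f] ghom_act[OF g] act_diff_right
       ghom_mcar[OF f] ghom_mcar[OF g] intro: mdeg_diff ghom_mdeg[OF f] ghom_mdeg[OF g]\<close>)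

lemma ghom_sum_fun:
  assumes "gmodule \<Gamma> M" "gmodule \<Gamma> N" "\<And>k. k \<in> F \<Longrightarrow> ghom M N (f k)"
  shows "ghom M N (\<lambda>x. \<Sum>k\<in>F. f k x)"
  using assms(3)
  by (induction F rule: infinite_finite_induct) (auto intro: ghom_zero_map assms ghom_plus)

lemma ghom_hcomp:
  assumes f: "ghom M N f" and "x \<in> mcar M"
  shows "f (hcomp (mdeg M) x t) = hcomp (mdeg N) (f x) t"
  using ghom_gmodule(1)[OF f] assms(2)
proof (induction rule: mcar_induct)
  case zero
  then show ?case using ghom_zero[OF f] comp_zero ghom_gmodule[OF f] by metis
next
  case (add s x y)
  have x: "x \<in> mcar M" by (rule mdeg_mcar[OF ghom_gmodule(1)[OF f] add(1)])
  have "f (hcomp (mdeg M) x t) = hcomp (mdeg N) (f x) t"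
    unfolding comp_homogeneous[OF ghom_gmodule(1)[OF f] add(1)]
      comp_homogeneous[OF ghom_gmodule(2)[OF f] ghom_mdeg[OF f add(1)]]
    by (auto simp: ghom_zero[OF f])
  then show ?case
    using add x comp_add[OF ghom_gmodule(1)[OF f] x add(2)] ghom_add[OF f]
      comp_add[OF ghom_gmodule(2)[OF f] ghom_mcar[OF f x] ghom_mcar[OF f add(2)]]
      comp_mdeg[OF ghom_gmodule(1)[OF f]] mdeg_mcar[OF ghom_gmodule(1)[OF f]] by metis
qed

text \<open>The degree \<open>t\<close> component of any preimage is again a preimage, because
  homomorphisms commute with taking components.\<close>

lemma ghom_homogeneous_preimage:
  assumes f: "ghom M N f" and y: "y \<in> mdeg N t" "y \<in> f ` mcar M"
  shows "y \<in> f ` mdeg M t"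
proof -
  obtain x where x: "x \<in> mcar M" "y = f x" using y by blast
  have "f (hcomp (mdeg M) x t) = y"
    using ghom_hcomp[OF f x(1)] x comp_homogeneous[OF ghom_gmodule(2)[OF f] y(1)] by simp
  then show ?thesis using comp_mdeg[OF ghom_gmodule(1)[OF f] x(1)] by blast
qed

lemma ghom_inverse:
  assumes f: "ghom M N f" and bij: "bij_betw f (mcar M) (mcar N)"
    and g: "\<And>x. x \<in> mcar M \<Longrightarrow> g (f x) = x"
  shows "ghom N M g"
proof (rule ghomI)
  have surj: "\<exists>x\<in>mcar M. y = f x" if "y \<in> mcar N" for y
    using that bij unfolding bij_betw_def by blast
  note gm = ghom_gmodule[OF f]
  fix t x assume "x \<in> mdeg N t"
  moreover from this have "x \<in> f ` mcar M" using surj mdeg_mcar[OF gm(2)] by blast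
  ultimately obtain y where "y \<in> mdeg M t" "x = f y" using ghom_homogeneous_preimage[OF f] by blast
  then show "g x \<in> mdeg M t" using g mdeg_mcar[OF gm(1)] by metis
next
  have surj: "\<exists>x\<in>mcar M. y = f x" if "y \<in> mcar N" for y
    using that bij unfolding bij_betw_def by blast
  note gm = ghom_gmodule[OF f]
  fix x y assume "x \<in> mcar N" "y \<in> mcar N"
  then show "g (x + y) = g x + g y" using surj g ghom_add[OF f] mcar_add[OF gm(1)] by metis
next
  have surj: "\<exists>x\<in>mcar M. y = f x" if "y \<in> mcar N" for y
    using that bij unfolding bij_betw_def by blast
  note gm = ghom_gmodule[OF f]
  fix a x assume "x \<in> mcar N"
  then show "g (act N a x) = act M a (g x)" using surj g ghom_act[OF f] act_mcar[OF gm(1)] by metis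
qed (use ghom_gmodule[OF f] in auto)

text \<open>Factorization through a surjection without forming a quotient: \<open>h\<close>
  evaluates \<open>g\<close> at an arbitrary preimage, and the kernel condition makes the value
  independent of the choice.\<close>

lemma ghom_factor:
  assumes p: "ghom M L p" and surj: "mcar L \<subseteq> p ` mcar M" and g: "ghom M N g"
    and ker: "\<And>x. x \<in> mcar M \<Longrightarrow> p x = 0 \<Longrightarrow> g x = 0"
  shows "\<exists>h. ghom L N h \<and> (\<forall>x\<in>mcar M. h (p x) = g x)"
proof -
  let ?h = "\<lambda>y. g (SOME x. x \<in> mcar M \<and> p x = y)"
  note gm = ghom_gmodule[OF p]
  have h: "?h (p x) = g x" if "x \<in> mcar M" for x
  proof -
    let ?x = "SOME z. z \<in> mcar M \<and> p z = p x"
    have "?x \<in> mcar M \<and> p ?x = p x" by (rule someI[of _ x]) (use that in auto)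
    then have "g (?x - x) = 0" "?x \<in> mcar M"
      using ghom_diff[OF p _ that, of ?x] mcar_diff[OF gm(1) _ that] by (auto intro!: ker)
    then show ?thesis using ghom_diff[OF g _ that] by simp
  qed
  have pre: "\<exists>x\<in>mcar M. y = p x" if "y \<in> mcar L" for y using that surj by blast
  have "ghom L N ?h"
  proof (rule ghomI)
    fix t x assume "x \<in> mdeg L t"
    moreover from this have "x \<in> p ` mcar M" using pre mdeg_mcar[OF gm(2)] by blast
    ultimately obtain y where "y \<in> mdeg M t" "x = p y" using ghom_homogeneous_preimage[OF p] by blast
    then show "?h x \<in> mdeg N t" using h mdeg_mcar[OF gm(1)] ghom_mdeg[OF g] by metis
  next
    fix x y assume "x \<in> mcar L" "y \<in> mcar L"
    then obtain u v where "u \<in> mcar M" "x = p u" "v \<in> mcar M" "y = p v" using pre by metis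
    then show "?h (x + y) = ?h x + ?h y"
      using h[of "u + v"] h ghom_add[OF p] ghom_add[OF g] mcar_add[OF gm(1)] by simp
  next
    fix a x assume "x \<in> mcar L"
    then obtain u where "u \<in> mcar M" "x = p u" using pre by metis
    then show "?h (act L a x) = act N a (?h x)"
      using h[of "act M a u"] h ghom_act[OF p] ghom_act[OF g] act_mcar[OF gm(1)] by simp
  qed (use gm ghom_gmodule[OF g] in auto)
  then show ?thesis using h by blast
qed

section \<open>Degree shifts\<close>

lemma mcar_shift: "mcar (shift M r) = mcar M" if "gmodule \<Gamma> M"
proof -
  interpret indep_graded_group "mdeg M" by (rule mdeg_group[OF that])
  interpret s: graded_group "mdeg (shift M r)"
    using zero_mem diff_mem by unfold_locales (auto simp: shift_def)
  have "(\<Union>t. mdeg (shift M r) t) = (\<Union>t. mdeg M t)"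
  proof
    show "(\<Union>t. mdeg M t) \<subseteq> (\<Union>t. mdeg (shift M r) t)"
    proof
      fix x assume "x \<in> (\<Union>t. mdeg M t)"
      then obtain t where "x \<in> mdeg M t" by blast
      then have "x \<in> mdeg (shift M r) (t - r)" by (simp add: shift_def)
      then show "x \<in> (\<Union>t. mdeg (shift M r) t)" by blast
    qed
  qed (auto simp: shift_def)
  then show ?thesis unfolding mcar_def s.family_sum_eq family_sum_eq by simp
qed

lemma act_shift [simp]: "act (shift M r) = act M"
  and mdeg_shift [simp]: "mdeg (shift M r) t = mdeg M (t + r)"
  by (simp_all add: shift_def)

lemma shift_shift: "shift (shift M r) s = shift M (s + r)"
  by (simp add: shift_def add.assoc)

lemma gmodule_shift:
  assumes M: "gmodule \<Gamma> M" shows "gmodule \<Gamma> (shift M r)"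
proof -
  have "family_indep (mdeg (shift M r))"
    unfolding family_indep_def[of "mdeg (shift M r)"]
  proof (intro allI impI, elim conjE)
    fix F x assume F: "finite F" "\<forall>t\<in>F. x t \<in> mdeg (shift M r) t" "(\<Sum>t\<in>F. x t) = 0"
    have "(\<Sum>t\<in>(\<lambda>t. t + r) ` F. x (t - r)) = 0" using F(3) by (simp add: sum.reindex)
    moreover have "\<forall>t\<in>(\<lambda>t. t + r) ` F. x (t - r) \<in> mdeg M t" using F(2) by auto
    moreover have "finite ((\<lambda>t. t + r) ` F)" using F(1) by simp
    moreover have "family_indep (mdeg M)" using M unfolding gmodule_def by blast
    ultimately have "x (t - r) = 0" if "t \<in> (\<lambda>t. t + r) ` F" for t
      using family_indepD[of "mdeg M" "(\<lambda>t. t + r) ` F" "\<lambda>t. x (t - r)" t] that by blast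
    from this[of "_ + r"] show "\<forall>t\<in>F. x t = 0" by simp
  qed
  moreover have "act M a x \<in> mdeg M (int s + t + r)" if "a \<in> deg \<Gamma> s" "x \<in> mdeg M (t + r)" for s t a x
    using act_mdeg[OF M that] by (simp add: add.assoc)
  ultimately show ?thesis
    using M unfolding gmodule_def[of _ "shift M r"] mcar_shift[OF M] act_shift
    using mdeg_zero[OF M] mdeg_diff[OF M] act_add_right[OF M] act_add_left[OF M] act_mult[OF M]
      act_local_unit[OF M] by auto
qed

lemma ghom_shift: "ghom M N f \<Longrightarrow> ghom (shift M r) (shift N r) f"
  using mcar_shift[of M r] unfolding ghom_def gr_hom_def by (auto simp: gmodule_shift)

lemma shift_zero: "shift M 0 = M"
  by (simp add: shift_def)

end

section \<open>Direct sums and the lifting property of projectives\<close>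

lemma add_span_image:
  assumes "\<And>x y. f (x + y) = f x + f y" shows "add_span (f ` S) = f ` add_span S"
proof
  have f0: "f 0 = 0" using assms[of 0 0] by simp
  show "add_span (f ` S) \<subseteq> f ` add_span S"
  proof (rule add_span_subset)
    show "0 \<in> f ` add_span S" using f0 add_span_zero by force
    show "x + y \<in> f ` add_span S" if xy: "x \<in> f ` add_span S" "y \<in> f ` add_span S" for x y
    proof -
      obtain u v where "u \<in> add_span S" "x = f u" "v \<in> add_span S" "y = f v" using xy by blast
      then show ?thesis by (intro image_eqI[of _ _ "u + v"]) (auto simp: assms intro: add_span_add)
    qed
  qed (auto intro: add_span_base)
  show "f ` add_span S \<subseteq> add_span (f ` S)"
  proof
    fix y assume "y \<in> f ` add_span S"
    then obtain x where x: "x \<in> add_span S" "y = f x" by blast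
    have "f x \<in> add_span (f ` S)" using x(1)
      by (induction rule: add_span_induct) (auto simp: f0 assms add_span_zero intro: add_span_base_add)
    then show "y \<in> add_span (f ` S)" using x by simp
  qed
qed

text \<open>The lifting property of \<open>gr_projective\<close> speaks only of modules on sequences in the algebra.
  Modules on another group are transported there along an additive injection \<open>\<iota>\<close> with left
  inverse \<open>\<kappa>\<close>.\<close>

definition coding :: "('m::ab_group_add \<Rightarrow> 'n::ab_group_add) \<Rightarrow> ('n \<Rightarrow> 'm) \<Rightarrow> bool" where
  "coding \<iota> \<kappa> \<longleftrightarrow> (\<forall>x y. \<iota> (x + y) = \<iota> x + \<iota> y) \<and> (\<forall>x. \<kappa> (\<iota> x) = x)"

definition transport :: "('m \<Rightarrow> 'n) \<Rightarrow> ('n \<Rightarrow> 'm) \<Rightarrow> ('a, 'm) gmod \<Rightarrow> ('a, 'n) gmod" where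
  "transport \<iota> \<kappa> M = \<lparr>mdeg = \<lambda>t. \<iota> ` mdeg M t, act = \<lambda>a z. \<iota> (act M a (\<kappa> z))\<rparr>"

lemma coding_id: "coding (\<lambda>x. x) (\<lambda>x. x)"
  unfolding coding_def by simp

text \<open>Serves modules whose underlying group consists of elements of the algebra, such as the
  simple ones.\<close>

lemma coding_first: "coding (\<lambda>a j. if j = (0::nat) then a else 0) (\<lambda>z. z 0)"
  unfolding coding_def by auto

text \<open>Sequences of sequences are coded as sequences, so that a countable direct sum of modules
  on sequences falls under the lifting property again.\<close>

lemma coding_pair:
  "coding (\<lambda>z n. z (fst (prod_decode n)) (snd (prod_decode n))) (\<lambda>w d k. w (prod_encode (d, k)))"
  unfolding coding_def by auto

text \<open>Finite support is imposed on each homogeneous piece; the elements of the carrier inherit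
  it as finite sums of such pieces.\<close>

definition direct_sum :: "(nat \<Rightarrow> ('a, 'm::zero) gmod) \<Rightarrow> ('a, nat \<Rightarrow> 'm) gmod" where
  "direct_sum M = \<lparr>mdeg = \<lambda>t. {z. finite {d. z d \<noteq> 0} \<and> (\<forall>d. z d \<in> mdeg (M d) t)},
     act = \<lambda>a z d. act (M d) a (z d)\<rparr>"

definition truncate :: "int \<Rightarrow> ('a, 'm::zero) gmod \<Rightarrow> ('a, 'm) gmod" where
  "truncate b M = \<lparr>mdeg = \<lambda>t. if b \<le> t then mdeg M t else {0}, act = act M\<rparr>"

lemma sum_fun_apply: "(\<Sum>k\<in>F. f k) d = (\<Sum>k\<in>F. f k d)"
  by (induction F rule: infinite_finite_induct) auto

context graded_alg
begin

lemma
  assumes M: "gmodule \<Gamma> M" and \<iota>: "coding \<iota> \<kappa>"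
  shows mcar_transport: "mcar (transport \<iota> \<kappa> M) = \<iota> ` mcar M"
    and ghom_transport: "ghom M (transport \<iota> \<kappa> M) \<iota>"
    and ghom_transport_inverse: "ghom (transport \<iota> \<kappa> M) M \<kappa>"
proof -
  have add: "\<iota> (x + y) = \<iota> x + \<iota> y" and inv: "\<kappa> (\<iota> x) = x" for x y
    using \<iota> unfolding coding_def by auto
  have zero: "\<iota> 0 = 0" using add[of 0 0] by simp
  have diff: "\<iota> (x - y) = \<iota> x - \<iota> y" for x y using add[of "x - y" y] by simp
  have sum: "\<iota> (sum z F) = (\<Sum>k\<in>F. \<iota> (z k))" for z and F :: "int set"
    by (induction F rule: infinite_finite_induct) (auto simp: zero add)
  let ?T = "transport \<iota> \<kappa> M"
  interpret indep_graded_group "mdeg M" by (rule mdeg_group[OF M])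
  interpret T: graded_group "mdeg ?T"
    by unfold_locales
      (use zero_mem diff_mem diff zero in \<open>auto simp: transport_def image_iff\<close>, metis+)
  have "(\<Union>t. mdeg ?T t) = \<iota> ` (\<Union>t. mdeg M t)" by (auto simp: transport_def)
  then show car: "mcar ?T = \<iota> ` mcar M"
    unfolding mcar_def T.family_sum_eq family_sum_eq using add_span_image[of \<iota>, OF add] by metis
  have indep': "family_indep (mdeg ?T)"
    unfolding family_indep_def[of "mdeg ?T"]
  proof (intro allI impI ballI, elim conjE)
    fix F x t assume F: "finite F" "\<forall>t\<in>F. x t \<in> mdeg ?T t" "(\<Sum>t\<in>F. x t) = 0" "t \<in> F"
    have x: "\<iota> (\<kappa> (x t)) = x t" "\<kappa> (x t) \<in> mdeg M t" if "t \<in> F" for t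
      using F(2) that inv by (auto simp: transport_def)
    have "\<iota> (\<Sum>t\<in>F. \<kappa> (x t)) = \<iota> 0" using sum F(3) x zero by simp
    then have "(\<Sum>t\<in>F. \<kappa> (x t)) = 0" using inv by metis
    then have "\<kappa> (x t) = 0"
      using family_indepD[OF indep F(1), of "\<lambda>t. \<kappa> (x t)" t] x F(4) by blast
    then show "x t = 0" using x(1)[OF F(4)] zero by simp
  qed
  have gm: "gmodule \<Gamma> ?T"
    unfolding gmodule_def car
  proof (intro conjI allI ballI indep')
    fix x assume "x \<in> \<iota> ` mcar M"
    then obtain y where y: "y \<in> mcar M" "x = \<iota> y" by blast
    obtain F where "finite F" "act M (\<Sum>i\<in>F. idem \<Gamma> i) y = y" using act_local_unit[OF M y(1)] by blast
    then show "\<exists>F. finite F \<and> act ?T (\<Sum>i\<in>F. idem \<Gamma> i) x = x"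
      by (intro exI[of _ F]) (simp add: transport_def inv y(2))
  qed (auto simp: transport_def inv add[symmetric] act_add_right[OF M] act_add_left[OF M]
      act_mult[OF M] zero mdeg_zero[OF M] diff[symmetric] mdeg_diff[OF M] act_mdeg[OF M]
      intro!: imageI T.zero_mem[unfolded transport_def gmod.simps])
  show "ghom M ?T \<iota>" by (rule ghomI) (use M gm in \<open>auto simp: transport_def add inv\<close>)
  show "ghom ?T M \<kappa>"
    by (rule ghomI) (use M gm in \<open>auto simp: car add[symmetric] inv, auto simp: transport_def inv\<close>)
qed

lemma projective_gmodule: "gr_projective \<Gamma> P \<Longrightarrow> gmodule \<Gamma> P"
  unfolding gr_projective_def by blast

text \<open>\<open>gr_projective\<close> lifts only along surjections between modules on sequences.
  Replacing \<open>N\<close> by the graded image \<open>D\<close> of \<open>p\<close> makes the map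
  onto, and the codings transport both modules to sequences.\<close>

lemma projective_lift:
  fixes \<iota> :: "'m::ab_group_add \<Rightarrow> nat \<Rightarrow> 'a" and \<iota>' :: "'n::ab_group_add \<Rightarrow> nat \<Rightarrow> 'a"
    and M :: "('a, 'm) gmod" and N :: "('a, 'n) gmod"
  assumes Q: "gr_projective \<Gamma> Q" and p: "ghom M N p" and h: "ghom Q N h"
    and im: "h ` mcar Q \<subseteq> p ` mcar M" and "coding \<iota> \<kappa>" "coding \<iota>' \<kappa>'"
  shows "\<exists>k. ghom Q M k \<and> (\<forall>x\<in>mcar Q. p (k x) = h x)"
proof -
  note gm = ghom_gmodule[OF p]
  define D where "D = \<lparr>mdeg = \<lambda>t. p ` mdeg M t, act = act N\<rparr>"
  have D: "gmodule \<Gamma> D" "mcar D \<subseteq> mcar N"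
  proof -
    have zero: "0 \<in> p ` mdeg M t" for t
      by (rule image_eqI[of _ _ 0]) (simp_all add: ghom_zero[OF p] mdeg_zero[OF gm(1)])
    have diff: "x - y \<in> p ` mdeg M t" if xy: "x \<in> p ` mdeg M t" "y \<in> p ` mdeg M t" for x y t
    proof -
      obtain u v where "u \<in> mdeg M t" "x = p u" "v \<in> mdeg M t" "y = p v" using xy by blast
      then show ?thesis
        by (intro image_eqI[of _ _ "u - v"])
          (simp_all add: ghom_diff[OF p] mdeg_mcar[OF gm(1)] mdeg_diff[OF gm(1)])
    qed
    have act: "act N a x \<in> p ` mdeg M (int s + t)" if ax: "a \<in> deg \<Gamma> s" "x \<in> p ` mdeg M t" for a x s t
    proof -
      obtain u where "u \<in> mdeg M t" "x = p u" using ax by blast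
      then show ?thesis
        by (intro image_eqI[of _ _ "act M a u"])
          (simp_all add: ghom_act[OF p] mdeg_mcar[OF gm(1)] act_mdeg[OF gm(1) ax(1)])
    qed
    have sub: "p ` mdeg M t \<subseteq> mdeg N t" for t using ghom_mdeg[OF p] by blast
    show "gmodule \<Gamma> D" "mcar D \<subseteq> mcar N"
      unfolding D_def using submodule_gmodule[OF gm(2) sub zero diff act] by blast+
  qed
  have pD: "ghom M D p"
    by (rule ghomI) (use gm D ghom_add[OF p] ghom_act[OF p] in \<open>auto simp: D_def\<close>)
  have hD: "ghom Q D h"
  proof (rule ghomI)
    fix t x assume x: "x \<in> mdeg Q t"
    then have "h x \<in> p ` mcar M" using im mdeg_mcar[OF ghom_gmodule(1)[OF h]] by blast
    then have "h x \<in> p ` mdeg M t" using ghom_homogeneous_preimage[OF p ghom_mdeg[OF h x]] by blast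
    then show "h x \<in> mdeg D t" by (simp add: D_def)
  qed (use ghom_gmodule[OF h] D ghom_add[OF h] ghom_act[OF h] in \<open>auto simp: D_def\<close>)
  have surj: "p ` mcar M = mcar D"
  proof
    show "p ` mcar M \<subseteq> mcar D" using ghom_mcar[OF pD] by blast
    show "mcar D \<subseteq> p ` mcar M"
    proof
      fix y assume "y \<in> mcar D"
      with D(1) show "y \<in> p ` mcar M"
      proof (induction rule: mcar_induct)
        case zero show ?case using ghom_zero[OF p] mcar_zero[OF gm(1)] by (metis image_eqI)
      next
        case (add t x y)
        then obtain u v where "u \<in> mdeg M t" "x = p u" "v \<in> mcar M" "y = p v" by (auto simp: D_def)
        then show ?case
          by (intro image_eqI[of _ _ "u + v"])
            (simp_all add: ghom_add[OF p] mdeg_mcar[OF gm(1)] mcar_add[OF gm(1)])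
      qed
    qed
  qed
  let ?M = "transport \<iota> \<kappa> M" and ?D = "transport \<iota>' \<kappa>' D"
  have inv: "\<kappa> (\<iota> x) = x" "\<kappa>' (\<iota>' y) = y" for x y using assms unfolding coding_def by auto
  note M = ghom_transport[OF gm(1) assms(5)] ghom_transport_inverse[OF gm(1) assms(5)]
    mcar_transport[OF gm(1) assms(5)]
  note D' = ghom_transport[OF D(1) assms(6)] ghom_transport_inverse[OF D(1) assms(6)]
    mcar_transport[OF D(1) assms(6)]
  let ?g = "\<lambda>z. \<iota>' (p (\<kappa> z))" and ?h = "\<lambda>x. \<iota>' (h x)"
  have g: "ghom ?M ?D ?g" by (rule ghom_comp[OF ghom_comp[OF M(2) pD] D'(1)])
  have h': "ghom Q ?D ?h" by (rule ghom_comp[OF hD D'(1)])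
  have "?g ` mcar ?M = mcar ?D" unfolding M D' surj[symmetric] image_image inv ..
  then obtain k where k: "gr_hom Q ?M k" "\<forall>x\<in>mcar Q. ?g (k x) = ?h x"
    using Q g h' unfolding gr_projective_def ghom_def by blast
  have "ghom Q ?M k" using k(1) Q ghom_gmodule[OF M(1)] unfolding ghom_def gr_projective_def by blast
  then have "ghom Q M (\<lambda>x. \<kappa> (k x))" by (rule ghom_comp[OF _ M(2)])
  moreover have "p (\<kappa> (k x)) = h x" if "x \<in> mcar Q" for x
    using k(2) that inv by metis
  ultimately show ?thesis by blast
qed

section \<open>Countable direct sums and truncations\<close>

lemma finite_support_add: "finite {d. x d \<noteq> 0} \<Longrightarrow> finite {d. y d \<noteq> 0} \<Longrightarrow> finite {d. (x + y) d \<noteq> 0}"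
  and finite_support_diff: "finite {d. x d \<noteq> 0} \<Longrightarrow> finite {d. y d \<noteq> 0} \<Longrightarrow> finite {d. (x - y) d \<noteq> 0}"
  for x y :: "'t \<Rightarrow> 'm::ab_group_add"
  by (rule finite_subset[of _ "{d. x d \<noteq> 0} \<union> {d. y d \<noteq> 0}"]; auto)+

lemma direct_sum_mdeg:
  "z \<in> mdeg (direct_sum M) t \<longleftrightarrow> finite {d. z d \<noteq> 0} \<and> (\<forall>d. z d \<in> mdeg (M d) t)"
  by (simp add: direct_sum_def)

lemma direct_sum_act [simp]: "act (direct_sum M) a z d = act (M d) a (z d)"
  by (simp add: direct_sum_def)

lemma direct_sum_support:
  assumes "\<And>d. gmodule \<Gamma> (M d)" "z \<in> mcar (direct_sum M)"
  shows "finite {d. z d \<noteq> 0}" "z d \<in> mcar (M d)"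
proof -
  interpret graded_group "mdeg (direct_sum M)"
  proof
    fix x y t assume "x \<in> mdeg (direct_sum M) t" "y \<in> mdeg (direct_sum M) t"
    then show "x - y \<in> mdeg (direct_sum M) t"
      unfolding direct_sum_mdeg using finite_support_diff[of x y] mdeg_diff[OF assms(1)] by simp
  qed (simp add: direct_sum_mdeg mdeg_zero[OF assms(1)])
  have "finite {d. z d \<noteq> 0} \<and> (\<forall>d. z d \<in> mcar (M d))"
    using assms(2) unfolding mcar_def[of "direct_sum M"]
  proof (induction rule: family_sum_induct)
    case zero then show ?case using mcar_zero[OF assms(1)] by simp
  next
    case (add t x y)
    then show ?case
      using finite_support_add[of x y]
      unfolding direct_sum_mdeg by (auto intro!: mcar_add[OF assms(1) mdeg_mcar[OF assms(1)]])
  qed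
  then show "finite {d. z d \<noteq> 0}" "z d \<in> mcar (M d)" by auto
qed

lemma direct_sum_gmodule:
  assumes M: "\<And>d. gmodule \<Gamma> (M d)" shows "gmodule \<Gamma> (direct_sum M)"
proof -
  note supp = direct_sum_support[of M, OF M]
  have "family_indep (mdeg (direct_sum M))"
    unfolding family_indep_def[of "mdeg (direct_sum M)"]
  proof (intro allI impI ballI, elim conjE)
    fix F x t assume F: "finite F" "\<forall>t\<in>F. x t \<in> mdeg (direct_sum M) t" "(\<Sum>t\<in>F. x t) = 0" "t \<in> F"
    have "x t d = 0" for d
    proof (rule family_indepD[of "mdeg (M d)" F "\<lambda>t. x t d"])
      show "family_indep (mdeg (M d))" using M unfolding gmodule_def by blast
      show "(\<Sum>t\<in>F. x t d) = 0" using F(3) by (metis sum_fun_apply zero_fun_apply)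
    qed (use F in \<open>auto simp: direct_sum_def\<close>)
    then show "x t = 0" by auto
  qed
  moreover have "x - y \<in> mdeg (direct_sum M) t"
    if "x \<in> mdeg (direct_sum M) t" "y \<in> mdeg (direct_sum M) t" for x y t
    using that finite_support_diff[of x y] mdeg_diff[OF M] unfolding direct_sum_mdeg by simp
  moreover have "act (direct_sum M) a x \<in> mdeg (direct_sum M) (int s + t)"
    if "a \<in> deg \<Gamma> s" "x \<in> mdeg (direct_sum M) t" for a x s t
  proof -
    have "finite {d. act (M d) a (x d) \<noteq> 0}"
      by (rule finite_subset[of _ "{d. x d \<noteq> 0}"])
        (use that act_zero_right[OF M] in \<open>auto simp: direct_sum_mdeg\<close>)
    then show ?thesis using that act_mdeg[OF M] by (simp add: direct_sum_mdeg)
  qed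
  moreover have "\<exists>F. finite F \<and> act (direct_sum M) (\<Sum>i\<in>F. idem \<Gamma> i) x = x"
    if x: "x \<in> mcar (direct_sum M)" for x
  proof -
    obtain G where G: "\<And>d. finite (G d) \<and> act (M d) (\<Sum>i\<in>G d. idem \<Gamma> i) (x d) = x d"
      using act_local_unit[OF M supp(2)[OF x]] by metis
    let ?F = "\<Union>d\<in>{d. x d \<noteq> 0}. G d"
    have fin: "finite ?F" using supp(1)[OF x] G by blast
    have "act (M d) (\<Sum>i\<in>?F. idem \<Gamma> i) (x d) = x d" for d
    proof (cases "x d = 0")
      case False
      then show ?thesis
        using act_unit_superset[OF M supp(2)[OF x] _ _ fin, of d "G d"] G[of d] by blast
    qed (simp add: act_zero_right[OF M])
    then show ?thesis using fin by (intro exI[of _ ?F]) (simp add: fun_eq_iff)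
  qed
  moreover have "0 \<in> mdeg (direct_sum M) t" for t by (simp add: direct_sum_mdeg mdeg_zero[OF M])
  ultimately show ?thesis
    unfolding gmodule_def
    using act_add_right[OF M supp(2) supp(2)] act_add_left[OF M supp(2)] act_mult[OF M supp(2)]
    by (simp add: fun_eq_iff)
qed

lemma direct_sum_component:
  assumes "\<And>d. gmodule \<Gamma> (M d)" shows "ghom (direct_sum M) (M d) (\<lambda>z. z d)"
  by (rule ghomI) (simp_all add: assms direct_sum_gmodule direct_sum_mdeg)

lemma direct_sum_single:
  assumes M: "\<And>d. gmodule \<Gamma> (M d)" and x: "x \<in> mcar (M d)"
  shows "(\<lambda>j. if j = d then x else 0) \<in> mcar (direct_sum M)"
proof -
  have "ghom (M d) (direct_sum M) (\<lambda>x j. if j = d then x else 0)"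
  proof (rule ghomI)
    fix t x assume "x \<in> mdeg (M d) t"
    moreover have "finite {j. (if j = d then x else 0) \<noteq> 0}"
      by (rule finite_subset[of _ "{d}"]) auto
    ultimately show "(\<lambda>j. if j = d then x else 0) \<in> mdeg (direct_sum M) t"
      using mdeg_zero[OF M] by (simp add: direct_sum_mdeg)
  qed (auto simp: M direct_sum_gmodule act_zero_right fun_eq_iff)
  then show ?thesis by (rule ghom_mcar[OF _ x])
qed

lemma direct_sum_fold:
  assumes f: "\<And>d. ghom (M d) X (f d)" and X: "gmodule \<Gamma> X"
  shows "ghom (direct_sum M) X (\<lambda>z. \<Sum>d | z d \<noteq> 0. f d (z d))"
proof (rule ghomI)
  note M = ghom_gmodule(1)[OF f]
  note supp = direct_sum_support[of M, OF M]
  show "gmodule \<Gamma> (direct_sum M)" by (rule direct_sum_gmodule[OF M])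
  \<comment> \<open>The summation range depends on \<open>z\<close>; enlarging it to a common finite
    set is harmless since each \<open>f d\<close> sends 0 to 0.\<close>
  have eq: "(\<Sum>d | z d \<noteq> 0. f d (z d)) = (\<Sum>d\<in>F. f d (z d))" if "{d. z d \<noteq> 0} \<subseteq> F" "finite F" for F z
    by (rule sum.mono_neutral_left) (use that ghom_zero[OF f] in auto)
  fix x y assume x: "x \<in> mcar (direct_sum M)" and y: "y \<in> mcar (direct_sum M)"
  let ?F = "{d. x d \<noteq> 0} \<union> {d. y d \<noteq> 0}"
  have fin: "finite ?F" using supp x y by simp
  have "(\<Sum>d | (x + y) d \<noteq> 0. f d ((x + y) d)) = (\<Sum>d\<in>?F. f d ((x + y) d))"
    using fin by (intro eq) auto
  also have "\<dots> = (\<Sum>d\<in>?F. f d (x d)) + (\<Sum>d\<in>?F. f d (y d))"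
    using supp(2)[OF x] supp(2)[OF y] by (simp add: ghom_add[OF f] sum.distrib)
  also have "(\<Sum>d\<in>?F. f d (x d)) = (\<Sum>d | x d \<noteq> 0. f d (x d))" using fin by (intro eq[symmetric]) auto
  also have "(\<Sum>d\<in>?F. f d (y d)) = (\<Sum>d | y d \<noteq> 0. f d (y d))" using fin by (intro eq[symmetric]) auto
  finally show "(\<Sum>d | (x + y) d \<noteq> 0. f d ((x + y) d))
      = (\<Sum>d | x d \<noteq> 0. f d (x d)) + (\<Sum>d | y d \<noteq> 0. f d (y d))" .
next
  note M = ghom_gmodule(1)[OF f]
  note supp = direct_sum_support[of M, OF M]
  fix a x assume x: "x \<in> mcar (direct_sum M)"
  have "(\<Sum>d | act (direct_sum M) a x d \<noteq> 0. f d (act (direct_sum M) a x d))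
      = (\<Sum>d | x d \<noteq> 0. f d (act (direct_sum M) a x d))"
    by (rule sum.mono_neutral_left)
      (use supp(1)[OF x] ghom_zero[OF f] act_zero_right[OF M] in auto)
  also have "\<dots> = (\<Sum>d | x d \<noteq> 0. act X a (f d (x d)))"
    using ghom_act[OF f supp(2)[OF x]] by simp
  also have "\<dots> = act X a (\<Sum>d | x d \<noteq> 0. f d (x d))"
    by (rule act_sum_right[OF X, symmetric]) (rule ghom_mcar[OF f supp(2)[OF x]])
  finally show "(\<Sum>d | act (direct_sum M) a x d \<noteq> 0. f d (act (direct_sum M) a x d))
      = act X a (\<Sum>d | x d \<noteq> 0. f d (x d))" .
qed (use assms in \<open>auto simp: direct_sum_mdeg intro!: mdeg_sum ghom_mdeg[OF f]\<close>)

lemma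
  assumes M: "gmodule \<Gamma> M"
  shows truncate_gmodule: "gmodule \<Gamma> (truncate b M)"
    and ghom_truncate: "ghom (truncate b M) M (\<lambda>x. x)"
proof -
  have *: "gmodule \<Gamma> (truncate b M) \<and> mcar (truncate b M) \<subseteq> mcar M"
    unfolding truncate_def
    by (intro conjI; rule submodule_gmodule[OF M])
      (auto simp: mdeg_zero[OF M] mdeg_diff[OF M] act_zero_right[OF M] act_mdeg[OF M] split: if_splits)
  then show "gmodule \<Gamma> (truncate b M)" by simp
  show "ghom (truncate b M) M (\<lambda>x. x)"
    by (rule ghomI) (use * M mdeg_zero[OF M] in \<open>auto simp: truncate_def split: if_splits\<close>)
qed

section \<open>The graded radical and projective covers\<close>

lemma radical_mcar:
  assumes "gmodule \<Gamma> M" shows "graded_radical \<Gamma> M \<subseteq> mcar M"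
  unfolding graded_radical_def
  by (rule add_span_subset) (use assms act_mcar mcar_zero mcar_add in auto)

lemma radical_zero: "0 \<in> graded_radical \<Gamma> M"
  unfolding graded_radical_def by (rule add_span_zero)

lemma radical_add: "x \<in> graded_radical \<Gamma> M \<Longrightarrow> y \<in> graded_radical \<Gamma> M \<Longrightarrow> x + y \<in> graded_radical \<Gamma> M"
  unfolding graded_radical_def by (rule add_span_add)

lemma radical_sum: "(\<And>k. k \<in> F \<Longrightarrow> z k \<in> graded_radical \<Gamma> M) \<Longrightarrow> sum z F \<in> graded_radical \<Gamma> M"
  unfolding graded_radical_def by (rule add_span_sum)

lemma radical_act_positive: "a \<in> deg \<Gamma> (Suc s) \<Longrightarrow> x \<in> mcar M \<Longrightarrow> act M a x \<in> graded_radical \<Gamma> M"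
  unfolding graded_radical_def by (rule add_span_base) blast

lemma ghom_radical:
  assumes f: "ghom M N f" and "x \<in> graded_radical \<Gamma> M" shows "f x \<in> graded_radical \<Gamma> N"
  using assms(2) unfolding graded_radical_def[of _ M]
proof (induction rule: add_span_induct)
  case zero show ?case using ghom_zero[OF f] radical_zero by simp
next
  case (add x y)
  then obtain a z s where x: "x = act M a z" "a \<in> deg \<Gamma> (Suc s)" "z \<in> mcar M" by blast
  have "f x \<in> graded_radical \<Gamma> N"
    using radical_act_positive[OF x(2) ghom_mcar[OF f x(3)]] ghom_act[OF f x(3)] x(1) by simp
  moreover have "y \<in> mcar M"
    using add(2) radical_mcar[OF ghom_gmodule(1)[OF f]] unfolding graded_radical_def by blast
  ultimately show ?case
    using add(3) radical_add ghom_add[OF f] x act_mcar[OF ghom_gmodule(1)[OF f] x(3)] by simp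
qed

text \<open>The filtration by the degree of the acting element replaces genuine powers of the graded
  radical: elements of degree at least \<open>m\<close> act once.\<close>

definition radical_power :: "nat \<Rightarrow> ('a, 'm::ab_group_add) gmod \<Rightarrow> 'm set" where
  "radical_power m M = add_span {act M a x | a x. (\<exists>s\<ge>m. a \<in> deg \<Gamma> s) \<and> x \<in> mcar M}"

lemma radical_power_mcar:
  assumes "gmodule \<Gamma> M" shows "radical_power m M \<subseteq> mcar M"
  unfolding radical_power_def
  by (rule add_span_subset) (use assms act_mcar mcar_zero mcar_add in auto)

lemma radical_power_zero:
  assumes M: "gmodule \<Gamma> M" and x: "x \<in> mcar M" shows "x \<in> radical_power 0 M"
proof -
  obtain F where "act M (\<Sum>i\<in>F. idem \<Gamma> i) x = x" using act_local_unit[OF M x] by blast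
  then have "\<exists>a y. x = act M a y \<and> (\<exists>s\<ge>0. a \<in> deg \<Gamma> s) \<and> y \<in> mcar M"
    using idem_sum_deg0 x by (metis le0)
  then show ?thesis unfolding radical_power_def by (intro add_span_base) simp
qed

text \<open>\<open>\<psi>\<close> sends \<open>a z\<close> to \<open>a \<psi>(z)\<close>, and the
  radical element \<open>\<psi>(z)\<close> contributes a further coefficient of positive degree, so
  the degrees of the coefficients grow by at least one.\<close>

lemma radical_power_Suc:
  assumes \<psi>: "ghom P P \<psi>" and rad: "\<And>x. x \<in> mcar P \<Longrightarrow> \<psi> x \<in> graded_radical \<Gamma> P"
    and "x \<in> radical_power m P"
  shows "\<psi> x \<in> radical_power (Suc m) P"
  using assms(3) unfolding radical_power_def[of m]
proof (induction rule: add_span_induct)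
  case zero show ?case using ghom_zero[OF \<psi>] by (simp add: radical_power_def add_span_zero)
next
  case (add x y)
  note P = ghom_gmodule(1)[OF \<psi>]
  from add obtain a z s where x: "x = act P a z" "s \<ge> m" "a \<in> deg \<Gamma> s" "z \<in> mcar P" by blast
  have "act P a w \<in> radical_power (Suc m) P" if "w \<in> graded_radical \<Gamma> P" for w
    using that unfolding graded_radical_def
  proof (induction rule: add_span_induct)
    case zero show ?case using act_zero_right[OF P] by (simp add: radical_power_def add_span_zero)
  next
    case (add u v)
    then obtain b y r where u: "u = act P b y" "b \<in> deg \<Gamma> (Suc r)" "y \<in> mcar P" by blast
    have "act P a u = act P (a * b) y" using act_mult[OF P u(3)] u(1) by simp
    moreover have "a * b \<in> deg \<Gamma> (s + Suc r)" by (rule deg_mult[OF x(3) u(2)])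
    ultimately have "\<exists>c y. act P a u = act P c y \<and> (\<exists>s\<ge>Suc m. c \<in> deg \<Gamma> s) \<and> y \<in> mcar P"
      using u(3) x(2) by (intro exI[of _ "a * b"] exI[of _ y] conjI exI[of _ "s + Suc r"]) auto
    then have *: "act P a u \<in> {act P a x | a x. (\<exists>s\<ge>Suc m. a \<in> deg \<Gamma> s) \<and> x \<in> mcar P}" by simp
    have "u \<in> mcar P" "v \<in> mcar P"
      using u act_mcar[OF P] add(2) radical_mcar[OF P] unfolding graded_radical_def by auto
    then show ?case
      using add_span_base_add[OF *] add(3) act_add_right[OF P] unfolding radical_power_def by simp
  qed
  then have *: "\<psi> x \<in> radical_power (Suc m) P" using ghom_act[OF \<psi> x(4)] rad[OF x(4)] x(1) by simp
  have "y \<in> mcar P" using add(2) radical_power_mcar[OF P] unfolding radical_power_def by blast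
  then have "\<psi> (x + y) = \<psi> x + \<psi> y" using ghom_add[OF \<psi>] x act_mcar[OF P] by simp
  then show ?case using add_span_add[of "\<psi> x" _ "\<psi> y"] * add(3) unfolding radical_power_def by simp
qed

text \<open>Acting by an element of degree at least \<open>m\<close> raises degrees by at least
  \<open>m\<close>, while \<open>T\<close> starts no lower than \<open>b\<close>.\<close>

lemma radical_power_lower_bound:
  assumes f: "ghom P T f" and low: "\<And>t. t < b \<Longrightarrow> mdeg T t = {0}"
    and "x \<in> radical_power m P" and t: "t < b + int m"
  shows "hcomp (mdeg T) (f x) t = 0"
  using assms(3) unfolding radical_power_def
proof (induction rule: add_span_induct)
  case zero show ?case using ghom_zero[OF f] comp_zero[OF ghom_gmodule(2)[OF f]] by simp
next
  case (add x y)
  note P = ghom_gmodule(1)[OF f] and T = ghom_gmodule(2)[OF f]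
  from add obtain a z s where x: "x = act P a z" "s \<ge> m" "a \<in> deg \<Gamma> s" "z \<in> mcar P" by blast
  have "hcomp (mdeg T) (f z) (t - int s) \<in> mdeg T (t - int s)"
    by (rule comp_mdeg[OF T ghom_mcar[OF f x(4)]])
  then have "hcomp (mdeg T) (f z) (t - int s) = 0" using low[of "t - int s"] t x(2) by simp
  then have "hcomp (mdeg T) (f x) t = 0"
    using ghom_act[OF f x(4)] comp_act[OF T x(3) ghom_mcar[OF f x(4)]] x(1) act_zero_right[OF T] by simp
  moreover have "y \<in> mcar P" using add(2) radical_power_mcar[OF P] unfolding radical_power_def by blast
  moreover have "x \<in> mcar P" using x act_mcar[OF P] by simp
  ultimately show ?case
    using add(3) ghom_add[OF f] comp_add[OF T] ghom_mcar[OF f] by simp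
qed

text \<open>A graded projective \<open>P\<close> is a direct summand of the sum of its truncations \<open>P\<^bsub>\<ge>-d\<^esub>\<close>, each of
  which is bounded below and therefore separated for the radical filtration.\<close>

lemma projective_separated:
  assumes P: "gr_projective \<Gamma> P" and x: "x \<in> mcar P" "\<And>m. x \<in> radical_power m P"
  shows "x = 0"
proof -
  have gm: "gmodule \<Gamma> P" by (rule projective_gmodule[OF P])
  define T where "T d = truncate (- int d) P" for d :: nat
  have T: "gmodule \<Gamma> (T d)" "ghom (T d) P (\<lambda>x. x)" for d
    unfolding T_def by (rule truncate_gmodule[OF gm] ghom_truncate[OF gm])+
  define s where "s z = (\<Sum>d | z d \<noteq> 0. z d)" for z :: "nat \<Rightarrow> nat \<Rightarrow> 'a"
  have s: "ghom (direct_sum T) P s"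
    using direct_sum_fold[of T P "\<lambda>d x. x", OF T(2) gm] unfolding s_def .
  have "mcar P \<subseteq> s ` mcar (direct_sum T)"
  proof
    fix y assume "y \<in> mcar P"
    with gm show "y \<in> s ` mcar (direct_sum T)"
    proof (induction rule: mcar_induct)
      case zero show ?case
        using ghom_zero[OF s] mcar_zero[OF ghom_gmodule(1)[OF s]] by (metis image_eqI)
    next
      case (add t x y)
      then obtain z where z: "z \<in> mcar (direct_sum T)" "y = s z" by blast
      \<comment> \<open>\<open>nat (- t)\<close> is the smallest index whose truncation keeps degree
        \<open>t\<close>.\<close>
      have "x \<in> mdeg (T (nat (- t))) t" using add(1) by (simp add: T_def truncate_def)
      then have "x \<in> mcar (T (nat (- t)))" by (rule mdeg_mcar[OF T(1)])
      from direct_sum_single[of T x "nat (- t)", OF T(1) this]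
      have w: "(\<lambda>j. if j = nat (- t) then x else 0) \<in> mcar (direct_sum T)" .
      have "s (\<lambda>j. if j = nat (- t) then x else 0) = x"
        by (cases "x = 0") (auto simp: s_def)
      then have "x + y = s ((\<lambda>j. if j = nat (- t) then x else 0) + z)"
        using ghom_add[OF s w z(1)] z(2) by simp
      then show ?case using mcar_add[OF ghom_gmodule(1)[OF s] w z(1)] by blast
    qed
  qed
  then have "(\<lambda>x. x) ` mcar P \<subseteq> s ` mcar (direct_sum T)" by simp
  from projective_lift[OF P s ghom_id[OF gm] this coding_pair coding_id]
  obtain k where k: "ghom P (direct_sum T) k" "\<And>x. x \<in> mcar P \<Longrightarrow> s (k x) = x" by blast
  have "k x d = 0" for d
  proof (rule comp_eq_zero[OF T(1)])
    have f: "ghom P (T d) (\<lambda>x. k x d)"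
      by (rule ghom_comp[OF k(1) direct_sum_component[of T, OF T(1)]])
    show "k x d \<in> mcar (T d)" by (rule ghom_mcar[OF f x(1)])
    fix t :: int
    show "hcomp (mdeg (T d)) (k x d) t = 0"
      \<comment> \<open>As \<open>T d\<close> vanishes below \<open>- int d\<close>, the filtration
        step \<open>m\<close> rules out a component in degree \<open>t\<close> once
        \<open>t < - int d + int m\<close>; the given \<open>m\<close> is the least one.\<close>
      by (rule radical_power_lower_bound[OF f, of "- int d" x "nat (t + int d + 1)"])
        (auto simp: T_def truncate_def x(2))
  qed
  then have "k x = 0" by auto
  then show ?thesis using k(2)[OF x(1)] ghom_zero[OF s] by simp
qed

text \<open>A fixed vector is unchanged by \<psi>, yet each application moves it one step up the
  radical filtration. With \<open>\<psi> = 1 - \<theta>\<close> this gives the injectivity of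
  \<theta> without a bound on degrees.\<close>

lemma radical_endo_fixed_zero:
  assumes P: "gr_projective \<Gamma> P" and \<psi>: "ghom P P \<psi>"
    and rad: "\<And>x. x \<in> mcar P \<Longrightarrow> \<psi> x \<in> graded_radical \<Gamma> P"
    and x: "x \<in> mcar P" "\<psi> x = x"
  shows "x = 0"
proof (rule projective_separated[OF P x(1)])
  fix m show "x \<in> radical_power m P"
  proof (induction m)
    case 0 show ?case by (rule radical_power_zero[OF projective_gmodule[OF P] x(1)])
  next
    case (Suc m) then show ?case using radical_power_Suc[OF \<psi> rad] x(2) by metis
  qed
qed

section \<open>Nakayama's lemma and projective covers\<close>

definition bounded_below :: "('a, 'm::zero) gmod \<Rightarrow> bool" where
  "bounded_below M \<longleftrightarrow> (\<exists>b. \<forall>t<b. mdeg M t = {0})"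

text \<open>Induction on the degree, starting at a lower bound \<open>b\<close> of \<open>Q\<close>.
  The component in degree \<open>b + int n\<close> of a radical element arises from elements of
  positive degree acting on components of smaller degree, which lie in the image already.\<close>

lemma nakayama:
  assumes \<theta>: "ghom P Q \<theta>" and "bounded_below Q"
    and mod_rad: "\<And>y. y \<in> mcar Q \<Longrightarrow> \<exists>x\<in>mcar P. y - \<theta> x \<in> graded_radical \<Gamma> Q"
  shows "\<theta> ` mcar P = mcar Q"
proof
  note P = ghom_gmodule(1)[OF \<theta>] and Q = ghom_gmodule(2)[OF \<theta>]
  show "\<theta> ` mcar P \<subseteq> mcar Q" using ghom_mcar[OF \<theta>] by blast
  let ?H = "\<theta> ` mcar P"
  obtain b where b: "\<And>t. t < b \<Longrightarrow> mdeg Q t = {0}" using assms(2) unfolding bounded_below_def by blast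
  have H0: "0 \<in> ?H" by (rule image_eqI[of _ _ 0]) (simp_all add: ghom_zero[OF \<theta>] mcar_zero[OF P])
  have Hadd: "x + y \<in> ?H" if "x \<in> ?H" "y \<in> ?H" for x y
  proof -
    obtain u v where "u \<in> mcar P" "x = \<theta> u" "v \<in> mcar P" "y = \<theta> v" using \<open>x \<in> ?H\<close> \<open>y \<in> ?H\<close> by blast
    then show ?thesis by (intro image_eqI[of _ _ "u + v"]) (simp_all add: ghom_add[OF \<theta>] mcar_add[OF P])
  qed
  have act: "act Q a x \<in> ?H" if "x \<in> ?H" for a x
  proof -
    obtain u where "u \<in> mcar P" "x = \<theta> u" using \<open>x \<in> ?H\<close> by blast
    then show ?thesis by (intro image_eqI[of _ _ "act P a u"]) (simp_all add: ghom_act[OF \<theta>] act_mcar[OF P])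
  qed
  have "mdeg Q (b + int n) \<subseteq> ?H" for n
  proof (induction n rule: less_induct)
    case (less n)
    have rad: "hcomp (mdeg Q) z (b + int n) \<in> ?H" if "z \<in> graded_radical \<Gamma> Q" for z
      using that unfolding graded_radical_def
    proof (induction rule: add_span_induct)
      case zero show ?case using H0 comp_zero[OF Q] by simp
    next
      case (add x y)
      then obtain a v s where x: "x = act Q a v" "a \<in> deg \<Gamma> (Suc s)" "v \<in> mcar Q" by blast
      let ?t = "b + int n - int (Suc s)"
      have v: "hcomp (mdeg Q) v ?t \<in> mdeg Q ?t" by (rule comp_mdeg[OF Q x(3)])
      have "hcomp (mdeg Q) v ?t \<in> ?H"
      proof (cases "?t < b")
        case True
        then have "hcomp (mdeg Q) v ?t = 0" using b[of ?t] v by blast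
        then show ?thesis using H0 by simp
      next
        case False
        then have "?t = b + int (n - Suc s)" "n - Suc s < n" by auto
        then show ?thesis using less.IH[of "n - Suc s"] v by (metis subsetD)
      qed
      then have 1: "hcomp (mdeg Q) x (b + int n) \<in> ?H" using act comp_act[OF Q x(2,3)] x(1) by simp
      have "x \<in> mcar Q" "y \<in> mcar Q"
        using x act_mcar[OF Q] add(2) radical_mcar[OF Q] unfolding graded_radical_def by auto
      then show ?case using comp_add[OF Q] Hadd[OF 1 add(3)] by simp
    qed
    show ?case
    proof
      fix y assume y: "y \<in> mdeg Q (b + int n)"
      then obtain x where x: "x \<in> mcar P" "y - \<theta> x \<in> graded_radical \<Gamma> Q"
        using mod_rad mdeg_mcar[OF Q] by blast
      \<comment> \<open>The congruence modulo the radical need not be homogeneous; only its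
        component in degree \<open>b + int n\<close> is used.\<close>
      let ?x = "hcomp (mdeg P) x (b + int n)"
      have "hcomp (mdeg Q) (y - \<theta> x) (b + int n) = y - \<theta> ?x"
        using comp_diff[OF Q mdeg_mcar[OF Q y] ghom_mcar[OF \<theta> x(1)]] comp_homogeneous[OF Q y]
          ghom_hcomp[OF \<theta> x(1)] by simp
      then have "y - \<theta> ?x \<in> ?H" using rad[OF x(2)] by simp
      moreover have "\<theta> ?x \<in> ?H" using mdeg_mcar[OF P comp_mdeg[OF P x(1)]] by blast
      ultimately show "y \<in> ?H" using Hadd[of "y - \<theta> ?x" "\<theta> ?x"] by simp
    qed
  qed
  then have hom: "mdeg Q t \<subseteq> ?H"
    for t
  proof (cases "t < b")
    case True then show ?thesis using b[of t] H0 by simp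
  next
    case False
    then have "t = b + int (nat (t - b))" by simp
    then show ?thesis using \<open>\<And>n. mdeg Q (b + int n) \<subseteq> ?H\<close> by metis
  qed
  show "mcar Q \<subseteq> ?H"
  proof
    fix y assume "y \<in> mcar Q"
    with Q show "y \<in> ?H" by (induction rule: mcar_induct) (use H0 Hadd hom in blast)+
  qed
qed

text \<open>A lift \<alpha> of \<open>q\<close> through \<open>\<gamma> \<circ> p\<close> is an
  inverse of \<theta> modulo the radical on both sides. Nakayama's lemma gives surjectivity from the
  bound on \<open>Q\<close>; injectivity is \<open>radical_endo_fixed_zero\<close> for
  \<open>1 - \<alpha> \<theta>\<close>. The maps \<open>p\<close> and \<open>q\<close> need not be
  onto: in the inductions below, \<open>M\<close> and \<open>N\<close> are the terms one place
  lower, of which only the cycles are covered.\<close>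

lemma projective_cover_iso:
  fixes p :: "(nat \<Rightarrow> 'a) \<Rightarrow> 'm::ab_group_add" and \<iota> :: "'n::ab_group_add \<Rightarrow> nat \<Rightarrow> 'a"
    and M :: "('a, 'm) gmod" and N :: "('a, 'n) gmod"
  assumes P: "gr_projective \<Gamma> P" and Q: "gr_projective \<Gamma> Q" and "bounded_below Q"
    and p: "ghom P M p" and q: "ghom Q N q" and \<gamma>: "ghom M N \<gamma>" and inj: "inj_on \<gamma> (mcar M)"
    and \<theta>: "ghom P Q \<theta>" and comm: "\<And>x. x \<in> mcar P \<Longrightarrow> q (\<theta> x) = \<gamma> (p x)"
    and im: "q ` mcar Q \<subseteq> (\<lambda>x. \<gamma> (p x)) ` mcar P"
    and kerp: "\<And>x. x \<in> mcar P \<Longrightarrow> p x = 0 \<Longrightarrow> x \<in> graded_radical \<Gamma> P"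
    and kerq: "\<And>x. x \<in> mcar Q \<Longrightarrow> q x = 0 \<Longrightarrow> x \<in> graded_radical \<Gamma> Q"
    and \<iota>: "coding \<iota> \<kappa>"
  shows "bij_betw \<theta> (mcar P) (mcar Q)"
proof -
  obtain \<alpha> where \<alpha>: "ghom Q P \<alpha>" "\<And>x. x \<in> mcar Q \<Longrightarrow> \<gamma> (p (\<alpha> x)) = q x"
    using projective_lift[OF Q ghom_comp[OF p \<gamma>] q im coding_id \<iota>] by blast
  have "y - \<theta> (\<alpha> y) \<in> graded_radical \<Gamma> Q" if y: "y \<in> mcar Q" for y
  proof (rule kerq)
    show "y - \<theta> (\<alpha> y) \<in> mcar Q"
      using y ghom_mcar[OF \<alpha>(1)] ghom_mcar[OF \<theta>] mcar_diff[OF ghom_gmodule(1)[OF q]] by blast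
    show "q (y - \<theta> (\<alpha> y)) = 0"
      using y ghom_mcar[OF \<alpha>(1)] ghom_mcar[OF \<theta>] ghom_diff[OF q] comm \<alpha>(2) by simp
  qed
  then have surj: "\<theta> ` mcar P = mcar Q"
    using ghom_mcar[OF \<alpha>(1)] by (intro nakayama[OF \<theta> assms(3)]) blast
  have \<psi>: "ghom P P (\<lambda>x. x - \<alpha> (\<theta> x))"
    by (rule ghom_minus[OF ghom_id[OF ghom_gmodule(1)[OF p]] ghom_comp[OF \<theta> \<alpha>(1)]])
  have rad: "x - \<alpha> (\<theta> x) \<in> graded_radical \<Gamma> P" if x: "x \<in> mcar P" for x
  proof (rule kerp)
    have \<alpha>x: "\<alpha> (\<theta> x) \<in> mcar P" using x ghom_mcar[OF \<alpha>(1)] ghom_mcar[OF \<theta>] by blast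
    then show "x - \<alpha> (\<theta> x) \<in> mcar P" using x mcar_diff[OF ghom_gmodule(1)[OF p]] by blast
    have "\<gamma> (p (\<alpha> (\<theta> x))) = \<gamma> (p x)" using \<alpha>(2) ghom_mcar[OF \<theta> x] comm[OF x] by simp
    then have "p (\<alpha> (\<theta> x)) = p x" using inj ghom_mcar[OF p] x \<alpha>x by (meson inj_onD)
    then show "p (x - \<alpha> (\<theta> x)) = 0" using ghom_diff[OF p x \<alpha>x] by simp
  qed
  have "x = 0" if x: "x \<in> mcar P" "\<theta> x = 0" for x
    by (rule radical_endo_fixed_zero[OF P \<psi> rad x(1)]) (simp_all add: x ghom_zero[OF \<alpha>(1)])
  moreover have "\<theta> (x - y) = 0 \<longleftrightarrow> \<theta> x = \<theta> y" if "x \<in> mcar P" "y \<in> mcar P" for x y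
    using ghom_diff[OF \<theta> that] by simp
  ultimately have "inj_on \<theta> (mcar P)"
    using mcar_diff[OF ghom_gmodule(1)[OF p]] by (intro inj_onI) (metis eq_iff_diff_eq_0)
  then show ?thesis using surj unfolding bij_betw_def by blast
qed

lemma identity_mod_radical_bij:
  assumes P: "gr_projective \<Gamma> P" "bounded_below P" and \<theta>: "ghom P P \<theta>"
    and rad: "\<And>x. x \<in> mcar P \<Longrightarrow> x - \<theta> x \<in> graded_radical \<Gamma> P"
  shows "bij_betw \<theta> (mcar P) (mcar P)"
proof -
  note gm = ghom_gmodule(1)[OF \<theta>]
  have surj: "\<theta> ` mcar P = mcar P" by (rule nakayama[OF \<theta> P(2)]) (use rad in blast)
  have "x = 0" if x: "x \<in> mcar P" "\<theta> x = 0" for x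
    by (rule radical_endo_fixed_zero[OF P(1) ghom_minus[OF ghom_id[OF gm] \<theta>] rad x(1)]) (simp_all add: x)
  moreover have "\<theta> (x - y) = 0 \<longleftrightarrow> \<theta> x = \<theta> y" if "x \<in> mcar P" "y \<in> mcar P" for x y
    using ghom_diff[OF \<theta> that] by simp
  ultimately have "inj_on \<theta> (mcar P)"
    using mcar_diff[OF gm] by (intro inj_onI) (metis eq_iff_diff_eq_0)
  then show ?thesis using surj unfolding bij_betw_def by blast
qed

text \<open>The inverse demanded by the definition is a homomorphism as soon as the map is bijective
  on the carrier, and bijectivity is what Nakayama-type arguments deliver.\<close>

lemma radical_map_iff:
  assumes f: "ghom X Y f"
  shows "radical_map X Y f \<longleftrightarrow>
    (\<forall>g. ghom Y X g \<longrightarrow> bij_betw (\<lambda>x. x - g (f x)) (mcar X) (mcar X))"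
proof
  note X = ghom_gmodule(1)[OF f] and Y = ghom_gmodule(2)[OF f]
  assume rad: "radical_map X Y f"
  show "\<forall>g. ghom Y X g \<longrightarrow> bij_betw (\<lambda>x. x - g (f x)) (mcar X) (mcar X)"
  proof (intro allI impI)
    fix g assume g: "ghom Y X g"
    then obtain h where h: "gr_hom X X h" "\<And>x. x \<in> mcar X \<Longrightarrow> h (x - g (f x)) = x"
      "\<And>x. x \<in> mcar X \<Longrightarrow> h x - g (f (h x)) = x"
      using rad unfolding radical_map_def ghom_def by meson
    have "ghom X X h" using h(1) X unfolding ghom_def by blast
    then show "bij_betw (\<lambda>x. x - g (f x)) (mcar X) (mcar X)"
      using h ghom_mcar[of X X h] ghom_mcar[OF ghom_minus[OF ghom_id[OF X] ghom_comp[OF f g]]]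
      by (intro bij_betw_byWitness[of _ h]) auto
  qed
next
  note X = ghom_gmodule(1)[OF f] and Y = ghom_gmodule(2)[OF f]
  assume bij: "\<forall>g. ghom Y X g \<longrightarrow> bij_betw (\<lambda>x. x - g (f x)) (mcar X) (mcar X)"
  show "radical_map X Y f"
    unfolding radical_map_def
  proof (intro conjI allI impI)
    show "gr_hom X Y f" using f unfolding ghom_def by blast
    fix g assume "gr_hom Y X g"
    then have g: "ghom Y X g" using X Y unfolding ghom_def by blast
    let ?u = "\<lambda>x. x - g (f x)"
    have u: "ghom X X ?u" by (rule ghom_minus[OF ghom_id[OF X] ghom_comp[OF f g]])
    have b: "bij_betw ?u (mcar X) (mcar X)" using bij g by blast
    let ?h = "inv_into (mcar X) ?u"
    have left: "?h (x - g (f x)) = x" if "x \<in> mcar X" for x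
      using inv_into_f_f[OF bij_betw_imp_inj_on[OF b] that] .
    have right: "?h x - g (f (?h x)) = x" if "x \<in> mcar X" for x
      using f_inv_into_f[of x ?u "mcar X"] b that unfolding bij_betw_def by simp
    have "ghom X X ?h" by (rule ghom_inverse[OF u b]) (rule left)
    then show "\<exists>h. gr_hom X X h \<and> (\<forall>x\<in>mcar X. h (x - g (f x)) = x \<and> h x - g (f (h x)) = x)"
      using left right unfolding ghom_def by blast
  qed
qed

text \<open>\<open>g \<circ> f\<close> has radical image for every \<open>g\<close>, so
  \<open>1 - g f\<close> is the identity modulo the radical.\<close>

lemma radical_image_radical_map:
  assumes X: "gr_projective \<Gamma> X" "bounded_below X" and f: "ghom X Y f"
    and rad: "\<And>x. x \<in> mcar X \<Longrightarrow> f x \<in> graded_radical \<Gamma> Y"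
  shows "radical_map X Y f"
  unfolding radical_map_iff[OF f]
proof (intro allI impI)
  fix g assume g: "ghom Y X g"
  show "bij_betw (\<lambda>x. x - g (f x)) (mcar X) (mcar X)"
    by (rule identity_mod_radical_bij[OF X ghom_minus[OF ghom_id[OF ghom_gmodule(1)[OF f]] ghom_comp[OF f g]]])
      (simp add: ghom_radical[OF g] rad)
qed

section \<open>The regular and the simple modules\<close>

lemma regular_mdeg: "mdeg (regular_mod \<Gamma>) t = (if 0 \<le> t then deg \<Gamma> (nat t) else {0})"
  and regular_act [simp]: "act (regular_mod \<Gamma>) a x = a * x"
  by (simp_all add: regular_mod_def)

lemma
  shows mcar_regular [simp]: "mcar (regular_mod \<Gamma>) = UNIV"
    and regular_gmodule: "gmodule \<Gamma> (regular_mod \<Gamma>)"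
proof -
  interpret indep_graded_group "deg \<Gamma>" by (rule deg_group)
  interpret R: graded_group "mdeg (regular_mod \<Gamma>)"
    by unfold_locales (auto simp: regular_mdeg intro: zero_mem diff_mem)
  have "a \<in> mcar (regular_mod \<Gamma>)" for a
  proof (induction a rule: alg_induct)
    case zero show ?case unfolding mcar_def by (rule R.family_sum_zero)
  next
    case (add s a b)
    then have "a \<in> mdeg (regular_mod \<Gamma>) (int s)" by (simp add: regular_mdeg)
    then show ?case using add(2) R.mem_family_sum R.family_sum_add unfolding mcar_def by blast
  qed
  then show car: "mcar (regular_mod \<Gamma>) = UNIV" by blast
  have "family_indep (mdeg (regular_mod \<Gamma>))"
    unfolding family_indep_def[of "mdeg (regular_mod \<Gamma>)"]
  proof (intro allI impI ballI, elim conjE)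
    fix F x t assume F: "finite F" "\<forall>t\<in>F. x t \<in> mdeg (regular_mod \<Gamma>) t" "(\<Sum>t\<in>F. x t) = 0" "t \<in> F"
    have neg: "x t = 0" if "t \<in> F" "t < 0" for t using F(2) that by (auto simp: regular_mdeg)
    \<comment> \<open>Negative degrees carry only zero, so the family is reindexed to natural
      degrees, where independence is known.\<close>
    let ?G = "nat ` (F \<inter> {0..})"
    have "(\<Sum>s\<in>?G. x (int s)) = (\<Sum>t\<in>F \<inter> {0..}. x t)"
      by (subst sum.reindex) (auto intro: inj_onI)
    also have "\<dots> = (\<Sum>t\<in>F. x t)" using F(1) neg by (intro sum.mono_neutral_left) force+
    finally have sum: "(\<Sum>s\<in>?G. x (int s)) = 0" using F(3) by simp
    show "x t = 0"
    proof (cases "t < 0")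
      case True then show ?thesis using neg F(4) by blast
    next
      case False
      have "\<forall>s\<in>?G. x (int s) \<in> deg \<Gamma> s" using F(2) by (force simp: regular_mdeg)
      moreover have "nat t \<in> ?G" using False F(4) by auto
      ultimately have "x (int (nat t)) = 0"
        using family_indepD[OF indep, of ?G "\<lambda>s. x (int s)" "nat t"] sum F(1) by blast
      then show ?thesis using False by simp
    qed
  qed
  moreover have "a * x \<in> mdeg (regular_mod \<Gamma>) (int s + t)"
    if "a \<in> deg \<Gamma> s" "x \<in> mdeg (regular_mod \<Gamma>) t" for a x s t
    using that deg_mult[of a s x "nat t"] R.zero_mem
    by (cases "0 \<le> t") (auto simp: regular_mdeg nat_add_distrib)
  moreover have "\<exists>F. finite F \<and> (\<Sum>i\<in>F. idem \<Gamma> i) * x = x" for x using local_unit[of x] by blast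
  ultimately show "gmodule \<Gamma> (regular_mod \<Gamma>)"
    unfolding gmodule_def car using R.zero_mem R.diff_mem by (auto simp: algebra_simps)
qed

text \<open>Evaluation at \<open>x\<close>: under the convention for shifts, an element of degree
  \<open>s\<close> corresponds to a degree 0 map from the algebra into \<open>M\<close> shifted by
  \<open>s\<close>.\<close>

lemma ghom_from_regular:
  assumes M: "gmodule \<Gamma> M" and x: "x \<in> mdeg M s"
  shows "ghom (regular_mod \<Gamma>) (shift M s) (\<lambda>a. act M a x)"
proof (rule ghomI)
  have xc: "x \<in> mcar M" by (rule mdeg_mcar[OF M x])
  show "act M a x \<in> mdeg (shift M s) t" if a: "a \<in> mdeg (regular_mod \<Gamma>) t" for t a
  proof (cases "0 \<le> t")
    case True
    then have "a \<in> deg \<Gamma> (nat t)" using a by (simp add: regular_mdeg)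
    from act_mdeg[OF M this x] True show ?thesis by simp
  next
    case False
    then have "a = 0" using a by (simp add: regular_mdeg)
    then show ?thesis using act_zero_left[OF M xc] mdeg_zero[OF M] by simp
  qed
  show "act M (a + b) x = act M a x + act M b x" for a b by (rule act_add_left[OF M xc])
  show "act M (act (regular_mod \<Gamma>) a b) x = act (shift M s) a (act M b x)" for a b
    using act_mult[OF M xc] by simp
qed (simp_all add: regular_gmodule gmodule_shift[OF M])

text \<open>Turns the definite description into a component, which makes additivity and
  multiplicativity accessible.\<close>

lemma degree0_part_eq: "degree0_part \<Gamma> a = hcomp (deg \<Gamma>) a 0"
proof -
  interpret indep_graded_group "deg \<Gamma>" by (rule deg_group)
  interpret P: graded_group "\<lambda>t. deg \<Gamma> (Suc t)" using zero_mem diff_mem by unfold_locales auto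
  have U: "a \<in> family_sum (deg \<Gamma>)" for a using deg_sum_UNIV by simp
  have zero: "hcomp (deg \<Gamma>) b 0 = 0" if "b \<in> family_sum (\<lambda>t. deg \<Gamma> (Suc t))" for b
    using that by (induction rule: P.family_sum_induct)
      (auto simp: hcomp_zero hcomp_add[OF U U] hcomp_homogeneous)
  have diff: "a - hcomp (deg \<Gamma>) a 0 \<in> family_sum (\<lambda>t. deg \<Gamma> (Suc t))"
  proof (induction a rule: alg_induct)
    case zero then show ?case by (simp add: hcomp_zero P.family_sum_zero)
  next
    case (add s a b)
    have "a - hcomp (deg \<Gamma>) a 0 \<in> family_sum (\<lambda>t. deg \<Gamma> (Suc t))"
    proof (cases s)
      case 0 then show ?thesis using hcomp_homogeneous[OF add(1)] P.family_sum_zero by simp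
    next
      case (Suc r)
      then show ?thesis using hcomp_homogeneous[OF add(1)] P.mem_family_sum[of a r] add(1) by simp
    qed
    from P.family_sum_add[OF this add(2)] show ?case using hcomp_add[OF U U, of a b 0] by (simp add: algebra_simps)
  qed
  show ?thesis
    unfolding degree0_part_def
  proof (rule the_equality)
    show "hcomp (deg \<Gamma>) a 0 \<in> deg \<Gamma> 0 \<and> a - hcomp (deg \<Gamma>) a 0 \<in> family_sum (\<lambda>t. deg \<Gamma> (Suc t))"
      using diff hcomp_props(2)[OF U] by blast
    fix b assume b: "b \<in> deg \<Gamma> 0 \<and> a - b \<in> family_sum (\<lambda>t. deg \<Gamma> (Suc t))"
    have "hcomp (deg \<Gamma>) a 0 - hcomp (deg \<Gamma>) b 0 = 0" using zero b hcomp_diff[OF U U] by metis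
    moreover have "hcomp (deg \<Gamma>) b 0 = b" using hcomp_homogeneous[of b 0] b by simp
    ultimately show "b = hcomp (deg \<Gamma>) a 0" by simp
  qed
qed

lemma degree0_part_deg: "a \<in> deg \<Gamma> s \<Longrightarrow> degree0_part \<Gamma> a = (if s = 0 then a else 0)"
proof -
  interpret indep_graded_group "deg \<Gamma>" by (rule deg_group)
  show "a \<in> deg \<Gamma> s \<Longrightarrow> degree0_part \<Gamma> a = (if s = 0 then a else 0)"
    unfolding degree0_part_eq using hcomp_homogeneous[of a s] by simp
qed

lemma degree0_part_add: "degree0_part \<Gamma> (a + b) = degree0_part \<Gamma> a + degree0_part \<Gamma> b"
proof -
  interpret indep_graded_group "deg \<Gamma>" by (rule deg_group)
  show ?thesis unfolding degree0_part_eq by (rule hcomp_add) (simp_all add: deg_sum_UNIV)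
qed

lemma degree0_part_mem: "degree0_part \<Gamma> a \<in> deg \<Gamma> 0"
proof -
  interpret indep_graded_group "deg \<Gamma>" by (rule deg_group)
  show ?thesis unfolding degree0_part_eq by (rule hcomp_props) (simp add: deg_sum_UNIV)
qed

text \<open>The elements of positive degree form an ideal, so taking the degree 0 part is a ring
  homomorphism; the simple modules are modules through it.\<close>

lemma degree0_part_mult: "degree0_part \<Gamma> (a * b) = degree0_part \<Gamma> a * degree0_part \<Gamma> b"
proof (induction a rule: alg_induct)
  case zero show ?case using degree0_part_add[of 0 0] by simp
next
  case (add s a a')
  have "degree0_part \<Gamma> (a * b) = degree0_part \<Gamma> a * degree0_part \<Gamma> b"
  proof (induction b rule: alg_induct)
    case zero show ?case using degree0_part_add[of 0 0] by simp
  next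
    case (add t b b')
    have "degree0_part \<Gamma> (a * b) = degree0_part \<Gamma> a * degree0_part \<Gamma> b"
      using degree0_part_deg[OF deg_mult[OF \<open>a \<in> deg \<Gamma> s\<close> add(1)]] degree0_part_deg[OF add(1)]
        degree0_part_deg[OF \<open>a \<in> deg \<Gamma> s\<close>] by auto
    then show ?case using add(2) degree0_part_add by (simp add: distrib_left)
  qed
  then show ?case using add(2) degree0_part_add by (simp add: distrib_right)
qed

text \<open>Orthogonality of the idempotents leaves only the coefficient at \<open>i\<close>. Both
  the simple module and the target of the top Ext isomorphism become one-dimensional in this
  way.\<close>

lemma deg0_mult_idem:
  assumes "a \<in> deg \<Gamma> 0" shows "\<exists>c. a * idem \<Gamma> i = scl \<Gamma> c (idem \<Gamma> i)" "\<exists>c. idem \<Gamma> i * a = scl \<Gamma> c (idem \<Gamma> i)"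
proof -
  have "(\<exists>c. a * idem \<Gamma> i = scl \<Gamma> c (idem \<Gamma> i)) \<and> (\<exists>c. idem \<Gamma> i * a = scl \<Gamma> c (idem \<Gamma> i))"
    using assms unfolding deg0
  proof (induction rule: V.span_induct_alt)
    case base show ?case by (auto intro!: exI[of _ 0])
  next
    case (step c x y)
    then obtain j where x: "x = idem \<Gamma> j" by blast
    from step obtain d d' where "y * idem \<Gamma> i = scl \<Gamma> d (idem \<Gamma> i)" "idem \<Gamma> i * y = scl \<Gamma> d' (idem \<Gamma> i)"
      by blast
    then show ?case
      unfolding x distrib_right distrib_left scl_left[symmetric] scl_right[symmetric] idem_mult
      by (cases "i = j") (auto simp: V.scale_left_distrib[symmetric])
  qed
  then show "\<exists>c. a * idem \<Gamma> i = scl \<Gamma> c (idem \<Gamma> i)" "\<exists>c. idem \<Gamma> i * a = scl \<Gamma> c (idem \<Gamma> i)" by auto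
qed

lemma deg0_idem_eq: "{a * idem \<Gamma> i | a. a \<in> deg \<Gamma> 0} = {scl \<Gamma> c (idem \<Gamma> i) | c. True}"
proof -
  have "\<exists>a. scl \<Gamma> c (idem \<Gamma> i) = a * idem \<Gamma> i \<and> a \<in> deg \<Gamma> 0" for c
    by (rule exI[of _ "scl \<Gamma> c (idem \<Gamma> i)"]) (simp add: scl_left[symmetric] idem_mult idem_deg0)
  then show ?thesis using deg0_mult_idem(1) by blast
qed

lemma simple_mdeg: "mdeg (simple_mod \<Gamma> i) t = (if t = 0 then {scl \<Gamma> c (idem \<Gamma> i) | c. True} else {0})"
  and simple_act: "act (simple_mod \<Gamma> i) a x = degree0_part \<Gamma> a * x"
  by (simp_all add: simple_mod_def deg0_idem_eq)

lemma
  shows mcar_simple: "mcar (simple_mod \<Gamma> i) = {scl \<Gamma> c (idem \<Gamma> i) | c. True}"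
    and simple_gmodule: "gmodule \<Gamma> (simple_mod \<Gamma> i)"
proof -
  let ?L = "{scl \<Gamma> c (idem \<Gamma> i) | c. True}"
  have zero: "0 \<in> ?L" by (auto intro!: exI[of _ 0])
  have plus: "x + y \<in> ?L" if "x \<in> ?L" "y \<in> ?L" for x y
    using that V.scale_left_distrib[symmetric] by blast
  have diff: "x - y \<in> ?L" if "x \<in> ?L" "y \<in> ?L" for x y
    using that V.scale_left_diff_distrib[symmetric] by blast
  interpret graded_group "mdeg (simple_mod \<Gamma> i)"
    using zero diff by unfold_locales (auto simp: simple_mdeg)
  have "x \<in> ?L" if "x \<in> mcar (simple_mod \<Gamma> i)" for x
    using that unfolding mcar_def
    by (induction rule: family_sum_induct) (use zero plus in \<open>auto simp: simple_mdeg split: if_splits\<close>)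
  moreover have "x \<in> mcar (simple_mod \<Gamma> i)" if "x \<in> ?L" for x
    using mem_family_sum[of x 0] that unfolding mcar_def by (simp add: simple_mdeg)
  ultimately show car: "mcar (simple_mod \<Gamma> i) = ?L" by blast
  have "family_indep (mdeg (simple_mod \<Gamma> i))"
    unfolding family_indep_def
  proof (intro allI impI ballI, elim conjE)
    fix F x t assume F: "finite F" "\<forall>t\<in>F. x t \<in> mdeg (simple_mod \<Gamma> i) t" "(\<Sum>t\<in>F. x t) = 0" "t \<in> F"
    have nz: "x t = 0" if "t \<in> F" "t \<noteq> 0" for t using F(2) that by (auto simp: simple_mdeg)
    show "x t = 0"
    proof (cases "t = 0")
      case True
      have "(\<Sum>t\<in>{t}. x t) = (\<Sum>t\<in>F. x t)" using F nz True by (intro sum.mono_neutral_left) auto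
      then show ?thesis using F(3) by simp
    qed (use nz F(4) in blast)
  qed
  moreover have "degree0_part \<Gamma> a * x \<in> mdeg (simple_mod \<Gamma> i) (int s + t)"
    if a: "a \<in> deg \<Gamma> s" and x: "x \<in> mdeg (simple_mod \<Gamma> i) t" for a x s t
  proof (cases "s = 0 \<and> t = 0")
    case True
    then obtain c where "x = scl \<Gamma> c (idem \<Gamma> i)" using x by (auto simp: simple_mdeg)
    moreover obtain d where "degree0_part \<Gamma> a * idem \<Gamma> i = scl \<Gamma> d (idem \<Gamma> i)"
      using deg0_mult_idem(1)[OF degree0_part_mem] by blast
    ultimately have "degree0_part \<Gamma> a * x = scl \<Gamma> (c * d) (idem \<Gamma> i)"
      using scl_right by (metis V.scale_scale)
    then show ?thesis using True by (auto simp: simple_mdeg)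
  next
    case False
    then have "degree0_part \<Gamma> a * x = 0" using x degree0_part_deg[OF a] by (auto simp: simple_mdeg split: if_splits)
    then show ?thesis using zero_mem by simp
  qed
  moreover have "\<exists>F. finite F \<and> degree0_part \<Gamma> (\<Sum>i\<in>F. idem \<Gamma> i) * x = x" if "x \<in> ?L" for x
    using that by (intro exI[of _ "{i}"]) (auto simp: degree0_part_deg[OF idem_deg0(1)] scl_right[symmetric] idem_mult)
  ultimately show "gmodule \<Gamma> (simple_mod \<Gamma> i)"
    unfolding gmodule_def car simple_act
    using zero_mem diff_mem degree0_part_mult degree0_part_add
    by (intro conjI allI ballI impI) (auto simp: distrib_left distrib_right mult.assoc)
qed

section \<open>Finitely generated modules\<close>

text \<open>The components of \<open>act M a v\<close>, with \<open>v\<close> of degree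
  \<open>t\<close>, come from those of \<open>a\<close>. Hence none lies below \<open>t\<close>, and
  degree \<open>t + int s\<close> receives only the degree \<open>s\<close> component of
  \<open>a\<close>.\<close>

lemma generated_in_degree_mdeg:
  assumes M: "gmodule \<Gamma> M" and gen: "generated_in_degree M t"
  shows "r < t \<Longrightarrow> mdeg M r = {0}"
    and "mdeg M (t + int s) \<subseteq> add_span {act M a v | a v. a \<in> deg \<Gamma> s \<and> v \<in> mdeg M t}"
proof -
  let ?S = "\<lambda>s. {act M a v | a v. a \<in> deg \<Gamma> s \<and> v \<in> mdeg M t}"
  have single: "(\<forall>r<t. hcomp (mdeg M) (act M a v) r = 0)
      \<and> hcomp (mdeg M) (act M a v) (t + int s) \<in> add_span (?S s)" if v: "v \<in> mdeg M t" for a v s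
  proof (induction a rule: alg_induct)
    case zero show ?case using act_zero_left[OF M mdeg_mcar[OF M v]] comp_zero[OF M] add_span_zero by simp
  next
    case (add s' a b)
    have "act M a v \<in> ?S s'" using add(1) v by blast
    then have "hcomp (mdeg M) (act M a v) (t + int s) \<in> add_span (?S s)"
      using comp_homogeneous[OF M act_mdeg[OF M add(1) v]] by (auto intro: add_span_base add_span_zero)
    then show ?case
      using add(2) comp_homogeneous[OF M act_mdeg[OF M add(1) v]] act_add_left[OF M mdeg_mcar[OF M v]]
        comp_add[OF M] act_mcar[OF M mdeg_mcar[OF M v]] by (auto intro: add_span_add)
  qed
  have all: "(\<forall>r<t. hcomp (mdeg M) x r = 0) \<and> hcomp (mdeg M) x (t + int s) \<in> add_span (?S s)"
    if "x \<in> mcar M" for x s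
    using that unfolding gen[unfolded generated_in_degree_def]
  proof (induction rule: add_span_induct)
    case zero show ?case using comp_zero[OF M] add_span_zero by simp
  next
    case (add x y)
    then obtain a v where x: "x = act M a v" "v \<in> mdeg M t" by blast
    have y: "y \<in> mcar M" using add(2) unfolding gen[unfolded generated_in_degree_def] .
    then show ?case
      using single[OF x(2), of a s] x add(3) comp_add[OF M act_mcar[OF M mdeg_mcar[OF M x(2)]] y]
      by (auto intro: add_span_add)
  qed
  show "mdeg M r = {0}" if "r < t"
  proof -
    have "x = 0" if x: "x \<in> mdeg M r" for x
      using all[OF mdeg_mcar[OF M x], of 0] comp_homogeneous[OF M x] \<open>r < t\<close> by metis
    then show ?thesis using mdeg_zero[OF M] by blast
  qed
  show "mdeg M (t + int s) \<subseteq> add_span (?S s)"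
  proof
    fix x assume x: "x \<in> mdeg M (t + int s)"
    show "x \<in> add_span (?S s)"
      using all[OF mdeg_mcar[OF M x], of s] comp_homogeneous[OF M x] by simp
  qed
qed

text \<open>Components below \<open>t\<close> vanish and those above \<open>t\<close> come from
  positive degree elements acting on degree \<open>t\<close>, so only the component in degree
  \<open>t\<close> can obstruct. Minimality of the Koszul complex is detected by this.\<close>

lemma generated_in_degree_radical:
  assumes M: "gmodule \<Gamma> M" and gen: "generated_in_degree M t" and x: "x \<in> mcar M"
    and "hcomp (mdeg M) x t = 0"
  shows "x \<in> graded_radical \<Gamma> M"
proof -
  have "hcomp (mdeg M) x r \<in> graded_radical \<Gamma> M" for r
  proof -
    consider "r < t" | "r = t" | s where "r = t + int (Suc s)"
      by (metis (no_types, opaque_lifting) add.commute zless_iff_Suc_zadd not_less_iff_gr_or_eq)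
    then show ?thesis
    proof cases
      case 1
      then show ?thesis using generated_in_degree_mdeg(1)[OF M gen 1] comp_mdeg[OF M x, of r] radical_zero by auto
    next
      case 2 then show ?thesis using assms(4) radical_zero by simp
    next
      case 3
      have "{act M a v | a v. a \<in> deg \<Gamma> (Suc s) \<and> v \<in> mdeg M t}
          \<subseteq> {act M a x | a x. (\<exists>s. a \<in> deg \<Gamma> (Suc s)) \<and> x \<in> mcar M}"
        using mdeg_mcar[OF M] by blast
      then have "mdeg M r \<subseteq> graded_radical \<Gamma> M"
        using generated_in_degree_mdeg(2)[OF M gen, of "Suc s"] add_span_mono 3
        unfolding graded_radical_def by blast
      then show ?thesis using comp_mdeg[OF M x] by blast
    qed
  qed
  then have "(\<Sum>r | hcomp (mdeg M) x r \<noteq> 0. hcomp (mdeg M) x r) \<in> graded_radical \<Gamma> M"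
    by (intro radical_sum)
  then show ?thesis unfolding comp_sum[OF M x, symmetric] .
qed

section \<open>Finite generating sets and dual bases\<close>

definition combinations :: "('a, 'm::ab_group_add) gmod \<Rightarrow> 'm set \<Rightarrow> 'm set" where
  "combinations M B = {\<Sum>b\<in>B. act M (c b) b | c. True}"

lemma combinationsI: "(\<Sum>b\<in>B. act M (c b) b) \<in> combinations M B"
  unfolding combinations_def by (rule CollectI) (rule exI[of _ c], simp)

lemma combinationsE:
  assumes "x \<in> combinations M B" obtains c where "x = (\<Sum>b\<in>B. act M (c b) b)"
  using assms unfolding combinations_def mem_Collect_eq by (elim exE conjE)

lemma fin_generated_iff: "fin_generated M \<longleftrightarrow> (\<exists>B. finite B \<and> B \<subseteq> mcar M \<and> mcar M \<subseteq> combinations M B)"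
proof -
  have "(\<forall>x \<in> mcar M. \<exists>c. x = (\<Sum>b\<in>B. act M (c b) b)) \<longleftrightarrow> mcar M \<subseteq> combinations M B" for B
    unfolding combinations_def subset_iff Ball_def mem_Collect_eq by simp
  then show ?thesis unfolding fin_generated_def by simp
qed

lemma
  assumes M: "gmodule \<Gamma> M" and B: "finite B" "B \<subseteq> mcar M"
  shows combinations_zero: "0 \<in> combinations M B"
    and combinations_add: "x \<in> combinations M B \<Longrightarrow> y \<in> combinations M B \<Longrightarrow> x + y \<in> combinations M B"
    and combinations_act: "x \<in> combinations M B \<Longrightarrow> act M a x \<in> combinations M B"
    and combinations_base: "b \<in> B \<Longrightarrow> act M a b \<in> combinations M B"
proof -
  have Bc: "b \<in> mcar M" if "b \<in> B" for b using that B by blast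
  have "(\<Sum>b\<in>B. act M ((\<lambda>_. 0) b) b) = 0" using act_zero_left[OF M Bc] by simp
  then show "0 \<in> combinations M B" using combinationsI[where M = M and B = B and c = "\<lambda>_. 0"] by simp
  show "x + y \<in> combinations M B" if xy: "x \<in> combinations M B" "y \<in> combinations M B"
  proof -
    obtain c where c: "x = (\<Sum>b\<in>B. act M (c b) b)" by (rule combinationsE[OF xy(1)])
    obtain d where d: "y = (\<Sum>b\<in>B. act M (d b) b)" by (rule combinationsE[OF xy(2)])
    have "x + y = (\<Sum>b\<in>B. act M (c b + d b) b)"
      unfolding c d using act_add_left[OF M Bc] by (simp add: sum.distrib[symmetric])
    then show ?thesis using combinationsI[where M = M and B = B and c = "\<lambda>b. c b + d b"] by simp
  qed
  show "act M a x \<in> combinations M B" if x: "x \<in> combinations M B"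
  proof -
    obtain c where c: "x = (\<Sum>b\<in>B. act M (c b) b)" by (rule combinationsE[OF x])
    have "act M a x = (\<Sum>b\<in>B. act M (a * c b) b)"
      unfolding c using act_mult[OF M Bc] act_sum_right[OF M, of B "\<lambda>b. act M (c b) b"] act_mcar[OF M Bc]
      by simp
    then show ?thesis using combinationsI[where M = M and B = B and c = "\<lambda>b. a * c b"] by simp
  qed
  show "act M a b \<in> combinations M B" if "b \<in> B"
  proof -
    have "(\<Sum>b'\<in>B. act M (if b' = b then a else 0) b') = (\<Sum>b'\<in>B. if b' = b then act M a b else 0)"
      using act_zero_left[OF M Bc] by (intro sum.cong) auto
    then have "act M a b = (\<Sum>b'\<in>B. act M (if b' = b then a else 0) b')"
      using that B(1) by (simp add: sum.delta)
    then show ?thesis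
      using combinationsI[where M = M and B = B and c = "\<lambda>b'. if b' = b then a else 0"] by simp
  qed
qed

lemma fin_generated_image:
  assumes f: "ghom M N f" and surj: "f ` mcar M = mcar N" and "fin_generated M"
  shows "fin_generated N"
proof -
  obtain B where B: "finite B" "B \<subseteq> mcar M" "mcar M \<subseteq> combinations M B"
    using assms(3) unfolding fin_generated_iff by blast
  note N = ghom_gmodule(2)[OF f] and M = ghom_gmodule(1)[OF f]
  have fB: "finite (f ` B)" "f ` B \<subseteq> mcar N" using B surj by auto
  have "f x \<in> combinations N (f ` B)" if xM: "x \<in> mcar M" for x
  proof -
    obtain c where x: "x = (\<Sum>b\<in>B. act M (c b) b)" by (rule combinationsE[OF subsetD[OF B(3) xM]])
    have "f x = (\<Sum>b\<in>B. act N (c b) (f b))"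
      unfolding x using ghom_sum[OF f, of B "\<lambda>b. act M (c b) b"] act_mcar[OF M] ghom_act[OF f] B(2)
      by (simp add: subset_iff)
    \<comment> \<open>\<open>f\<close> may identify elements of \<open>B\<close>, so a sum over
      \<open>B\<close> is not literally one over its image; it is rebuilt term by term.\<close>
    also have "(\<Sum>b\<in>G. act N (c b) (f b)) \<in> combinations N (f ` B)" if "finite G" "G \<subseteq> B" for G
      using that by (induction G rule: finite_induct)
        (auto intro!: combinations_zero[OF N fB] combinations_add[OF N fB] combinations_base[OF N fB])
    from this[OF B(1)] have "(\<Sum>b\<in>B. act N (c b) (f b)) \<in> combinations N (f ` B)" by simp
    finally show ?thesis .
  qed
  then have "mcar N \<subseteq> combinations N (f ` B)" unfolding surj[symmetric] by (rule image_subsetI)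
  with fB show ?thesis unfolding fin_generated_iff by (intro exI[of _ "f ` B"] conjI)
qed

text \<open>The homogeneous components of finitely many generators generate. Generation is expressed
  through an arbitrary additively closed set \<open>H\<close>, which avoids choosing
  coefficients.\<close>

lemma homogeneous_generators:
  assumes M: "gmodule \<Gamma> M" and "fin_generated M"
  shows "\<exists>m s x. (\<forall>k<(m::nat). x k \<in> mdeg M (s k)) \<and>
    (\<forall>H. 0 \<in> H \<and> (\<forall>u\<in>H. \<forall>v\<in>H. u + v \<in> H) \<and> (\<forall>k<m. \<forall>a. act M a (x k) \<in> H) \<longrightarrow> mcar M \<subseteq> H)"
proof -
  obtain B where B: "finite B" "B \<subseteq> mcar M" "mcar M \<subseteq> combinations M B"
    using assms(2) unfolding fin_generated_iff by blast
  let ?G = "\<Union>b\<in>B. (\<lambda>t. (t, hcomp (mdeg M) b t)) ` {t. hcomp (mdeg M) b t \<noteq> 0}"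
  have "finite ?G" using B comp_finite[OF M] by blast
  then obtain m :: nat and e where e: "?G = e ` {k. k < m}"
    using finite_imp_nat_seg_image_inj_on[of ?G] by blast
  have mem: "e k \<in> ?G" if "k < m" for k using that unfolding e by blast
  have "\<forall>k<m. snd (e k) \<in> mdeg M (fst (e k))"
  proof (intro allI impI)
    fix k assume "k < m"
    then obtain b t where "b \<in> B" "e k = (t, hcomp (mdeg M) b t)" using mem by blast
    then show "snd (e k) \<in> mdeg M (fst (e k))" using comp_mdeg[OF M] B by auto
  qed
  moreover have "mcar M \<subseteq> H"
    if H: "0 \<in> H" "\<And>u v. u \<in> H \<Longrightarrow> v \<in> H \<Longrightarrow> u + v \<in> H" "\<And>k a. k < m \<Longrightarrow> act M a (snd (e k)) \<in> H" for H
  proof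
    have Hsum: "sum z F \<in> H" if "\<And>k. k \<in> F \<Longrightarrow> z k \<in> H" for F and z :: "'z \<Rightarrow> _"
      using that by (induction F rule: infinite_finite_induct) (auto intro: H)
    fix x assume xM: "x \<in> mcar M"
    obtain c where x: "x = (\<Sum>b\<in>B. act M (c b) b)" by (rule combinationsE[OF subsetD[OF B(3) xM]])
    have "act M a b \<in> H" if b: "b \<in> B" for a b
    proof -
      have bc: "b \<in> mcar M" using b B by blast
      have "act M a (hcomp (mdeg M) b t) \<in> H" if "hcomp (mdeg M) b t \<noteq> 0" for t
      proof -
        have "(t, hcomp (mdeg M) b t) \<in> ?G" using b that by blast
        then obtain k where "k < m" "e k = (t, hcomp (mdeg M) b t)" unfolding e by force
        then show ?thesis using H(3)[of k a] by simp
      qed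
      then have "(\<Sum>t | hcomp (mdeg M) b t \<noteq> 0. act M a (hcomp (mdeg M) b t)) \<in> H" by (intro Hsum) blast
      then have "act M a (\<Sum>t | hcomp (mdeg M) b t \<noteq> 0. hcomp (mdeg M) b t) \<in> H"
        by (subst act_sum_right[OF M]) (rule mdeg_mcar[OF M comp_mdeg[OF M bc]])
      then show ?thesis unfolding comp_sum[OF M bc, symmetric] .
    qed
    then show "x \<in> H" unfolding x by (intro Hsum)
  qed
  ultimately show ?thesis
    by (intro exI[of _ m] exI[of _ "\<lambda>k. fst (e k)"] exI[of _ "\<lambda>k. snd (e k)"] conjI allI impI) simp_all
qed

text \<open>Homogeneous generators of degrees \<open>s k\<close> give a surjection onto
  \<open>X\<close> from a direct sum of shifted copies of the algebra. Projectivity splits it, and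
  the components of the splitting are the coordinates \<open>\<pi> k\<close>.\<close>

lemma dual_basis:
  assumes X: "gr_projective \<Gamma> X" "fin_generated X"
  shows "\<exists>m s x \<pi>. (\<forall>k<(m::nat). x k \<in> mdeg X (s k)) \<and>
    (\<forall>k. ghom (shift X (s k)) (regular_mod \<Gamma>) (\<pi> k)) \<and>
    (\<forall>y\<in>mcar X. y = (\<Sum>k<m. act X (\<pi> k y) (x k)))"
proof -
  have gm: "gmodule \<Gamma> X" by (rule projective_gmodule[OF X(1)])
  obtain m :: nat and s x' where gen1: "\<forall>k<m. x' k \<in> mdeg X (s k)" and gen2:
    "\<forall>H. 0 \<in> H \<and> (\<forall>u\<in>H. \<forall>v\<in>H. u + v \<in> H) \<and> (\<forall>k<m. \<forall>a. act X a (x' k) \<in> H) \<longrightarrow> mcar X \<subseteq> H"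
    using homogeneous_generators[OF gm X(2)] by (elim exE conjE)
  have gen: "\<And>k. k < m \<Longrightarrow> x' k \<in> mdeg X (s k)"
    "\<And>H. 0 \<in> H \<Longrightarrow> (\<And>u v. u \<in> H \<Longrightarrow> v \<in> H \<Longrightarrow> u + v \<in> H) \<Longrightarrow> (\<And>k a. k < m \<Longrightarrow> act X a (x' k) \<in> H)
      \<Longrightarrow> mcar X \<subseteq> H"
  proof -
    show "x' k \<in> mdeg X (s k)" if "k < m" for k using gen1 that by simp
    show "mcar X \<subseteq> H" if "0 \<in> H" "\<And>u v. u \<in> H \<Longrightarrow> v \<in> H \<Longrightarrow> u + v \<in> H"
      "\<And>k a. k < m \<Longrightarrow> act X a (x' k) \<in> H" for H
      using spec[OF gen2, of H] that by simp
  qed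
  \<comment> \<open>\<open>direct_sum\<close> is indexed by all natural numbers; the places from
    \<open>m\<close> on get the zero generator.\<close>
  define x where "x k = (if k < m then x' k else 0)" for k
  have xs: "x k \<in> mdeg X (s k)" for k using gen(1) mdeg_zero[OF gm] by (simp add: x_def)
  define R where "R k = shift (regular_mod \<Gamma>) (- s k)" for k
  have R: "gmodule \<Gamma> (R k)" "mcar (R k) = UNIV" for k
    unfolding R_def by (simp_all add: gmodule_shift regular_gmodule mcar_shift)
  have f: "ghom (R k) X (\<lambda>a. act X a (x k))" for k
    using ghom_shift[OF ghom_from_regular[OF gm xs[of k]], of "- s k"] unfolding R_def shift_shift
    by (simp add: shift_zero)
  define T where "T z = (\<Sum>d | z d \<noteq> 0. act X (z d) (x d))" for z
  have T: "ghom (direct_sum R) X T"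
    using direct_sum_fold[of R X "\<lambda>k a. act X a (x k)", OF f gm] unfolding T_def .
  have "mcar X \<subseteq> T ` mcar (direct_sum R)"
  proof (rule gen(2))
    note D = ghom_gmodule(1)[OF T]
    show "0 \<in> T ` mcar (direct_sum R)"
      by (rule image_eqI[of _ _ 0]) (simp_all add: ghom_zero[OF T] mcar_zero[OF D])
    show "u + v \<in> T ` mcar (direct_sum R)" if uv: "u \<in> T ` mcar (direct_sum R)" "v \<in> T ` mcar (direct_sum R)" for u v
    proof -
      obtain y z where "y \<in> mcar (direct_sum R)" "u = T y" "z \<in> mcar (direct_sum R)" "v = T z" using uv by blast
      then show ?thesis by (intro image_eqI[of _ _ "y + z"]) (simp_all add: ghom_add[OF T] mcar_add[OF D])
    qed
    fix k a assume "k < m"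
    have "(\<lambda>j. if j = k then a else 0) \<in> mcar (direct_sum R)"
      by (rule direct_sum_single[of R]) (simp_all add: R)
    moreover have "T (\<lambda>j. if j = k then a else 0) = act X a (x k)"
      by (cases "a = 0") (auto simp: T_def act_zero_left[OF gm mdeg_mcar[OF gm xs]])
    ultimately show "act X a (x' k) \<in> T ` mcar (direct_sum R)" using \<open>k < m\<close> by (force simp: x_def)
  qed
  then have "(\<lambda>y. y) ` mcar X \<subseteq> T ` mcar (direct_sum R)" by simp
  from projective_lift[OF X(1) T ghom_id[OF gm] this coding_id coding_id]
  obtain \<sigma> where \<sigma>: "ghom X (direct_sum R) \<sigma>" "\<And>y. y \<in> mcar X \<Longrightarrow> T (\<sigma> y) = y" by blast
  have "ghom (shift X (s k)) (regular_mod \<Gamma>) (\<lambda>y. \<sigma> y k)" for k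
  proof -
    have "ghom (shift X (s k)) (shift (R k) (s k)) (\<lambda>y. \<sigma> y k)"
      by (rule ghom_shift[OF ghom_comp[OF \<sigma>(1) direct_sum_component[of R, OF R(1)]]])
    then show ?thesis unfolding R_def shift_shift by (simp add: shift_zero)
  qed
  moreover have "y = (\<Sum>k<m. act X (\<sigma> y k) (x k))" if y: "y \<in> mcar X" for y
  proof -
    have "finite {d. \<sigma> y d \<noteq> 0}" by (rule direct_sum_support(1)[of R, OF R(1) ghom_mcar[OF \<sigma>(1) y]])
    then have "T (\<sigma> y) = (\<Sum>k\<in>{d. \<sigma> y d \<noteq> 0} \<union> {..<m}. act X (\<sigma> y k) (x k))"
      unfolding T_def by (intro sum.mono_neutral_left) (auto simp: act_zero_left[OF gm mdeg_mcar[OF gm xs]])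
    also have "\<dots> = (\<Sum>k<m. act X (\<sigma> y k) (x k))"
      using \<open>finite _\<close> by (intro sum.mono_neutral_right) (auto simp: x_def act_zero_right[OF gm])
    finally show ?thesis using \<sigma>(2)[OF y] by simp
  qed
  ultimately show ?thesis using xs
    by (intro exI[of _ m] exI[of _ s] exI[of _ x] exI[of _ "\<lambda>k y. \<sigma> y k"] conjI allI impI ballI) simp_all
qed

section \<open>Finite generation of Koszul complexes\<close>

lemma scl_idem_mult:
  "scl \<Gamma> c (idem \<Gamma> i) * scl \<Gamma> d (idem \<Gamma> j) = scl \<Gamma> (if i = j then c * d else 0) (idem \<Gamma> j)"
  unfolding scl_left[symmetric] scl_right[symmetric] idem_mult by simp

text \<open>The span over the degree 0 part of a list of homogeneous generators \<open>v\<close>, each multiplied by an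
  idempotent \<open>e\<^sub>j\<close>; it has finite dimension over the ground field.\<close>

primrec line_span :: "('a, 'm::ab_group_add) gmod \<Rightarrow> ('v \<times> 'm) list \<Rightarrow> 'm set" where
  "line_span M [] = {0}"
| "line_span M (p # l) =
    {act M (scl \<Gamma> c (idem \<Gamma> (fst p))) (snd p) + r | c r. r \<in> line_span M l}"

lemma
  assumes M: "gmodule \<Gamma> M" and l: "snd ` set l \<subseteq> mcar M"
  shows line_span_zero: "0 \<in> line_span M l"
    and line_span_mcar: "line_span M l \<subseteq> mcar M"
    and line_span_diff: "x \<in> line_span M l \<Longrightarrow> y \<in> line_span M l \<Longrightarrow> x - y \<in> line_span M l"
    and line_span_act: "x \<in> line_span M l \<Longrightarrow> act M (scl \<Gamma> c (idem \<Gamma> j)) x \<in> line_span M l"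
    and line_span_base: "p \<in> set l \<Longrightarrow> act M (scl \<Gamma> c (idem \<Gamma> (fst p))) (snd p) \<in> line_span M l"
proof -
  have z: "act M (scl \<Gamma> 0 (idem \<Gamma> j)) v = 0" if "v \<in> mcar M" for j v
    using act_zero_left[OF M that] by simp
  have "0 \<in> line_span M l \<and> line_span M l \<subseteq> mcar M
    \<and> (\<forall>x\<in>line_span M l. \<forall>y\<in>line_span M l. x - y \<in> line_span M l)
    \<and> (\<forall>x\<in>line_span M l. \<forall>c j. act M (scl \<Gamma> c (idem \<Gamma> j)) x \<in> line_span M l)
    \<and> (\<forall>p\<in>set l. \<forall>c. act M (scl \<Gamma> c (idem \<Gamma> (fst p))) (snd p) \<in> line_span M l)"
    using l
  proof (induction l)
    case Nil then show ?case by (simp add: act_zero_right[OF M] mcar_zero[OF M])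
  next
    case (Cons p l)
    let ?a = "\<lambda>c. act M (scl \<Gamma> c (idem \<Gamma> (fst p))) (snd p)"
    let ?L = "line_span M l"
    have p: "snd p \<in> mcar M" using Cons.prems by simp
    have IH: "0 \<in> ?L" "?L \<subseteq> mcar M" "\<And>x y. x \<in> ?L \<Longrightarrow> y \<in> ?L \<Longrightarrow> x - y \<in> ?L"
      "\<And>x c j. x \<in> ?L \<Longrightarrow> act M (scl \<Gamma> c (idem \<Gamma> j)) x \<in> ?L"
      "\<And>p c. p \<in> set l \<Longrightarrow> act M (scl \<Gamma> c (idem \<Gamma> (fst p))) (snd p) \<in> ?L"
      using Cons by auto
    have I: "?a c + r \<in> line_span M (p # l)" if "r \<in> ?L" for c r using that by auto
    have zero: "0 \<in> line_span M (p # l)" using I[OF IH(1), of 0] z[OF p] by simp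
    have sub: "line_span M (p # l) \<subseteq> mcar M"
      using act_mcar[OF M p] IH(2) mcar_add[OF M] by auto
    have diff: "x - y \<in> line_span M (p # l)" if xy: "x \<in> line_span M (p # l)" "y \<in> line_span M (p # l)" for x y
    proof -
      obtain c r c' r' where "x = ?a c + r" "r \<in> ?L" "y = ?a c' + r'" "r' \<in> ?L" using xy by auto
      moreover have "?a c - ?a c' = ?a (c - c')" for c c'
        by (simp add: V.scale_left_diff_distrib act_diff_left[OF M p])
      moreover have "(?a c + r) - (?a c' + r') = (?a c - ?a c') + (r - r')" by simp
      ultimately show ?thesis using I[OF IH(3), of r r' "c - c'"] by metis
    qed
    have act: "act M (scl \<Gamma> c (idem \<Gamma> j)) x \<in> line_span M (p # l)" if x: "x \<in> line_span M (p # l)" for x c j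
    proof -
      obtain c' r where r: "x = ?a c' + r" "r \<in> ?L" using x by auto
      have "act M (scl \<Gamma> c (idem \<Gamma> j)) (?a c') = ?a (if j = fst p then c * c' else 0)"
        unfolding act_mult[OF M p, symmetric] scl_idem_mult ..
      then have "act M (scl \<Gamma> c (idem \<Gamma> j)) x
          = ?a (if j = fst p then c * c' else 0) + act M (scl \<Gamma> c (idem \<Gamma> j)) r"
        using r act_add_right[OF M act_mcar[OF M p]] IH(2) by (simp add: subset_iff)
      then show ?thesis using I[OF IH(4)[OF r(2)]] by metis
    qed
    have "act M (scl \<Gamma> c (idem \<Gamma> (fst p'))) (snd p') \<in> line_span M (p # l)" if p': "p' \<in> set (p # l)" for p' c
    proof (cases "p' = p")
      case True then show ?thesis using I[OF IH(1), of c] by simp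
    next
      case False
      then have "act M (scl \<Gamma> c (idem \<Gamma> (fst p'))) (snd p') \<in> ?L" using p' IH(5) by simp
      from I[OF this, of 0] show ?thesis using z[OF p] by simp
    qed
    then show ?case using zero sub diff act by blast
  qed
  then show "0 \<in> line_span M l" "line_span M l \<subseteq> mcar M"
    "x \<in> line_span M l \<Longrightarrow> y \<in> line_span M l \<Longrightarrow> x - y \<in> line_span M l"
    "x \<in> line_span M l \<Longrightarrow> act M (scl \<Gamma> c (idem \<Gamma> j)) x \<in> line_span M l"
    "p \<in> set l \<Longrightarrow> act M (scl \<Gamma> c (idem \<Gamma> (fst p))) (snd p) \<in> line_span M l" by blast+
qed

lemma line_span_add:
  assumes "gmodule \<Gamma> M" "snd ` set l \<subseteq> mcar M" "x \<in> line_span M l" "y \<in> line_span M l"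
  shows "x + y \<in> line_span M l"
  using line_span_diff[OF assms(1,2) assms(3) line_span_diff[OF assms(1,2) line_span_zero[OF assms(1,2)] assms(4)]]
  by simp

lemma line_span_sum:
  assumes "gmodule \<Gamma> M" "snd ` set l \<subseteq> mcar M" "\<And>k. k \<in> F \<Longrightarrow> z k \<in> line_span M l"
  shows "sum z F \<in> line_span M l"
  using assms(3) by (induction F rule: infinite_finite_induct)
    (auto intro: line_span_zero[OF assms(1,2)] line_span_add[OF assms(1,2)])

text \<open>A space that injects into a finite-dimensional one is finite-dimensional; the proof is
  elimination along the list. Either the image of \<open>W\<close> lies in the span of the tail, or
  one element \<open>w'\<close> is split off and all others are reduced by multiples of it to
  \<open>W0\<close>.\<close>

lemma line_span_pullback:
  assumes d: "ghom M N d" and l: "snd ` set l \<subseteq> mcar N" and "W \<subseteq> mcar M" "0 \<in> W"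
    and "\<And>x y. x \<in> W \<Longrightarrow> y \<in> W \<Longrightarrow> x - y \<in> W"
    and "\<And>x c j. x \<in> W \<Longrightarrow> act M (scl \<Gamma> c (idem \<Gamma> j)) x \<in> W"
    and "\<And>x. x \<in> W \<Longrightarrow> d x = 0 \<Longrightarrow> x = 0" and "d ` W \<subseteq> line_span N l"
  shows "\<exists>l'. snd ` set l' \<subseteq> W \<and> W \<subseteq> line_span M l'"
  using assms(2-)
proof (induction l arbitrary: W)
  case Nil
  then have "W \<subseteq> line_span M []" by auto
  then show ?case by (intro exI[of _ "[]"]) simp
next
  case (Cons p l)
  note M = ghom_gmodule(1)[OF d] and N = ghom_gmodule(2)[OF d]
  have l: "snd ` set l \<subseteq> mcar N" and p: "snd p \<in> mcar N" using Cons.prems(1) by auto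
  note L = line_span_zero[OF N l] line_span_diff[OF N l] line_span_act[OF N l]
  let ?a = "\<lambda>c. act N (scl \<Gamma> c (idem \<Gamma> (fst p))) (snd p)"
  define W0 where "W0 = {w \<in> W. d w \<in> line_span N l}"
  have "\<exists>l'. snd ` set l' \<subseteq> W0 \<and> W0 \<subseteq> line_span M l'"
  proof (rule Cons.IH[OF l])
    show "x - y \<in> W0" if "x \<in> W0" "y \<in> W0" for x y
      using that Cons.prems(2,4) L(2) ghom_diff[OF d] unfolding W0_def by (simp add: subset_iff)
    show "act M (scl \<Gamma> c (idem \<Gamma> j)) x \<in> W0" if "x \<in> W0" for x c j
      using that Cons.prems(2,5) L(3) ghom_act[OF d] unfolding W0_def by (simp add: subset_iff)
  qed (use Cons.prems L(1) ghom_zero[OF d] in \<open>auto simp: W0_def\<close>)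
  then obtain l0 where l0: "snd ` set l0 \<subseteq> W0" "W0 \<subseteq> line_span M l0" by blast
  show ?case
  proof (cases "W \<subseteq> W0")
    case True
    then show ?thesis using l0 unfolding W0_def by blast
  next
    case False
    then obtain w where w: "w \<in> W" "d w \<notin> line_span N l" unfolding W0_def by blast
    then obtain c r where r: "d w = ?a c + r" "r \<in> line_span N l" using Cons.prems(7) by force
    have "c \<noteq> 0" using w(2) r act_zero_left[OF N p] by auto
    let ?j = "fst p"
    \<comment> \<open>The idempotent divided by \<open>c\<close> normalizes the coefficient of the
      leading generator to 1, modulo the span of the tail.\<close>
    define w' where "w' = act M (scl \<Gamma> (1 / c) (idem \<Gamma> ?j)) w"
    have w': "w' \<in> W" using Cons.prems(5) w(1) by (simp add: w'_def)
    have "d w' = act N (scl \<Gamma> (1 / c) (idem \<Gamma> ?j)) (?a c) + act N (scl \<Gamma> (1 / c) (idem \<Gamma> ?j)) r"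
      using ghom_act[OF d] w(1) Cons.prems(2) r act_add_right[OF N act_mcar[OF N p]] line_span_mcar[OF N l]
      by (simp add: w'_def subset_iff)
    also have "act N (scl \<Gamma> (1 / c) (idem \<Gamma> ?j)) (?a c) = ?a 1"
      unfolding act_mult[OF N p, symmetric] scl_idem_mult using \<open>c \<noteq> 0\<close> by simp
    finally have dw': "d w' = ?a 1 + act N (scl \<Gamma> (1 / c) (idem \<Gamma> ?j)) r" .
    have "W \<subseteq> line_span M ((?j, w') # l0)"
    proof
      fix x assume x: "x \<in> W"
      then obtain c' r' where r': "d x = ?a c' + r'" "r' \<in> line_span N l" using Cons.prems(7) by force
      let ?y = "act M (scl \<Gamma> c' (idem \<Gamma> ?j)) w'"
      have y: "?y \<in> W" by (rule Cons.prems(5)[OF w'])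
      have s: "act N (scl \<Gamma> (1 / c) (idem \<Gamma> ?j)) r \<in> line_span N l" by (rule L(3)[OF r(2)])
      have "d ?y = act N (scl \<Gamma> c' (idem \<Gamma> ?j)) (?a 1)
          + act N (scl \<Gamma> c' (idem \<Gamma> ?j)) (act N (scl \<Gamma> (1 / c) (idem \<Gamma> ?j)) r)"
        using ghom_act[OF d] w' Cons.prems(2) dw' act_add_right[OF N act_mcar[OF N p]] s line_span_mcar[OF N l]
        by (simp add: subset_iff)
      also have "act N (scl \<Gamma> c' (idem \<Gamma> ?j)) (?a 1) = ?a c'"
        unfolding act_mult[OF N p, symmetric] scl_idem_mult by simp
      finally have "d (x - ?y) = r' - act N (scl \<Gamma> c' (idem \<Gamma> ?j)) (act N (scl \<Gamma> (1 / c) (idem \<Gamma> ?j)) r)"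
        using ghom_diff[OF d] x y Cons.prems(2) r' by (simp add: subset_iff)
      also have "\<dots> \<in> line_span N l" by (rule L(2)[OF r'(2) L(3)[OF s]])
      finally have "x - ?y \<in> W0" using Cons.prems(4)[OF x y] by (simp add: W0_def)
      then have "x - ?y \<in> line_span M l0" using l0 by blast
      then show "x \<in> line_span M ((?j, w') # l0)" by (auto intro!: exI[of _ c'] exI[of _ "x - ?y"])
    qed
    moreover have "snd ` set ((?j, w') # l0) \<subseteq> W" using w' l0 by (auto simp: W0_def)
    ultimately show ?thesis by blast
  qed
qed

text \<open>The arrows starting at a vertex \<open>j\<close> lie in the span of a finite set
  \<open>B j\<close>, and a local unit splits each \<open>b\<close> in it into pieces
  \<open>e_i b\<close>. The new generators are the elements \<open>e_i b v\<close>, labelled by the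
  vertex \<open>i\<close> whose idempotent fixes them.\<close>

lemma line_span_arrows:
  assumes M: "gmodule \<Gamma> M" and l: "snd ` set l \<subseteq> mcar M"
  shows "\<exists>l'. snd ` set l' \<subseteq> mcar M \<and> (\<forall>a\<in>deg \<Gamma> 1. \<forall>v\<in>line_span M l. act M a v \<in> line_span M l')"
proof -
  have "\<forall>j. \<exists>B. finite B \<and> {a * idem \<Gamma> j | a. a \<in> deg \<Gamma> 1} \<subseteq> V.span B" using arrows_finite by blast
  from choice[OF this]
  obtain B where B: "\<And>j. finite (B j)" "\<And>j. {a * idem \<Gamma> j | a. a \<in> deg \<Gamma> 1} \<subseteq> V.span (B j)" by blast
  have "\<exists>F. finite F \<and> (\<forall>b\<in>B j. (\<Sum>i\<in>F. idem \<Gamma> i) * b = b)" for j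
    using local_unit_finite[OF B(1)[of j]] by blast
  then have "\<forall>j. \<exists>F. finite F \<and> (\<forall>b\<in>B j. (\<Sum>i\<in>F. idem \<Gamma> i) * b = b)" by blast
  from choice[OF this]
  obtain F where F: "\<And>j. finite (F j)" "\<And>j b. b \<in> B j \<Longrightarrow> (\<Sum>i\<in>F j. idem \<Gamma> i) * b = b" by blast
  define G where "G p = (\<lambda>(b, i). (i, act M (idem \<Gamma> i * b) (snd p))) ` (B (fst p) \<times> F (fst p))" for p
  have "finite (\<Union>p\<in>set l. G p)" unfolding G_def using B F by auto
  from finite_list[OF this] obtain l' where l': "set l' = (\<Union>p\<in>set l. G p)" ..
  have "snd y \<in> mcar M" if "p \<in> set l" "y \<in> G p" for p y
    using that(2) act_mcar[OF M subsetD[OF l imageI[OF that(1)]]] unfolding G_def by auto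
  then have sub: "snd ` set l' \<subseteq> mcar M" unfolding l' by blast
  note L = line_span_zero[OF M sub] line_span_add[OF M sub] line_span_sum[OF M sub] line_span_base[OF M sub]
  have gen: "act M a (act M (scl \<Gamma> c (idem \<Gamma> (fst p))) (snd p)) \<in> line_span M l'"
    if a: "a \<in> deg \<Gamma> 1" and p: "p \<in> set l" for a c p
  proof -
    let ?j = "fst p" and ?v = "snd p"
    have v: "?v \<in> mcar M" using p l by blast
    have "scl \<Gamma> c a \<in> deg \<Gamma> 1" using a deg_subspace by (rule V.subspace_scale[rotated])
    then have "scl \<Gamma> c a * idem \<Gamma> ?j \<in> V.span (B ?j)" using B(2)[of ?j] by blast
    moreover have "a * scl \<Gamma> c (idem \<Gamma> ?j) = scl \<Gamma> c a * idem \<Gamma> ?j"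
      using scl_left scl_right by metis
    ultimately obtain u where u: "a * scl \<Gamma> c (idem \<Gamma> ?j) = (\<Sum>b\<in>B ?j. scl \<Gamma> (u b) b)"
      unfolding V.span_finite[OF B(1)] by auto
    have "act M (scl \<Gamma> (u b) b) ?v \<in> line_span M l'" if b: "b \<in> B ?j" for b
    proof -
      \<comment> \<open>Splitting \<open>b\<close> turns the scalar into a multiple of an
        idempotent, the only form of coefficient that \<open>line_span\<close> admits.\<close>
      have "scl \<Gamma> (u b) b = (\<Sum>i\<in>F ?j. scl \<Gamma> (u b) (idem \<Gamma> i) * (idem \<Gamma> i * b))"
      proof -
        have "scl \<Gamma> (u b) (idem \<Gamma> i) * (idem \<Gamma> i * b) = scl \<Gamma> (u b) (idem \<Gamma> i * b)" for i
          unfolding scl_left[symmetric] mult.assoc[symmetric] idem_mult by simp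
        then have "(\<Sum>i\<in>F ?j. scl \<Gamma> (u b) (idem \<Gamma> i) * (idem \<Gamma> i * b))
            = scl \<Gamma> (u b) ((\<Sum>i\<in>F ?j. idem \<Gamma> i) * b)"
          by (simp add: sum_distrib_right V.scale_sum_right)
        then show ?thesis using F(2)[OF b] by simp
      qed
      then have "act M (scl \<Gamma> (u b) b) ?v
          = (\<Sum>i\<in>F ?j. act M (scl \<Gamma> (u b) (idem \<Gamma> i)) (act M (idem \<Gamma> i * b) ?v))"
        by (simp add: act_sum_left[OF M v] act_mult[OF M v])
      also have "\<dots> \<in> line_span M l'"
      proof (rule L(3))
        fix i assume i: "i \<in> F ?j"
        have "(i, act M (idem \<Gamma> i * b) ?v) \<in> set l'" unfolding l' G_def using p b i by force
        from L(4)[OF this, of "u b"]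
        show "act M (scl \<Gamma> (u b) (idem \<Gamma> i)) (act M (idem \<Gamma> i * b) ?v) \<in> line_span M l'" by simp
      qed
      finally show ?thesis .
    qed
    then have "(\<Sum>b\<in>B ?j. act M (scl \<Gamma> (u b) b) ?v) \<in> line_span M l'" by (rule L(3))
    then show ?thesis unfolding act_mult[OF M v, symmetric] u act_sum_left[OF M v] .
  qed
  \<comment> \<open>Sublists are quantified because the induction shortens the list, while
    \<open>gen\<close> refers to generators from the original \<open>l\<close>.\<close>
  have "act M a v \<in> line_span M l'" if a: "a \<in> deg \<Gamma> 1" and "set l0 \<subseteq> set l" "v \<in> line_span M l0" for a v l0
    using that(2,3)
  proof (induction l0 arbitrary: v)
    case Nil then show ?case using L(1) act_zero_right[OF M] by simp
  next
    case (Cons p l0)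
    then obtain c r where r: "v = act M (scl \<Gamma> c (idem \<Gamma> (fst p))) (snd p) + r" "r \<in> line_span M l0" by auto
    have "snd ` set l0 \<subseteq> mcar M" and p: "snd p \<in> mcar M" using Cons.prems(1) l by auto
    then have "r \<in> mcar M" using line_span_mcar[OF M] r(2) by blast
    then have "act M a v = act M a (act M (scl \<Gamma> c (idem \<Gamma> (fst p))) (snd p)) + act M a r"
      unfolding r(1) by (rule act_add_right[OF M act_mcar[OF M p]])
    then show ?case using L(2) gen[OF a, of p c] Cons.IH[of r] Cons.prems(1) r(2) by simp
  qed
  then show ?thesis using sub by blast
qed

lemma line_span_fin_generated:
  assumes M: "gmodule \<Gamma> M" and gen: "generated_in_degree M t"
    and l: "snd ` set l \<subseteq> mcar M" and sub: "mdeg M t \<subseteq> line_span M l"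
  shows "fin_generated M"
proof -
  let ?B = "snd ` set l"
  have B: "finite ?B" by simp
  note C = combinations_zero[OF M B l] combinations_add[OF M B l] combinations_act[OF M B l]
    combinations_base[OF M B l]
  have "line_span M l0 \<subseteq> combinations M ?B" if "set l0 \<subseteq> set l" for l0
    using that by (induction l0) (auto intro: C)
  then have "mdeg M t \<subseteq> combinations M ?B" using sub by blast
  then have "mcar M \<subseteq> combinations M ?B"
    unfolding gen[unfolded generated_in_degree_def] by (intro add_span_subset) (auto intro: C)
  then show ?thesis unfolding fin_generated_iff using B l by blast
qed

section \<open>Unpacking the Koszul complex\<close>

lemma exact_from_degrees:
  assumes f: "ghom L M f" and g: "ghom M N g"
    and hom: "\<And>r x. x \<in> mdeg M r \<Longrightarrow> g x = 0 \<Longrightarrow> x \<in> f ` mdeg L r"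
    and x: "x \<in> mcar M" "g x = 0"
  shows "x \<in> f ` mcar L"
proof -
  note M = ghom_gmodule(1)[OF g] and L = ghom_gmodule(1)[OF f]
  have "\<exists>y\<in>mdeg L r. f y = hcomp (mdeg M) x r" for r
    using hom[OF comp_mdeg[OF M x(1)], of r] ghom_hcomp[OF g x(1)] x(2) comp_zero[OF ghom_gmodule(2)[OF g]]
    by force
  then obtain y where y: "\<And>r. y r \<in> mdeg L r" "\<And>r. f (y r) = hcomp (mdeg M) x r" by metis
  have "f (\<Sum>r | hcomp (mdeg M) x r \<noteq> 0. y r) = (\<Sum>r | hcomp (mdeg M) x r \<noteq> 0. hcomp (mdeg M) x r)"
    by (subst ghom_sum[OF f]) (simp_all add: mdeg_mcar[OF L y(1)] y(2))
  then have "f (\<Sum>r | hcomp (mdeg M) x r \<noteq> 0. y r) = x" unfolding comp_sum[OF M x(1), symmetric] .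
  moreover have "(\<Sum>r | hcomp (mdeg M) x r \<noteq> 0. y r) \<in> mcar L" by (intro mcar_sum[OF L] mdeg_mcar[OF L y(1)])
  ultimately show ?thesis by (metis image_eqI)
qed

lemma ghom_zero_from_degrees:
  assumes f: "ghom M N f" and hom: "\<And>t x. x \<in> mdeg M t \<Longrightarrow> f x = 0" and x: "x \<in> mcar M"
  shows "f x = 0"
  using ghom_gmodule(1)[OF f] x
  by (induction rule: mcar_induct)
    (simp_all add: ghom_zero[OF f] hom ghom_add[OF f] mdeg_mcar[OF ghom_gmodule(1)[OF f]])

text \<open>The last two clauses say that the augmentation and the differentials are injective on
  the generating degrees: a kernel element there is a boundary, and boundaries vanish because the
  next term starts one degree higher.\<close>

lemma koszul_data:
  assumes "pq_koszul \<Gamma> q (enat (n + 1))" "q \<ge> 2"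
  shows "\<exists>K d \<epsilon>. (\<forall>t. gr_projective \<Gamma> (K t) \<and> generated_in_degree (K t) (int t)) \<and>
    (\<forall>t. ghom (K (Suc t)) (K t) (d (Suc t))) \<and> ghom (K 0) (simple_mod \<Gamma> i) \<epsilon> \<and>
    \<epsilon> ` mcar (K 0) = mcar (simple_mod \<Gamma> i) \<and>
    (\<forall>y\<in>mcar (K 1). \<epsilon> (d 1 y) = 0) \<and> (\<forall>x\<in>mcar (K 0). \<epsilon> x = 0 \<longrightarrow> x \<in> d 1 ` mcar (K 1)) \<and>
    (\<forall>t. \<forall>y\<in>mcar (K (Suc (Suc t))). d (Suc t) (d (Suc (Suc t)) y) = 0) \<and>
    (\<forall>t<n. \<forall>x\<in>mcar (K (Suc t)). d (Suc t) x = 0 \<longrightarrow> x \<in> d (Suc (Suc t)) ` mcar (K (Suc (Suc t)))) \<and>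
    (\<forall>x\<in>mdeg (K 0) 0. \<epsilon> x = 0 \<longrightarrow> x = 0) \<and>
    (\<forall>t\<le>n. \<forall>x\<in>mdeg (K (Suc t)) (int (Suc t)). d (Suc t) x = 0 \<longrightarrow> x = 0)"
proof -
  let ?S = "simple_mod \<Gamma> i"
  have "\<forall>i. \<exists>(P :: nat \<Rightarrow> 'a umod) d.
        (\<forall>t. gr_projective \<Gamma> (P t) \<and> generated_in_degree (P t) (int t)) \<and>
        (\<forall>t. enat (n + 1) < enat t \<longrightarrow> mcar (P t) = {0}) \<and>
        (\<forall>t. gr_hom (P (Suc t)) (P t) (d (Suc t))) \<and>
        (\<forall>t. \<forall>x \<in> mcar (P (Suc (Suc t))). d (Suc t) (d (Suc (Suc t)) x) = 0) \<and>
        (\<exists>\<epsilon>. gr_hom (P 0) (simple_mod \<Gamma> i) \<epsilon> \<and>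
             \<epsilon> ` mcar (P 0) = mcar (simple_mod \<Gamma> i) \<and>
             {x \<in> cycles P d 0 0. \<epsilon> x = 0} = boundaries P d 0 0) \<and>
        (\<forall>t r. (t, r) \<noteq> (0, 0) \<and> \<not> (\<exists>p'. q = enat p' \<and> enat (n + 1) = enat t \<and> r = int (p' + t))
               \<longrightarrow> cycles P d t r = boundaries P d t r) \<and>
        (\<forall>p' q'. q = enat p' \<and> enat (n + 1) = enat q' \<longrightarrow>
           cycles P d q' (int (p' + q')) = {0} \<or>
           is_tensor_over_degree0 \<Gamma> (P q') (deg \<Gamma> p') (mdeg (P q') (int q'))
             (cycles P d q' (int (p' + q'))))"
    using assms(1) unfolding pq_koszul_def by (rule conjunct2)
  from spec[OF this, of i] obtain K d \<epsilon> where
    proj: "\<forall>t. gr_projective \<Gamma> (K t) \<and> generated_in_degree (K t) (int t)" and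
    hom: "\<forall>t. gr_hom (K (Suc t)) (K t) (d (Suc t))" and
    cplx: "\<forall>t. \<forall>x \<in> mcar (K (Suc (Suc t))). d (Suc t) (d (Suc (Suc t)) x) = 0" and
    aug: "gr_hom (K 0) ?S \<epsilon>" and surj: "\<epsilon> ` mcar (K 0) = mcar ?S" and
    ex0: "{x \<in> cycles K d 0 0. \<epsilon> x = 0} = boundaries K d 0 0" and
    ex: "\<forall>t r. (t, r) \<noteq> (0, 0) \<and> \<not> (\<exists>p'. q = enat p' \<and> enat (n + 1) = enat t \<and> r = int (p' + t))
               \<longrightarrow> cycles K d t r = boundaries K d t r"
    by (elim exE conjE) blast
  have gm: "gmodule \<Gamma> (K t)" for t using proj projective_gmodule by blast
  have h: "ghom (K (Suc t)) (K t) (d (Suc t))" for t using hom gm unfolding ghom_def by blast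
  have e: "ghom (K 0) ?S \<epsilon>" using aug gm simple_gmodule unfolding ghom_def by blast
  have low: "mdeg (K t) r = {0}" if "r < int t" for t r
    using generated_in_degree_mdeg(1)[OF gm] proj that by blast
  have ex': "x \<in> d (Suc t) ` mdeg (K (Suc t)) r"
    if "x \<in> mdeg (K t) r" "t = 0 \<or> d t x = 0" "(t, r) \<noteq> (0, 0)" "t \<noteq> n + 1 \<or> r = int t" for x t r
  proof -
    \<comment> \<open>The exceptional homology sits at place \<open>n + 1\<close> in degree
      \<open>p' + n + 1\<close> with \<open>p' = q\<close>, and \<open>q \<ge> 2\<close> keeps it
      out of degree \<open>n + 1\<close>.\<close>
    have "\<not> (\<exists>p'. q = enat p' \<and> enat (n + 1) = enat t \<and> r = int (p' + t))"
      using that(4) assms(2) by (auto simp: numeral_eq_enat)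
    then have "cycles K d t r = boundaries K d t r" using ex that(3) by blast
    then show ?thesis using that(1,2) unfolding cycles_def boundaries_def by blast
  qed
  have ex0': "x \<in> d 1 ` mdeg (K 1) 0" if "x \<in> mdeg (K 0) 0" "\<epsilon> x = 0" for x
    using ex0 that unfolding cycles_def boundaries_def by auto
  have hz: "d (Suc t) 0 = 0" for t using ghom_zero[OF h] .
  \<comment> \<open>In degree 0 this is part of the homology condition; in the other degrees the
    simple module is zero.\<close>
  have "\<epsilon> (d 1 y) = 0" if y: "y \<in> mcar (K 1)" for y
  proof (rule ghom_zero_from_degrees[where f = "\<lambda>y. \<epsilon> (d 1 y)", rotated 2, OF y])
    show c: "ghom (K 1) ?S (\<lambda>y. \<epsilon> (d 1 y))" using ghom_comp[OF h[of 0] e] by simp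
    fix t x assume x: "x \<in> mdeg (K 1) t"
    show "\<epsilon> (d 1 x) = 0"
    proof (cases "t = 0")
      case True
      then have "d 1 x \<in> {x \<in> cycles K d 0 0. \<epsilon> x = 0}" using x unfolding ex0 boundaries_def by auto
      then show ?thesis by blast
    next
      case False then show ?thesis using ghom_mdeg[OF c x] by (simp add: simple_mdeg)
    qed
  qed
  moreover have "x \<in> d 1 ` mcar (K 1)" if x: "x \<in> mcar (K 0)" "\<epsilon> x = 0" for x
  proof -
    have h0: "ghom (K 1) (K 0) (d 1)" using h[of 0] by simp
    have hom: "x \<in> d 1 ` mdeg (K 1) r" if "x \<in> mdeg (K 0) r" "\<epsilon> x = 0" for r x
      using ex'[of x 0 r] ex0'[of x] that by (cases "r = 0") auto
    show ?thesis by (rule exact_from_degrees[OF h0 e]) (fact hom x)+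
  qed
  moreover have "x \<in> d (Suc (Suc t)) ` mcar (K (Suc (Suc t)))"
    if t: "t < n" and x: "x \<in> mcar (K (Suc t))" "d (Suc t) x = 0" for t x
  proof -
    have hom: "x \<in> d (Suc (Suc t)) ` mdeg (K (Suc (Suc t))) r"
      if "x \<in> mdeg (K (Suc t)) r" "d (Suc t) x = 0" for r x
      by (rule ex') (use t that in auto)
    show ?thesis by (rule exact_from_degrees[OF h h]) (fact hom x)+
  qed
  moreover have "x = 0" if "x \<in> mdeg (K 0) 0" "\<epsilon> x = 0" for x
    using ex0'[OF that] low[of 0 1] hz[of 0] by auto
  moreover have "x = 0" if "t \<le> n" "x \<in> mdeg (K (Suc t)) (int (Suc t))" "d (Suc t) x = 0" for t x
    using ex'[of x "Suc t" "int (Suc t)"] that low[of "int (Suc t)" "Suc (Suc t)"] hz by auto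
  ultimately show ?thesis using proj h e surj cplx by (intro exI[of _ K] exI[of _ d] exI[of _ \<epsilon>] conjI) auto
qed

section \<open>Maps into the regular module\<close>

lemma ghom_from_shift:
  assumes "ghom (shift M r) N g" shows "ghom M (shift N (- r)) g"
  using ghom_shift[OF assms, of "- r"] by (simp add: shift_shift shift_zero)

lemma gr_hom_ghom: "gr_hom M N g \<Longrightarrow> gmodule \<Gamma> M \<Longrightarrow> gmodule \<Gamma> N \<Longrightarrow> ghom M N g"
  unfolding ghom_def by simp

lemma ghom_mult_right:
  assumes u: "ghom M (regular_mod \<Gamma>) u" and a: "a \<in> deg \<Gamma> 0"
  shows "ghom M (regular_mod \<Gamma>) (\<lambda>x. u x * a)"
proof -
  have "a \<in> mdeg (regular_mod \<Gamma>) 0" using a by (simp add: regular_mdeg)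
  from ghom_comp[OF u ghom_from_regular[OF regular_gmodule this]] show ?thesis
    by (simp add: shift_zero)
qed

lemma radical_shift: "gmodule \<Gamma> M \<Longrightarrow> graded_radical \<Gamma> (shift M r) = graded_radical \<Gamma> M"
  unfolding graded_radical_def by (simp add: mcar_shift)

section \<open>The zero object and free objects of the category\<close>

lemma zero_mod_gmodule: "gmodule \<Gamma> (zero_mod :: ('a, 'm::ab_group_add) gmod)"
  and mcar_zero_mod: "mcar (zero_mod :: ('a, 'm::ab_group_add) gmod) = {0}"
proof -
  interpret graded_group "mdeg (zero_mod :: ('a, 'm) gmod)" by unfold_locales (simp_all add: zero_mod_def)
  have "x = 0" if "x \<in> mcar (zero_mod :: ('a, 'm) gmod)" for x
    using that unfolding mcar_def by (induction rule: family_sum_induct) (simp_all add: zero_mod_def)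
  then show car: "mcar (zero_mod :: ('a, 'm) gmod) = {0}" using family_sum_zero unfolding mcar_def by blast
  have "family_indep (mdeg (zero_mod :: ('a, 'm) gmod))" unfolding family_indep_def by (simp add: zero_mod_def)
  then show "gmodule \<Gamma> (zero_mod :: ('a, 'm) gmod)"
    unfolding gmodule_def car by (auto simp: zero_mod_def)
qed

lemma zero_mod_in_add: "in_add \<Gamma> zero_mod"
proof -
  have "gr_projective \<Gamma> (zero_mod :: 'a umod)"
    unfolding gr_projective_def
  proof (intro conjI allI impI zero_mod_gmodule, elim conjE)
    fix M N :: "'a umod" and g h :: "(nat \<Rightarrow> 'a) \<Rightarrow> nat \<Rightarrow> 'a"
    assume M: "gmodule \<Gamma> M" and N: "gmodule \<Gamma> N" and g: "gr_hom M N g" and h: "gr_hom zero_mod N h"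
    have "g 0 = h 0"
      using ghom_zero[OF gr_hom_ghom[OF g M N]] ghom_zero[OF gr_hom_ghom[OF h zero_mod_gmodule N]] by simp
    then have "\<forall>x\<in>mcar (zero_mod :: 'a umod). g 0 = h x" unfolding mcar_zero_mod by simp
    moreover have "gr_hom zero_mod M (\<lambda>_. 0)" by (rule ghom_gr_hom[OF ghom_zero_map[OF zero_mod_gmodule M]])
    ultimately show "\<exists>k. gr_hom zero_mod M k \<and> (\<forall>x\<in>mcar (zero_mod :: 'a umod). g (k x) = h x)"
      by (intro exI[of _ "\<lambda>_. 0"] conjI)
  qed
  moreover have "fin_generated (zero_mod :: 'a umod)"
    unfolding fin_generated_def mcar_zero_mod by (intro exI[of _ "{}"]) simp
  ultimately show ?thesis unfolding in_add_def by blast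
qed

lemma in_add_gmodule: "in_add \<Gamma> X \<Longrightarrow> gmodule \<Gamma> X"
  unfolding in_add_def using projective_gmodule by blast

lemma radical_map_zero: "gmodule \<Gamma> X \<Longrightarrow> gmodule \<Gamma> Y \<Longrightarrow> radical_map X Y (\<lambda>_. 0)"
proof -
  assume XY: "gmodule \<Gamma> X" "gmodule \<Gamma> Y"
  show ?thesis
    unfolding radical_map_iff[OF ghom_zero_map[OF XY]]
    by (auto simp: ghom_zero bij_betw_def)
qed

text \<open>The module \<open>\<Gamma>E[-l]\<close> for an idempotent \<open>E\<close> that is a sum of vertices, as an object of the
  category: homomorphisms into it are the homomorphisms of degree \<open>l\<close> to \<open>\<Gamma>\<close> with values fixed by \<open>E\<close>.\<close>

lemma free_object:
  assumes F: "finite F" and E: "E = (\<Sum>i\<in>F. idem \<Gamma> i)"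
  shows "\<exists>(X :: 'a umod) \<iota> \<kappa>. in_add \<Gamma> X \<and> ghom (shift X l) (regular_mod \<Gamma>) \<kappa> \<and>
    (\<forall>a. \<kappa> (\<iota> a) = a) \<and> (\<forall>x y. \<iota> (x + y) = \<iota> x + \<iota> y) \<and>
    (\<forall>(M :: 'a umod) g. gmodule \<Gamma> M \<and> ghom (shift M l) (regular_mod \<Gamma>) g \<and> (\<forall>x\<in>mcar M. g x * E = g x)
       \<longrightarrow> ghom M X (\<lambda>x. \<iota> (g x)))"
proof -
  let ?R = "regular_mod \<Gamma>"
  define G where "G = \<lparr>mdeg = \<lambda>t. {a \<in> mdeg ?R t. a * E = a}, act = act ?R\<rparr>"
  have G: "gmodule \<Gamma> G"
    unfolding G_def
    by (rule submodule_gmodule[OF regular_gmodule])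
      (use mdeg_zero[OF regular_gmodule] mdeg_diff[OF regular_gmodule] act_mdeg[OF regular_gmodule] in
       \<open>auto simp: left_diff_distrib mult.assoc\<close>)
  have GE: "a * E = a" if "a \<in> mcar G" for a
    using G that by (induction rule: mcar_induct) (auto simp: G_def distrib_right)
  have EG: "E \<in> mdeg G 0"
    unfolding G_def using idem_sum_deg0[of F] idem_sum_mult(1)[OF F subset_refl] by (simp add: E regular_mdeg)
  define \<iota> where "\<iota> = (\<lambda>(a :: 'a) j. if j = (0::nat) then a else 0)"
  define \<kappa> where "\<kappa> = (\<lambda>z :: nat \<Rightarrow> 'a. z 0)"
  have c: "coding \<iota> \<kappa>" unfolding \<iota>_def \<kappa>_def by (rule coding_first)
  then have inv: "\<kappa> (\<iota> a) = a" and add: "\<iota> (x + y) = \<iota> x + \<iota> y" for a x y unfolding coding_def by auto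
  define H where "H = shift G (- l)"
  have H: "gmodule \<Gamma> H" "mcar H = mcar G" unfolding H_def using gmodule_shift[OF G] mcar_shift[OF G] by auto
  define X where "X = transport \<iota> \<kappa> H"
  note X = ghom_transport[OF H(1) c, folded X_def] ghom_transport_inverse[OF H(1) c, folded X_def]
    mcar_transport[OF H(1) c, folded X_def]
  have Xgm: "gmodule \<Gamma> X" using ghom_gmodule X(1) by blast
  have actX: "act X a w = \<iota> (a * \<kappa> w)" for a w by (simp add: X_def transport_def H_def G_def)
  have inc: "ghom G ?R (\<lambda>a. a)"
    by (rule ghomI) (use G regular_gmodule in \<open>auto simp: G_def\<close>)
  have \<kappa>: "ghom (shift X l) ?R \<kappa>"
  proof -
    have "ghom (shift X l) (shift H l) \<kappa>" by (rule ghom_shift[OF X(2)])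
    then have "ghom (shift X l) G \<kappa>" by (simp add: H_def shift_shift shift_zero)
    from ghom_comp[OF this inc] show ?thesis .
  qed
  have into: "ghom M X (\<lambda>x. \<iota> (g x))"
    if g: "gmodule \<Gamma> M" "ghom (shift M l) ?R g" "\<And>x. x \<in> mcar M \<Longrightarrow> g x * E = g x" for M :: "'a umod" and g
  proof -
    have "ghom (shift M l) G g"
      by (rule ghomI)
        (use gmodule_shift[OF g(1)] G g(3) mdeg_mcar[OF g(1)] ghom_mdeg[OF g(2)] ghom_add[OF g(2)]
          ghom_act[OF g(2)] mcar_shift[OF g(1)] in \<open>auto simp: G_def\<close>)
    from ghom_from_shift[OF this] have "ghom M H g" by (simp add: H_def)
    from ghom_comp[OF this X(1)] show ?thesis .
  qed
  \<comment> \<open>The image of \<open>E\<close> generates \<open>X\<close>, and \<kappa> reads off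
    the coefficient of an element; maps out of \<open>X\<close> are lifted by lifting the image of
    this one generator.\<close>
  let ?e = "\<iota> E"
  have e: "?e \<in> mdeg X l" using ghom_mdeg[OF X(1), of E l] EG by (simp add: H_def)
  have xe: "act X (\<kappa> x) ?e = x" if x: "x \<in> mcar X" for x
  proof -
    obtain a where a: "a \<in> mcar G" "x = \<iota> a" using x X(3) H(2) by blast
    then show ?thesis using GE[OF a(1)] by (simp add: actX inv)
  qed
  have "gr_projective \<Gamma> X"
    unfolding gr_projective_def
  proof (intro conjI allI impI Xgm, elim conjE)
    fix M N :: "'a umod" and g h
    assume M: "gmodule \<Gamma> M" and N: "gmodule \<Gamma> N" and g': "gr_hom M N g" and surj: "g ` mcar M = mcar N"
      and h': "gr_hom X N h"
    have g: "ghom M N g" and h: "ghom X N h"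
      by (rule gr_hom_ghom[OF g' M N] gr_hom_ghom[OF h' Xgm N])+
    have he: "h ?e \<in> mdeg N l" by (rule ghom_mdeg[OF h e])
    then have "h ?e \<in> g ` mcar M" using surj mdeg_mcar[OF N] by blast
    then obtain z where z: "z \<in> mdeg M l" "h ?e = g z" using ghom_homogeneous_preimage[OF g he] by blast
    have "ghom (shift X l) (shift M l) (\<lambda>x. act M (\<kappa> x) z)" by (rule ghom_comp[OF \<kappa> ghom_from_regular[OF M z(1)]])
    from ghom_from_shift[OF this] have k: "ghom X M (\<lambda>x. act M (\<kappa> x) z)"
      by (simp add: shift_shift shift_zero)
    have "g (act M (\<kappa> x) z) = h x" if "x \<in> mcar X" for x
    proof -
      have "g (act M (\<kappa> x) z) = act N (\<kappa> x) (h ?e)"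
        using ghom_act[OF g mdeg_mcar[OF M z(1)]] z(2) by simp
      also have "\<dots> = h (act X (\<kappa> x) ?e)" using ghom_act[OF h mdeg_mcar[OF Xgm e]] by simp
      finally show ?thesis using xe[OF that] by simp
    qed
    then show "\<exists>k. gr_hom X M k \<and> (\<forall>x\<in>mcar X. g (k x) = h x)"
      using ghom_gr_hom[OF k] by (intro exI[of _ "\<lambda>x. act M (\<kappa> x) z"] conjI ballI)
  qed
  moreover have "fin_generated X"
    unfolding fin_generated_def
  proof (intro exI[of _ "{?e}"] conjI ballI)
    show "{?e} \<subseteq> mcar X" using mdeg_mcar[OF Xgm e] by simp
    fix x assume x: "x \<in> mcar X"
    show "\<exists>c. x = (\<Sum>b\<in>{?e}. act X (c b) b)" using xe[OF x] by (intro exI[of _ "\<lambda>_. \<kappa> x"]) simp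
  qed simp
  ultimately have "in_add \<Gamma> X" unfolding in_add_def by blast
  then show ?thesis
    using \<kappa> inv add into by (intro exI[of _ X] exI[of _ \<iota>] exI[of _ \<kappa>] conjI allI impI) (blast | simp)+
qed

text \<open>A common right unit for the values on finitely many generators is one for all values, as
  these are left combinations. So \<open>g\<close> takes its values in \<open>\<Gamma>E\<close> for
  a single \<open>E\<close>, as \<open>free_object\<close> demands.\<close>

lemma fin_generated_local_unit:
  assumes "fin_generated M" and g: "ghom (shift M l) (regular_mod \<Gamma>) g" and M: "gmodule \<Gamma> M"
  shows "\<exists>F. finite F \<and> (\<forall>x\<in>mcar M. g x * (\<Sum>i\<in>F. idem \<Gamma> i) = g x)"
proof -
  obtain B where B: "finite B" "B \<subseteq> mcar M" "mcar M \<subseteq> combinations M B"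
    using assms(1) unfolding fin_generated_iff by blast
  obtain F where F: "finite F" "\<forall>a\<in>g ` B. (\<Sum>i\<in>F. idem \<Gamma> i) * a = a \<and> a * (\<Sum>i\<in>F. idem \<Gamma> i) = a"
    using local_unit_finite[of "g ` B"] B(1) by blast
  have "g x * (\<Sum>i\<in>F. idem \<Gamma> i) = g x" if xM: "x \<in> mcar M" for x
  proof -
    obtain c where x: "x = (\<Sum>b\<in>B. act M (c b) b)" by (rule combinationsE[OF subsetD[OF B(3) xM]])
    have "g x = (\<Sum>b\<in>B. c b * g b)"
      unfolding x using ghom_sum[OF g, of B "\<lambda>b. act M (c b) b"] ghom_act[OF g] act_mcar[OF M] B(2) mcar_shift[OF M]
      by (simp add: subset_iff)
    then show ?thesis using F(2) by (simp add: sum_distrib_right mult.assoc)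
  qed
  then show ?thesis using F(1) by blast
qed

end

section \<open>Minimal resolutions of simple modules\<close>

text \<open>The kernel of the augmentation counts as the cycles at place 0, so that it and the
  kernels of the differentials are treated uniformly.\<close>

definition cycles_at ::
  "(nat \<Rightarrow> ('a, 'm::ab_group_add) gmod) \<Rightarrow> (nat \<Rightarrow> 'm \<Rightarrow> 'm) \<Rightarrow> ('m \<Rightarrow> 'n::zero) \<Rightarrow> nat \<Rightarrow> 'm set" where
  "cycles_at P f \<epsilon> t = {x \<in> mcar (P t). if t = 0 then \<epsilon> x = 0 else f t x = 0}"

locale minimal_res = graded_alg \<Gamma> for \<Gamma> :: "('k::field, 'v, 'a::ring) galg" +
  fixes i :: 'v and P :: "nat \<Rightarrow> 'a umod"
    and f :: "nat \<Rightarrow> (nat \<Rightarrow> 'a) \<Rightarrow> nat \<Rightarrow> 'a" and \<epsilon> :: "(nat \<Rightarrow> 'a) \<Rightarrow> 'a"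
  assumes res: "minimal_resolution \<Gamma> (simple_mod \<Gamma> i) P f \<epsilon>"
begin

abbreviation "S \<equiv> simple_mod \<Gamma> i"

lemma resolution: "proj_resolution \<Gamma> S P f \<epsilon>"
  using res unfolding minimal_resolution_def by (rule conjunct1)

lemma proj: "gr_projective \<Gamma> (P t)"
  using resolution[unfolded proj_resolution_def, THEN conjunct1] by simp

lemma gm: "gmodule \<Gamma> (P t)"
  by (rule projective_gmodule[OF proj])

lemma diff_ghom: "ghom (P (Suc t)) (P t) (f (Suc t))"
  using resolution[unfolded proj_resolution_def, THEN conjunct2, THEN conjunct1] gm
  by (simp add: ghom_def)

lemma aug_ghom: "ghom (P 0) S \<epsilon>"
  using resolution[unfolded proj_resolution_def, THEN conjunct2, THEN conjunct2, THEN conjunct1] gm simple_gmodule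
  by (simp add: ghom_def)

lemma aug_surj: "\<epsilon> ` mcar (P 0) = mcar S"
  using resolution unfolding proj_resolution_def by (elim conjE)

lemma cycles_eq: "cycles_at P f \<epsilon> t = f (Suc t) ` mcar (P (Suc t))"
proof (cases t)
  case 0
  have "{x \<in> mcar (P 0). \<epsilon> x = 0} = f 1 ` mcar (P 1)"
    using resolution unfolding proj_resolution_def by (elim conjE)
  then show ?thesis by (simp add: cycles_at_def 0)
next
  case (Suc s)
  have "{x \<in> mcar (P (Suc s)). f (Suc s) x = 0} = f (Suc (Suc s)) ` mcar (P (Suc (Suc s)))"
    using resolution[unfolded proj_resolution_def] by simp
  then show ?thesis by (simp add: cycles_at_def Suc)
qed

lemma image_mem_cycles: "x \<in> mcar (P (Suc t)) \<Longrightarrow> f (Suc t) x \<in> cycles_at P f \<epsilon> t"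
  unfolding cycles_eq by blast

lemma aug_diff: "x \<in> mcar (P 1) \<Longrightarrow> \<epsilon> (f 1 x) = 0"
  using image_mem_cycles[of x 0] by (simp add: cycles_at_def)

lemma diff_diff: "x \<in> mcar (P (Suc (Suc t))) \<Longrightarrow> f (Suc t) (f (Suc (Suc t)) x) = 0"
  using image_mem_cycles[of x "Suc t"] by (simp add: cycles_at_def)

lemma diff_radical: "x \<in> mcar (P (Suc t)) \<Longrightarrow> f (Suc t) x \<in> graded_radical \<Gamma> (P t)"
  using res[unfolded minimal_resolution_def, THEN conjunct2, THEN conjunct2] by blast

lemma cycles_radical: "cycles_at P f \<epsilon> t \<subseteq> graded_radical \<Gamma> (P t)"
  unfolding cycles_eq using diff_radical by blast

text \<open>At each place both terms are projective covers of the same cycles. That cycles of the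
  Koszul complex are radical up to place \<open>n + 1\<close> is the injectivity of its
  differentials on the generating degrees.\<close>

lemma koszul_comparison:
  assumes kos: "pq_koszul \<Gamma> q (enat (n + 1))" "q \<ge> 2" and t: "t \<le> n + 1"
  shows "\<exists>K :: 'a umod. gmodule \<Gamma> K \<and> generated_in_degree K (int t) \<and> fin_generated K \<and>
    (\<exists>\<theta>. ghom (P t) K \<theta> \<and> bij_betw \<theta> (mcar (P t)) (mcar K))"
proof -
  obtain K :: "nat \<Rightarrow> 'a umod" and d and e where
    K: "\<forall>t. gr_projective \<Gamma> (K t) \<and> generated_in_degree (K t) (int t)" and
    d: "\<forall>t. ghom (K (Suc t)) (K t) (d (Suc t))" and e: "ghom (K 0) S e" and
    e_surj: "e ` mcar (K 0) = mcar S" and ed: "\<forall>y\<in>mcar (K 1). e (d 1 y) = 0" and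
    ex0: "\<forall>x\<in>mcar (K 0). e x = 0 \<longrightarrow> x \<in> d 1 ` mcar (K 1)" and
    dd: "\<forall>t. \<forall>y\<in>mcar (K (Suc (Suc t))). d (Suc t) (d (Suc (Suc t)) y) = 0" and
    ex: "\<forall>t<n. \<forall>x\<in>mcar (K (Suc t)). d (Suc t) x = 0 \<longrightarrow> x \<in> d (Suc (Suc t)) ` mcar (K (Suc (Suc t)))" and
    low0: "\<forall>x\<in>mdeg (K 0) 0. e x = 0 \<longrightarrow> x = 0" and
    low: "\<forall>t\<le>n. \<forall>x\<in>mdeg (K (Suc t)) (int (Suc t)). d (Suc t) x = 0 \<longrightarrow> x = 0"
    using koszul_data[OF kos, of i] by (elim exE conjE)
  have Kp: "gr_projective \<Gamma> (K t)" and Kgen: "generated_in_degree (K t) (int t)"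
    and Kgm: "gmodule \<Gamma> (K t)" and dh: "ghom (K (Suc t)) (K t) (d (Suc t))" for t
    using K d projective_gmodule by blast+
  have bb: "bounded_below (K t)" for t
    unfolding bounded_below_def using generated_in_degree_mdeg(1)[OF Kgm Kgen] by blast
  have im_cyc: "d (Suc t) y \<in> cycles_at K d e t" if "y \<in> mcar (K (Suc t))" for t y
    using that ed dd ghom_mcar[OF dh] by (cases t) (auto simp: cycles_at_def)
  have cyc: "x \<in> d (Suc t) ` mcar (K (Suc t))" if "x \<in> cycles_at K d e t" "t \<le> n" for t x
    using that ex0 ex by (cases t) (auto simp: cycles_at_def)
  have rad: "x \<in> graded_radical \<Gamma> (K t)" if x: "x \<in> cycles_at K d e t" and t: "t \<le> n + 1" for t x
  proof (rule generated_in_degree_radical[OF Kgm Kgen])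
    show xc: "x \<in> mcar (K t)" using x by (simp add: cycles_at_def)
    let ?x = "hcomp (mdeg (K t)) x (int t)"
    have m: "?x \<in> mdeg (K t) (int t)" by (rule comp_mdeg[OF Kgm xc])
    show "?x = 0"
    proof (cases t)
      case 0
      then have "e ?x = 0"
        using ghom_hcomp[of "K 0" S e x 0] e xc x comp_zero[OF simple_gmodule] by (simp add: cycles_at_def)
      then show ?thesis using low0 m 0 by simp
    next
      case (Suc s)
      then have "d (Suc s) ?x = 0"
        using ghom_hcomp[OF dh[of s], of x "int (Suc s)"] xc x comp_zero[OF Kgm] by (simp add: cycles_at_def)
      then show ?thesis using low m Suc t by simp
    qed
  qed
  \<comment> \<open>Matching cycles with cycles allows the next map to be lifted through the Koszul
    differential and shows that the lift covers the same image.\<close>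
  have main: "\<exists>\<theta>. ghom (P t) (K t) \<theta> \<and> bij_betw \<theta> (mcar (P t)) (mcar (K t)) \<and>
      (\<forall>x\<in>mcar (P t). \<theta> x \<in> cycles_at K d e t \<longleftrightarrow> x \<in> cycles_at P f \<epsilon> t)" if "t \<le> n + 1" for t
    using that
  proof (induction t)
    case 0
    have "\<epsilon> ` mcar (P 0) \<subseteq> e ` mcar (K 0)" using aug_surj e_surj by simp
    then obtain \<theta> where \<theta>: "ghom (P 0) (K 0) \<theta>" "\<And>x. x \<in> mcar (P 0) \<Longrightarrow> e (\<theta> x) = \<epsilon> x"
      using projective_lift[OF proj e aug_ghom _ coding_id coding_first] by blast
    have "bij_betw \<theta> (mcar (P 0)) (mcar (K 0))"
    proof (rule projective_cover_iso[OF proj Kp bb aug_ghom e ghom_id[OF simple_gmodule] _ \<theta>(1) _ _ _ _ coding_first])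
      show "e ` mcar (K 0) \<subseteq> (\<lambda>x. \<epsilon> x) ` mcar (P 0)" using aug_surj e_surj by simp
      show "x \<in> graded_radical \<Gamma> (P 0)" if "x \<in> mcar (P 0)" "\<epsilon> x = 0" for x
        using cycles_radical[of 0] that by (auto simp: cycles_at_def)
      show "x \<in> graded_radical \<Gamma> (K 0)" if "x \<in> mcar (K 0)" "e x = 0" for x
        using rad[of x 0] that by (simp add: cycles_at_def)
      show "e (\<theta> x) = \<epsilon> x" if "x \<in> mcar (P 0)" for x by (rule \<theta>(2)[OF that])
      show "inj_on (\<lambda>x. x) (mcar S)" by simp
    qed
    then show ?case using \<theta> ghom_mcar[OF \<theta>(1)] by (auto simp: cycles_at_def)
  next
    case (Suc t)
    then obtain \<theta> where \<theta>: "ghom (P t) (K t) \<theta>" "bij_betw \<theta> (mcar (P t)) (mcar (K t))"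
      "\<And>x. x \<in> mcar (P t) \<Longrightarrow> \<theta> x \<in> cycles_at K d e t \<longleftrightarrow> x \<in> cycles_at P f \<epsilon> t" by auto
    have h: "ghom (P (Suc t)) (K t) (\<lambda>x. \<theta> (f (Suc t) x))" by (rule ghom_comp[OF diff_ghom \<theta>(1)])
    have "\<theta> (f (Suc t) x) \<in> d (Suc t) ` mcar (K (Suc t))" if x: "x \<in> mcar (P (Suc t))" for x
      using cyc[of _ t] \<theta>(3)[OF ghom_mcar[OF diff_ghom x]] image_mem_cycles[OF x] Suc.prems by auto
    then have "(\<lambda>x. \<theta> (f (Suc t) x)) ` mcar (P (Suc t)) \<subseteq> d (Suc t) ` mcar (K (Suc t))" by blast
    then obtain \<phi> where \<phi>: "ghom (P (Suc t)) (K (Suc t)) \<phi>"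
      "\<And>x. x \<in> mcar (P (Suc t)) \<Longrightarrow> d (Suc t) (\<phi> x) = \<theta> (f (Suc t) x)"
      using projective_lift[OF proj dh h _ coding_id coding_id] by blast
    have inj: "inj_on \<theta> (mcar (P t))" using \<theta>(2) by (rule bij_betw_imp_inj_on)
    have "bij_betw \<phi> (mcar (P (Suc t))) (mcar (K (Suc t)))"
    proof (rule projective_cover_iso[OF proj Kp bb diff_ghom dh \<theta>(1) inj \<phi>(1) _ _ _ _ coding_id])
      show "d (Suc t) (\<phi> x) = \<theta> (f (Suc t) x)" if "x \<in> mcar (P (Suc t))" for x by (rule \<phi>(2)[OF that])
      show "d (Suc t) ` mcar (K (Suc t)) \<subseteq> (\<lambda>x. \<theta> (f (Suc t) x)) ` mcar (P (Suc t))"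
      proof
        fix y assume "y \<in> d (Suc t) ` mcar (K (Suc t))"
        then have y: "y \<in> cycles_at K d e t" using im_cyc by blast
        then have "y \<in> mcar (K t)" by (simp add: cycles_at_def)
        then obtain x where x: "x \<in> mcar (P t)" "y = \<theta> x" using \<theta>(2) unfolding bij_betw_def by blast
        then have "x \<in> cycles_at P f \<epsilon> t" using \<theta>(3) y by simp
        then show "y \<in> (\<lambda>x. \<theta> (f (Suc t) x)) ` mcar (P (Suc t))" unfolding cycles_eq using x by blast
      qed
      show "x \<in> graded_radical \<Gamma> (P (Suc t))" if "x \<in> mcar (P (Suc t))" "f (Suc t) x = 0" for x
        using cycles_radical[of "Suc t"] that by (auto simp: cycles_at_def)
      show "x \<in> graded_radical \<Gamma> (K (Suc t))" if "x \<in> mcar (K (Suc t))" "d (Suc t) x = 0" for x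
        using rad[of x "Suc t"] that Suc.prems by (simp add: cycles_at_def)
    qed
    moreover have "\<theta> (f (Suc t) x) = 0 \<longleftrightarrow> f (Suc t) x = 0" if "x \<in> mcar (P (Suc t))" for x
      using inj_onD[OF inj, of "f (Suc t) x" 0] ghom_mcar[OF diff_ghom that] mcar_zero[OF gm]
        ghom_zero[OF \<theta>(1)] by auto
    ultimately show ?case using \<phi> ghom_mcar[OF \<phi>(1)] by (intro exI[of _ \<phi>]) (simp add: cycles_at_def)
  qed
  \<comment> \<open>Only the generating degree of \<open>K t\<close> has to be controlled; the
    induction starts from the simple module, spanned by one idempotent.\<close>
  have fin: "\<exists>l. snd ` set l \<subseteq> mdeg (K t) (int t) \<and> mdeg (K t) (int t) \<subseteq> line_span (K t) l"
    if "t \<le> n + 1" for t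
    using that
  proof (induction t)
    case 0
    show ?case
    proof (rule line_span_pullback[OF e, where l = "[(i, idem \<Gamma> i)]"])
      have "\<exists>c. idem \<Gamma> i = scl \<Gamma> c (idem \<Gamma> i)" by (rule exI[of _ 1]) simp
      then show sub: "snd ` set [(i, idem \<Gamma> i)] \<subseteq> mcar S" unfolding mcar_simple by simp
      have "scl \<Gamma> c (idem \<Gamma> i) \<in> line_span S [(i, idem \<Gamma> i)]" for c
        using line_span_base[OF simple_gmodule sub, of "(i, idem \<Gamma> i)" c]
        by (simp add: simple_act degree0_part_deg[OF idem_deg0(2)] scl_left[symmetric] idem_mult)
      then show "e ` mdeg (K 0) (int 0) \<subseteq> line_span S [(i, idem \<Gamma> i)]"
        using ghom_mdeg[OF e, of _ 0] by (force simp: simple_mdeg simp del: line_span.simps)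
      show "mdeg (K 0) (int 0) \<subseteq> mcar (K 0)" using mdeg_mcar[OF Kgm] by blast
      show "act (K 0) (scl \<Gamma> c (idem \<Gamma> j)) x \<in> mdeg (K 0) (int 0)" if "x \<in> mdeg (K 0) (int 0)" for x c j
        using act_mdeg[OF Kgm idem_deg0(2) that] by simp
      show "x = 0" if "x \<in> mdeg (K 0) (int 0)" "e x = 0" for x using low0 that by simp
    qed (fact mdeg_zero[OF Kgm] mdeg_diff[OF Kgm])+
  next
    case (Suc t)
    then obtain l where l: "snd ` set l \<subseteq> mdeg (K t) (int t)" "mdeg (K t) (int t) \<subseteq> line_span (K t) l" by auto
    have "snd ` set l \<subseteq> mcar (K t)" using l mdeg_mcar[OF Kgm] by blast
    from line_span_arrows[OF Kgm this] obtain l' where l': "snd ` set l' \<subseteq> mcar (K t)"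
      "\<forall>a\<in>deg \<Gamma> 1. \<forall>v\<in>line_span (K t) l. act (K t) a v \<in> line_span (K t) l'" by (elim exE conjE)
    have "mdeg (K t) (int (Suc t)) \<subseteq> add_span {act (K t) a v | a v. a \<in> deg \<Gamma> 1 \<and> v \<in> mdeg (K t) (int t)}"
    proof -
      have "int (Suc t) = int t + int 1" by simp
      then show ?thesis using generated_in_degree_mdeg(2)[OF Kgm Kgen, of t 1] by metis
    qed
    also have "\<dots> \<subseteq> line_span (K t) l'"
    proof (rule add_span_subset)
      show "{act (K t) a v | a v. a \<in> deg \<Gamma> 1 \<and> v \<in> mdeg (K t) (int t)} \<subseteq> line_span (K t) l'"
        using l'(2) subsetD[OF l(2)] by blast
    qed (fact line_span_zero[OF Kgm l'(1)] line_span_add[OF Kgm l'(1)])+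
    finally have sub: "mdeg (K t) (int (Suc t)) \<subseteq> line_span (K t) l'" .
    show ?case
    proof (rule line_span_pullback[OF dh l'(1)])
      show "d (Suc t) ` mdeg (K (Suc t)) (int (Suc t)) \<subseteq> line_span (K t) l'"
        using ghom_mdeg[OF dh] sub by blast
      show "mdeg (K (Suc t)) (int (Suc t)) \<subseteq> mcar (K (Suc t))" using mdeg_mcar[OF Kgm] by blast
      show "act (K (Suc t)) (scl \<Gamma> c (idem \<Gamma> j)) x \<in> mdeg (K (Suc t)) (int (Suc t))"
        if "x \<in> mdeg (K (Suc t)) (int (Suc t))" for x c j
        using act_mdeg[OF Kgm idem_deg0(2) that] by simp
      show "x = 0" if "x \<in> mdeg (K (Suc t)) (int (Suc t))" "d (Suc t) x = 0" for x
        using low[rule_format, of t x] Suc.prems that by simp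
    qed (fact mdeg_zero[OF Kgm] mdeg_diff[OF Kgm])+
  qed
  obtain l where "snd ` set l \<subseteq> mdeg (K t) (int t)" "mdeg (K t) (int t) \<subseteq> line_span (K t) l"
    using fin[OF t] by blast
  moreover from this have "snd ` set l \<subseteq> mcar (K t)" using mdeg_mcar[OF Kgm] by blast
  ultimately have "fin_generated (K t)" by (intro line_span_fin_generated[OF Kgm Kgen])
  moreover obtain \<theta> where "ghom (P t) (K t) \<theta>" "bij_betw \<theta> (mcar (P t)) (mcar (K t))"
    using main[OF t] by (elim exE conjE)
  ultimately show ?thesis using Kgm[of t] Kgen[of t] by (intro exI[of _ "K t"] conjI exI[of _ \<theta>])
qed

lemma
  assumes kos: "pq_koszul \<Gamma> q (enat (n + 1))" "q \<ge> 2" and t: "t \<le> n + 1"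
  shows koszul_fin_generated: "fin_generated (P t)" and koszul_bounded_below: "bounded_below (P t)"
proof -
  obtain K :: "'a umod" and \<theta> where K: "gmodule \<Gamma> K" "generated_in_degree K (int t)" "fin_generated K"
    and \<theta>: "ghom (P t) K \<theta>" and bij: "bij_betw \<theta> (mcar (P t)) (mcar K)"
    using koszul_comparison[OF assms] by (elim exE conjE) (rule that)
  let ?\<theta> = "inv_into (mcar (P t)) \<theta>"
  have inv: "?\<theta> (\<theta> x) = x" if "x \<in> mcar (P t)" for x
    by (rule inv_into_f_f[OF bij_betw_imp_inj_on[OF bij] that])
  have g: "ghom K (P t) ?\<theta>" by (rule ghom_inverse[OF \<theta> bij]) (rule inv)
  have "?\<theta> ` mcar K = mcar (P t)" using bij_betw_inv_into[OF bij] unfolding bij_betw_def by blast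
  from fin_generated_image[OF g this K(3)] show "fin_generated (P t)" .
  have "mdeg (P t) r = {0}" if "r < int t" for r
  proof -
    have "x = 0" if x: "x \<in> mdeg (P t) r" for x
    proof -
      have "\<theta> x = 0" using ghom_mdeg[OF \<theta> x] generated_in_degree_mdeg(1)[OF K(1,2) \<open>r < int t\<close>] by simp
      then show ?thesis using inv[OF mdeg_mcar[OF gm x]] ghom_zero[OF g] by simp
    qed
    then show ?thesis using mdeg_zero[OF gm] by blast
  qed
  then show "bounded_below (P t)" unfolding bounded_below_def by blast
qed

section \<open>Source sequences from exactness\<close>

lemma coboundaryI:
  assumes "ghom (shift (P (Suc t)) r) (regular_mod \<Gamma>) g" "ghom (shift (P t) r) (regular_mod \<Gamma>) h"
    "\<And>x. x \<in> mcar (P (Suc t)) \<Longrightarrow> g x = h (f (Suc t) x)"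
  shows "g \<in> ext_coboundaries \<Gamma> P f (Suc t) r"
  using assms unfolding ext_coboundaries_def ghom_def by auto

lemma coboundaryE:
  assumes "g \<in> ext_coboundaries \<Gamma> P f (Suc t) r"
  obtains h where "ghom (shift (P t) r) (regular_mod \<Gamma>) h"
    "\<And>x. x \<in> mcar (P (Suc t)) \<Longrightarrow> g x = h (f (Suc t) x)"
  using assms gmodule_shift[OF gm] regular_gmodule unfolding ext_coboundaries_def ghom_def by auto

lemma cocycle_iff:
  "g \<in> ext_cocycles \<Gamma> P f t r \<longleftrightarrow> ghom (shift (P t) r) (regular_mod \<Gamma>) g \<and>
    (\<forall>x\<in>mcar (P (Suc t)). g (f (Suc t) x) = 0)"
  using gmodule_shift[OF gm] regular_gmodule unfolding ext_cocycles_def ghom_def by auto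

lemma cocycle_compose:
  assumes g: "ghom (P t) X g" "\<And>x. x \<in> mcar (P (Suc t)) \<Longrightarrow> g (f (Suc t) x) = 0"
    and \<pi>: "ghom (shift X r) (regular_mod \<Gamma>) \<pi>"
  shows "(\<lambda>x. \<pi> (g x)) \<in> ext_cocycles \<Gamma> P f t r"
  unfolding cocycle_iff using ghom_comp[OF ghom_shift[OF g(1)] \<pi>] g(2) ghom_zero[OF \<pi>] by simp

text \<open>A dual basis turns a map into \<open>X\<close> into a tuple of coordinates in the
  algebra, which are extended separately and recombined. The coordinates have different degrees,
  which is why the condition ranges over all shifts \<open>r\<close>.\<close>

lemma extend_along_diff:
  assumes X: "in_add \<Gamma> X" and g: "ghom (P (Suc t)) X g"
    and cob: "\<And>r \<pi>. ghom (shift X r) (regular_mod \<Gamma>) \<pi>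
      \<Longrightarrow> (\<lambda>x. \<pi> (g x)) \<in> ext_coboundaries \<Gamma> P f (Suc t) r"
  shows "\<exists>h. ghom (P t) X h \<and> (\<forall>x\<in>mcar (P (Suc t)). g x = h (f (Suc t) x))"
proof -
  note Xgm = in_add_gmodule[OF X]
  obtain m :: nat and s x \<pi> where x: "\<forall>k<m. x k \<in> mdeg X (s k)"
    and \<pi>: "\<forall>k. ghom (shift X (s k)) (regular_mod \<Gamma>) (\<pi> k)"
    and basis: "\<forall>y\<in>mcar X. y = (\<Sum>k<m. act X (\<pi> k y) (x k))"
    using dual_basis[of X] X unfolding in_add_def by (elim exE conjE) blast
  have "\<exists>h. ghom (shift (P t) (s k)) (regular_mod \<Gamma>) h \<and>
      (\<forall>y\<in>mcar (P (Suc t)). \<pi> k (g y) = h (f (Suc t) y))" for k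
    using cob[OF \<pi>[rule_format, of k]] by (rule coboundaryE) blast
  then have "\<forall>k. \<exists>h. ghom (shift (P t) (s k)) (regular_mod \<Gamma>) h \<and>
      (\<forall>y\<in>mcar (P (Suc t)). \<pi> k (g y) = h (f (Suc t) y))" by blast
  from choice[OF this] obtain h where h: "\<And>k. ghom (shift (P t) (s k)) (regular_mod \<Gamma>) (h k)"
    "\<And>k y. y \<in> mcar (P (Suc t)) \<Longrightarrow> \<pi> k (g y) = h k (f (Suc t) y)" by blast
  have "ghom (P t) X (\<lambda>y. \<Sum>k\<in>{..<m}. act X (h k y) (x k))"
  proof (rule ghom_sum_fun[OF gm Xgm])
    fix k assume "k \<in> {..<m}"
    then have xk: "x k \<in> mdeg X (s k)" using x by simp
    have "ghom (shift (P t) (s k)) (shift X (s k)) (\<lambda>y. act X (h k y) (x k))"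
      by (rule ghom_comp[OF h(1) ghom_from_regular[OF Xgm xk]])
    from ghom_from_shift[OF this] show "ghom (P t) X (\<lambda>y. act X (h k y) (x k))"
      by (simp add: shift_shift shift_zero)
  qed
  moreover have "g y = (\<Sum>k\<in>{..<m}. act X (h k (f (Suc t) y)) (x k))" if "y \<in> mcar (P (Suc t))" for y
    using basis[rule_format, OF ghom_mcar[OF g that]] h(2)[OF that] by simp
  ultimately show ?thesis by (intro exI[of _ "\<lambda>y. \<Sum>k\<in>{..<m}. act X (h k y) (x k)"]) blast
qed

lemma middle_factorization:
  assumes X: "in_add \<Gamma> X" and ext: "ext_to_algebra_zero \<Gamma> S (Suc t)"
    and g: "ghom (P (Suc t)) X g" "\<And>x. x \<in> mcar (P (Suc (Suc t))) \<Longrightarrow> g (f (Suc (Suc t)) x) = 0"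
  shows "\<exists>h. ghom (P t) X h \<and> (\<forall>x\<in>mcar (P (Suc t)). g x = h (f (Suc t) x))"
proof (rule extend_along_diff[OF X g(1)])
  fix r \<pi> assume "ghom (shift X r) (regular_mod \<Gamma>) \<pi>"
  from cocycle_compose[OF g(1) _ this] g(2)
  have "(\<lambda>x. \<pi> (g x)) \<in> ext_cocycles \<Gamma> P f (Suc t) r" by blast
  then show "(\<lambda>x. \<pi> (g x)) \<in> ext_coboundaries \<Gamma> P f (Suc t) r"
    using ext resolution unfolding ext_to_algebra_zero_def by blast
qed

text \<open>A map that kills the boundaries factors through \<epsilon>, and its coordinates in a
  dual basis are then maps of various degrees from the simple module to the algebra, all of them
  zero. This is the exactness needed at \<open>P 0\<close>, after which the complex continues by
  zero.\<close>

lemma end_factorization: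
  assumes X: "in_add \<Gamma> X" and hom0: "hom_to_algebra_zero \<Gamma> S"
    and g: "ghom (P 0) X g" "\<And>x. x \<in> mcar (P 1) \<Longrightarrow> g (f 1 x) = 0" and x: "x \<in> mcar (P 0)"
  shows "g x = 0"
proof -
  have "g y = 0" if "y \<in> mcar (P 0)" "\<epsilon> y = 0" for y
  proof -
    have "y \<in> cycles_at P f \<epsilon> 0" using that by (simp add: cycles_at_def)
    then show ?thesis unfolding cycles_eq using g(2) by auto
  qed
  then obtain h where h: "ghom S X h" "\<forall>x\<in>mcar (P 0). h (\<epsilon> x) = g x"
    using ghom_factor[OF aug_ghom _ g(1)] aug_surj by blast
  obtain m :: nat and s y \<pi> where
    \<pi>: "\<forall>k. ghom (shift X (s k)) (regular_mod \<Gamma>) (\<pi> k)"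
    and basis: "\<forall>z\<in>mcar X. z = (\<Sum>k<m. act X (\<pi> k z) (y k))" and y: "\<forall>k<m. y k \<in> mdeg X (s k)"
    using dual_basis[of X] X unfolding in_add_def by (elim exE conjE) blast
  have "\<pi> k (h z) = 0" if "z \<in> mcar S" for k z
  proof -
    have "ghom (shift S (s k)) (regular_mod \<Gamma>) (\<lambda>z. \<pi> k (h z))"
      using ghom_comp[OF ghom_shift[OF h(1)]] \<pi> by blast
    from ghom_gr_hom[OF this] show ?thesis using hom0 that unfolding hom_to_algebra_zero_def by blast
  qed
  then have "\<pi> k (g x) = 0" for k using h(2) x ghom_mcar[OF aug_ghom x] by metis
  then have "(\<Sum>k<m. act X (\<pi> k (g x)) (y k)) = 0"
    using act_zero_left[OF in_add_gmodule[OF X] mdeg_mcar[OF in_add_gmodule[OF X]]] y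
    by (intro sum.neutral) auto
  then show ?thesis using basis[rule_format, OF ghom_mcar[OF g(1) x]] by simp
qed

section \<open>The top Ext group\<close>

lemma ext_iso_data:
  assumes "ext_to_algebra_iso \<Gamma> S t l j"
  shows "\<And>r. r \<noteq> int l \<Longrightarrow> ext_cocycles \<Gamma> P f t r \<subseteq> ext_coboundaries \<Gamma> P f t r"
    and "\<exists>\<phi>. \<phi> ` ext_cocycles \<Gamma> P f t (int l) = {idem \<Gamma> j * a | a. a \<in> deg \<Gamma> 0} \<and>
      (\<forall>g \<in> ext_cocycles \<Gamma> P f t (int l). \<forall>h \<in> ext_cocycles \<Gamma> P f t (int l).
                \<phi> (\<lambda>x. g x + h x) = \<phi> g + \<phi> h) \<and>
      (\<forall>g \<in> ext_cocycles \<Gamma> P f t (int l). \<forall>a \<in> deg \<Gamma> 0. \<phi> (\<lambda>x. g x * a) = \<phi> g * a) \<and>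
      (\<forall>g \<in> ext_cocycles \<Gamma> P f t (int l). \<phi> g = 0 \<longleftrightarrow> g \<in> ext_coboundaries \<Gamma> P f t (int l))"
proof -
  note * = assms[unfolded ext_to_algebra_iso_def, rule_format, OF resolution]
  show "ext_cocycles \<Gamma> P f t r \<subseteq> ext_coboundaries \<Gamma> P f t r" if "r \<noteq> int l" for r
    using conjunct1[OF *, rule_format, of "r - int l"] that by simp
  show "\<exists>\<phi>. \<phi> ` ext_cocycles \<Gamma> P f t (int l) = {idem \<Gamma> j * a | a. a \<in> deg \<Gamma> 0} \<and>
      (\<forall>g \<in> ext_cocycles \<Gamma> P f t (int l). \<forall>h \<in> ext_cocycles \<Gamma> P f t (int l).
                \<phi> (\<lambda>x. g x + h x) = \<phi> g + \<phi> h) \<and>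
      (\<forall>g \<in> ext_cocycles \<Gamma> P f t (int l). \<forall>a \<in> deg \<Gamma> 0. \<phi> (\<lambda>x. g x * a) = \<phi> g * a) \<and>
      (\<forall>g \<in> ext_cocycles \<Gamma> P f t (int l). \<phi> g = 0 \<longleftrightarrow> g \<in> ext_coboundaries \<Gamma> P f t (int l))"
    using * by (rule conjunct2)
qed

text \<open>The top Ext is one-dimensional, so a cocycle \<open>u\<close> of degree \<open>l\<close> that is not a coboundary generates
  it modulo coboundaries.\<close>

lemma ext_one_dimensional:
  assumes iso: "ext_to_algebra_iso \<Gamma> S t l j"
    and u: "u \<in> ext_cocycles \<Gamma> P f t (int l)" "u \<notin> ext_coboundaries \<Gamma> P f t (int l)"
    and \<rho>: "\<rho> \<in> ext_cocycles \<Gamma> P f t (int l)"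
  shows "\<exists>a\<in>deg \<Gamma> 0. (\<lambda>x. \<rho> x + u x * a) \<in> ext_coboundaries \<Gamma> P f t (int l)"
proof -
  obtain \<phi> where im: "\<phi> ` ext_cocycles \<Gamma> P f t (int l) = {idem \<Gamma> j * a | a. a \<in> deg \<Gamma> 0}"
    and add: "\<forall>g \<in> ext_cocycles \<Gamma> P f t (int l). \<forall>h \<in> ext_cocycles \<Gamma> P f t (int l).
                \<phi> (\<lambda>x. g x + h x) = \<phi> g + \<phi> h"
    and act: "\<forall>g \<in> ext_cocycles \<Gamma> P f t (int l). \<forall>a \<in> deg \<Gamma> 0. \<phi> (\<lambda>x. g x * a) = \<phi> g * a"
    and ker: "\<forall>g \<in> ext_cocycles \<Gamma> P f t (int l). \<phi> g = 0 \<longleftrightarrow> g \<in> ext_coboundaries \<Gamma> P f t (int l)"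
    using ext_iso_data(2)[OF iso] by (elim exE conjE)
  have scalar: "\<exists>c. \<phi> g = scl \<Gamma> c (idem \<Gamma> j)" if "g \<in> ext_cocycles \<Gamma> P f t (int l)" for g
  proof -
    have "\<phi> g \<in> {idem \<Gamma> j * a | a. a \<in> deg \<Gamma> 0}" using im that by blast
    then show ?thesis using deg0_mult_idem(2) by auto
  qed
  obtain c where c: "\<phi> u = scl \<Gamma> c (idem \<Gamma> j)" using scalar[OF u(1)] by blast
  obtain d where d: "\<phi> \<rho> = scl \<Gamma> d (idem \<Gamma> j)" using scalar[OF \<rho>] by blast
  have "\<phi> u \<noteq> 0" using bspec[OF ker u(1)] u(2) by simp
  then have "c \<noteq> 0" using c by auto
  \<comment> \<open>Solves \<open>\<phi> \<rho> + \<phi> u * b = 0\<close>, that is,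
    \<open>d + c x = 0\<close> for the coefficient \<open>x\<close> of \<open>b\<close>.\<close>
  define b where "b = scl \<Gamma> (- (d / c)) (idem \<Gamma> j)"
  have a: "b \<in> deg \<Gamma> 0" unfolding b_def by (rule idem_deg0)
  have ua: "(\<lambda>x. u x * b) \<in> ext_cocycles \<Gamma> P f t (int l)"
  proof -
    have u1: "ghom (shift (P t) (int l)) (regular_mod \<Gamma>) u" and u2: "\<forall>x\<in>mcar (P (Suc t)). u (f (Suc t) x) = 0"
      using u(1) unfolding cocycle_iff by auto
    show ?thesis unfolding cocycle_iff using ghom_mult_right[OF u1 a] u2 by simp
  qed
  have sum: "(\<lambda>x. \<rho> x + u x * b) \<in> ext_cocycles \<Gamma> P f t (int l)"
    using \<rho> ua ghom_plus[of "shift (P t) (int l)" "regular_mod \<Gamma>" \<rho> "\<lambda>x. u x * b"]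
    unfolding cocycle_iff by simp
  have "\<phi> (\<lambda>x. \<rho> x + u x * b) = \<phi> \<rho> + \<phi> u * b"
    using bspec[OF bspec[OF add \<rho>] ua] bspec[OF bspec[OF act u(1)] a] by simp
  also have "\<dots> = scl \<Gamma> d (idem \<Gamma> j) + scl \<Gamma> (c * - (d / c)) (idem \<Gamma> j)"
    unfolding c d b_def scl_idem_mult by simp
  also have "\<dots> = 0" using \<open>c \<noteq> 0\<close> by (simp add: V.scale_left_distrib[symmetric])
  finally have "(\<lambda>x. \<rho> x + u x * b) \<in> ext_coboundaries \<Gamma> P f t (int l)" using bspec[OF ker sum] by simp
  then show ?thesis by (rule bexI[OF _ a])
qed

text \<open>Injectivity of the last map makes the preceding differential zero, so every map from the
  top term to the algebra is a cocycle. If the given one is not a coboundary, some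
  \<open>1 - w g\<close> has radical image; being bijective as well, it forces the top term to be
  zero, where every map is a coboundary.\<close>

lemma top_coboundary:
  assumes iso: "ext_to_algebra_iso \<Gamma> S (Suc n) l j"
    and fg: "fin_generated (P (Suc n))" and bb: "bounded_below (P (Suc n))"
    and inj: "\<And>x. x \<in> mcar (P (Suc n)) \<Longrightarrow> f (Suc n) x = 0 \<Longrightarrow> x = 0"
    and g: "ghom (P (Suc n)) X g" and rad: "radical_map (P (Suc n)) X g"
    and \<pi>: "ghom (shift X r) (regular_mod \<Gamma>) \<pi>"
  shows "(\<lambda>x. \<pi> (g x)) \<in> ext_coboundaries \<Gamma> P f (Suc n) r"
proof -
  let ?T = "P (Suc n)"
  have van: "f (Suc (Suc n)) x = 0" if "x \<in> mcar (P (Suc (Suc n)))" for x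
    using inj[OF ghom_mcar[OF diff_ghom that] diff_diff[OF that]] .
  have coc: "\<rho> \<in> ext_cocycles \<Gamma> P f (Suc n) s" if "ghom (shift ?T s) (regular_mod \<Gamma>) \<rho>" for s \<rho>
    unfolding cocycle_iff using that van ghom_zero[OF that] by simp
  let ?u = "\<lambda>x. \<pi> (g x)"
  have u: "ghom (shift ?T r) (regular_mod \<Gamma>) ?u" by (rule ghom_comp[OF ghom_shift[OF g] \<pi>])
  have cob_rad: "\<rho> x \<in> graded_radical \<Gamma> (regular_mod \<Gamma>)"
    if \<rho>: "\<rho> \<in> ext_coboundaries \<Gamma> P f (Suc n) s" and x: "x \<in> mcar ?T" for \<rho> s x
  proof -
    obtain h where h: "ghom (shift (P n) s) (regular_mod \<Gamma>) h" "\<And>x. x \<in> mcar ?T \<Longrightarrow> \<rho> x = h (f (Suc n) x)"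
      using \<rho> by (rule coboundaryE) blast
    have "f (Suc n) x \<in> graded_radical \<Gamma> (shift (P n) s)"
      unfolding radical_shift[OF gm] by (rule diff_radical[OF x])
    from ghom_radical[OF h(1) this] show ?thesis using h(2)[OF x] by simp
  qed
  show ?thesis
  proof (cases "r = int l")
    case False
    then show ?thesis using ext_iso_data(1)[OF iso] coc[OF u] by blast
  next
    case r: True
    show ?thesis
    proof (rule ccontr)
      assume not: "?u \<notin> ext_coboundaries \<Gamma> P f (Suc n) r"
      obtain m :: nat and s p \<rho> where p: "\<forall>k<m. p k \<in> mdeg ?T (s k)"
        and \<rho>: "\<forall>k. ghom (shift ?T (s k)) (regular_mod \<Gamma>) (\<rho> k)"
        and basis: "\<forall>x\<in>mcar ?T. x = (\<Sum>k<m. act ?T (\<rho> k x) (p k))"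
        using dual_basis[OF proj fg] by (elim exE conjE)
      \<comment> \<open>Each coordinate is corrected by a multiple of \<open>?u\<close> to a
        coboundary, whose values are radical by minimality. Off degree \<open>l\<close> the
        coordinate is a coboundary already and the correction is 0.\<close>
      have ex: "\<exists>a. a \<in> deg \<Gamma> 0 \<and> (a \<noteq> 0 \<longrightarrow> s k = r) \<and>
          (\<forall>x\<in>mcar ?T. \<rho> k x + ?u x * a \<in> graded_radical \<Gamma> (regular_mod \<Gamma>))" for k
      proof (cases "s k = r")
        case True
        have \<rho>k: "\<rho> k \<in> ext_cocycles \<Gamma> P f (Suc n) (int l)" using coc[OF \<rho>[rule_format, of k]] True r by simp
        have uc: "?u \<in> ext_cocycles \<Gamma> P f (Suc n) (int l)" using coc[OF u] r by simp
        have un: "?u \<notin> ext_coboundaries \<Gamma> P f (Suc n) (int l)" using not r by simp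
        obtain a where a: "a \<in> deg \<Gamma> 0"
          and cob: "(\<lambda>x. \<rho> k x + ?u x * a) \<in> ext_coboundaries \<Gamma> P f (Suc n) (int l)"
          using ext_one_dimensional[OF iso uc un \<rho>k] by (elim bexE)
        have "\<forall>x\<in>mcar ?T. \<rho> k x + ?u x * a \<in> graded_radical \<Gamma> (regular_mod \<Gamma>)"
          using cob_rad[OF cob] by simp
        then show ?thesis using True a by (intro exI[of _ a] conjI impI)
      next
        case False
        then have "\<rho> k \<in> ext_coboundaries \<Gamma> P f (Suc n) (s k)"
          using coc[OF \<rho>[rule_format, of k]] ext_iso_data(1)[OF iso, of "s k"] r by blast
        then show ?thesis
          using cob_rad[of "\<rho> k" "s k"] V.subspace_0[OF deg_subspace[of 0]] by (intro exI[of _ 0]) simp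
      qed
      have "\<exists>a. \<forall>k. a k \<in> deg \<Gamma> 0 \<and> (a k \<noteq> 0 \<longrightarrow> s k = r) \<and>
          (\<forall>x\<in>mcar ?T. \<rho> k x + ?u x * a k \<in> graded_radical \<Gamma> (regular_mod \<Gamma>))"
        by (rule choice, rule allI, rule ex)
      then obtain a where a': "\<forall>k. a k \<in> deg \<Gamma> 0 \<and> (a k \<noteq> 0 \<longrightarrow> s k = r) \<and>
          (\<forall>x\<in>mcar ?T. \<rho> k x + ?u x * a k \<in> graded_radical \<Gamma> (regular_mod \<Gamma>))" by (elim exE)
      have a: "\<And>k. a k \<in> deg \<Gamma> 0" "\<And>k. a k \<noteq> 0 \<Longrightarrow> s k = r"
        "\<And>k x. x \<in> mcar ?T \<Longrightarrow> \<rho> k x + ?u x * a k \<in> graded_radical \<Gamma> (regular_mod \<Gamma>)"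
        using a' by simp_all
      \<comment> \<open>Where \<open>a k\<close> is nonzero, \<open>s k\<close> equals
        \<open>r\<close>, so that each summand has degree 0. The sign makes
        \<open>x - w (g x)\<close> the combination of the corrected coordinates.\<close>
      define w where "w y = (\<Sum>k\<in>{..<m}. act ?T (\<pi> y * - a k) (p k))" for y
      have pc: "p k \<in> mcar ?T" if "k < m" for k using p that mdeg_mcar[OF gm] by blast
      have Xgm: "gmodule \<Gamma> X" by (rule ghom_gmodule(2)[OF g])
      have w: "ghom X ?T w"
        unfolding w_def
      proof (rule ghom_sum_fun[OF Xgm gm])
        fix k assume "k \<in> {..<m}"
        then have k: "k < m" by simp
        show "ghom X ?T (\<lambda>y. act ?T (\<pi> y * - a k) (p k))"
        proof (cases "a k = 0")
          case True
          then show ?thesis using ghom_zero_map[OF Xgm gm] act_zero_left[OF gm pc[OF k]] by simp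
        next
          case False
          have pk: "p k \<in> mdeg ?T r" using p k a(2)[OF False] by auto
          have "- a k \<in> deg \<Gamma> 0" using a(1) V.subspace_neg[OF deg_subspace] by blast
          from ghom_comp[OF ghom_mult_right[OF \<pi> this] ghom_from_regular[OF gm pk]]
          have "ghom (shift X r) (shift ?T r) (\<lambda>y. act ?T (\<pi> y * - a k) (p k))" .
          from ghom_from_shift[OF this] show ?thesis by (simp add: shift_shift shift_zero)
        qed
      qed
      have "x - w (g x) \<in> graded_radical \<Gamma> ?T" if x: "x \<in> mcar ?T" for x
      proof -
        have "x - w (g x) = (\<Sum>k<m. act ?T (\<rho> k x) (p k)) - w (g x)" using bspec[OF basis x] by simp
        also have "\<dots> = (\<Sum>k<m. act ?T (\<rho> k x) (p k) - act ?T (?u x * - a k) (p k))"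
          unfolding w_def by (simp add: sum_subtractf)
        also have "\<dots> = (\<Sum>k<m. act ?T (\<rho> k x + ?u x * a k) (p k))"
          by (intro sum.cong refl) (simp add: act_diff_left[OF gm pc, symmetric])
        also have "\<dots> \<in> graded_radical \<Gamma> ?T"
        proof (rule radical_sum)
          fix k assume "k \<in> {..<m}"
          then have "p k \<in> mdeg ?T (s k)" using p by simp
          from ghom_radical[OF ghom_from_regular[OF gm this] a(3)[OF x]]
          show "act ?T (\<rho> k x + ?u x * a k) (p k) \<in> graded_radical \<Gamma> ?T" unfolding radical_shift[OF gm] .
        qed
        finally show ?thesis .
      qed
      moreover have "bij_betw (\<lambda>x. x - w (g x)) (mcar ?T) (mcar ?T)"
        using rad w unfolding radical_map_iff[OF g] by blast
      ultimately have all: "y \<in> graded_radical \<Gamma> ?T" if "y \<in> mcar ?T" for y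
        using that unfolding bij_betw_def by (metis (no_types, lifting) imageE)
      \<comment> \<open>The top term is its own radical, so the zero map is onto modulo the radical
        and Nakayama's lemma applies to it.\<close>
      have "(\<lambda>_. 0) ` mcar ?T = mcar ?T"
        by (rule nakayama[OF ghom_zero_map[OF gm gm] bb]) (use all mcar_zero[OF gm] in auto)
      then have zero: "x = 0" if "x \<in> mcar ?T" for x using that by blast
      have "?u \<in> ext_coboundaries \<Gamma> P f (Suc n) r"
      proof (rule coboundaryI[OF u ghom_zero_map[OF gmodule_shift[OF gm] regular_gmodule]])
        show "?u x = 0" if "x \<in> mcar ?T" for x using zero[OF that] ghom_zero[OF u] by simp
      qed
      then show False using not by blast
    qed
  qed
qed

lemma top_factorization:
  assumes X: "in_add \<Gamma> X" and iso: "ext_to_algebra_iso \<Gamma> S (Suc n) l j"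
    and fg: "fin_generated (P (Suc n))" and bb: "bounded_below (P (Suc n))"
    and inj: "\<And>x. x \<in> mcar (P (Suc n)) \<Longrightarrow> f (Suc n) x = 0 \<Longrightarrow> x = 0"
    and g: "ghom (P (Suc n)) X g" and rad: "radical_map (P (Suc n)) X g"
  shows "\<exists>h. ghom (P n) X h \<and> (\<forall>x\<in>mcar (P (Suc n)). g x = h (f (Suc n) x))"
  by (rule extend_along_diff[OF X g]) (rule top_coboundary[OF iso fg bb inj g rad])

lemma radical_map_ghom: "radical_map X Y g \<Longrightarrow> gmodule \<Gamma> X \<Longrightarrow> gmodule \<Gamma> Y \<Longrightarrow> ghom X Y g"
  unfolding radical_map_def by (rule gr_hom_ghom[OF conjunct1])

lemma exact_imp_source:
  assumes iso: "ext_to_algebra_iso \<Gamma> S (Suc n) l j"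
    and ext: "\<And>t. 0 < t \<Longrightarrow> t < Suc n \<Longrightarrow> ext_to_algebra_zero \<Gamma> S t"
    and hom0: "hom_to_algebra_zero \<Gamma> S"
    and fg: "\<And>t. t \<le> Suc n \<Longrightarrow> fin_generated (P t)" and bb: "\<And>t. t \<le> Suc n \<Longrightarrow> bounded_below (P t)"
    and inj: "\<And>x. x \<in> mcar (P (Suc n)) \<Longrightarrow> f (Suc n) x = 0 \<Longrightarrow> x = 0"
  shows "is_source_of_top \<Gamma> (Suc n) P f"
proof -
  let ?m = "Suc n"
  define C where "C = (\<lambda>t. if t \<le> ?m then P (?m - t) else zero_mod)"
  define F where "F = (\<lambda>t. if t < ?m then f (?m - t) else (\<lambda>_. 0))"
  have C_P: "C t = P (?m - t)" if "t \<le> ?m" for t using that by (simp add: C_def)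
  have C_zero: "C t = zero_mod" if "?m < t" for t using that by (simp add: C_def)
  have add: "in_add \<Gamma> (C t)" for t
    unfolding C_def using fg[of "?m - t"] proj zero_mod_in_add by (simp add: in_add_def)
  have Cgm: "gmodule \<Gamma> (C t)" for t by (rule in_add_gmodule[OF add])
  have rad: "radical_map (C t) (C (Suc t)) (F t)" for t
  proof (cases "t < ?m")
    case True
    then have eq: "?m - t = Suc (?m - Suc t)" by simp
    have "radical_map (P (Suc (?m - Suc t))) (P (?m - Suc t)) (f (Suc (?m - Suc t)))"
      by (rule radical_image_radical_map[OF proj bb diff_ghom diff_radical]) (use True in auto)
    then show ?thesis using True eq by (simp add: C_P F_def)
  next
    case False
    then have "F t = (\<lambda>_. 0)" by (simp add: F_def)
    then show ?thesis using radical_map_zero[OF Cgm Cgm] by simp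
  qed
  have cplx: "F (Suc t) (F t x) = 0" if x: "x \<in> mcar (C t)" for t x
  proof (cases "Suc t < ?m")
    case True
    then have eq: "?m - t = Suc (Suc (?m - Suc (Suc t)))" "?m - Suc t = Suc (?m - Suc (Suc t))" by auto
    have "C t = P (Suc (Suc (?m - Suc (Suc t))))" using C_P[of t] eq(1) True by simp
    then show ?thesis using diff_diff[of x "?m - Suc (Suc t)"] x True eq by (simp add: F_def)
  next
    case False then show ?thesis by (simp add: F_def)
  qed
  have top: "\<exists>h. gr_hom (C 1) X h \<and> (\<forall>x\<in>mcar (C 0). g x = h (F 0 x))"
    if X: "in_add \<Gamma> X" and g: "radical_map (C 0) X g" for X g
  proof -
    have g': "radical_map (P ?m) X g" using g C_P[of 0] by simp
    have gh: "ghom (P ?m) X g" by (rule radical_map_ghom[OF g' gm in_add_gmodule[OF X]])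
    have "\<exists>h. ghom (P n) X h \<and> (\<forall>x\<in>mcar (P ?m). g x = h (f ?m x))"
      by (rule top_factorization[OF X iso fg[OF order_refl] bb[OF order_refl] inj gh g'])
    then obtain h where "ghom (P n) X h" "\<forall>x\<in>mcar (P ?m). g x = h (f ?m x)" by (elim exE conjE)
    then show ?thesis using ghom_gr_hom C_P[of 0] C_P[of 1] by (intro exI[of _ h]) (simp add: F_def)
  qed
  have rest: "\<exists>h. gr_hom (C (Suc (Suc t))) X h \<and> (\<forall>x\<in>mcar (C (Suc t)). g x = h (F (Suc t) x))"
    if X: "in_add \<Gamma> X" and g: "gr_hom (C (Suc t)) X g" "\<forall>x\<in>mcar (C t). g (F t x) = 0" for X t g
  proof -
    have gh: "ghom (C (Suc t)) X g" by (rule gr_hom_ghom[OF g(1) Cgm in_add_gmodule[OF X]])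
    \<comment> \<open>The place after \<open>t\<close> holds an interior term, covered by Ext in
      degrees 1 to \<open>n\<close>; or the last term \<open>P 0\<close>, covered by Hom; or one of
      the zero terms that continue the complex.\<close>
    consider (mid) s where "?m - Suc t = Suc s" "Suc t < ?m" | (last) "Suc t = ?m" | (out) "?m < Suc t"
      by (metis Suc_diff_Suc linorder_neqE_nat)
    then show ?thesis
    proof cases
      case mid
      then have eq: "C (Suc t) = P (Suc s)" "C t = P (Suc (Suc s))" "C (Suc (Suc t)) = P s"
        "F t = f (Suc (Suc s))" "F (Suc t) = f (Suc s)"
      proof -
        have "?m - t = Suc (Suc s)" "?m - Suc (Suc t) = s" using mid by auto
        then show "C (Suc t) = P (Suc s)" "C t = P (Suc (Suc s))" "C (Suc (Suc t)) = P s"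
          "F t = f (Suc (Suc s))" "F (Suc t) = f (Suc s)"
          using mid C_P[of "Suc t"] C_P[of t] C_P[of "Suc (Suc t)"] unfolding F_def by auto
      qed
      have "ext_to_algebra_zero \<Gamma> S (Suc s)" by (rule ext) (use mid in auto)
      from middle_factorization[OF X this, of g] obtain h
        where "ghom (P s) X h" "\<forall>x\<in>mcar (P (Suc s)). g x = h (f (Suc s) x)"
        using gh g(2) unfolding eq by auto
      then show ?thesis unfolding eq using ghom_gr_hom by (intro exI[of _ h]) simp
    next
      case last
      have eq: "C (Suc t) = P 0" "C t = P 1" "F t = f 1"
        using last C_P[of "Suc t"] C_P[of t] by (auto simp: F_def)
      have gd: "g (f 1 x) = 0" if "x \<in> mcar (P 1)" for x
        using bspec[OF g(2)[unfolded eq] that] .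
      have "g x = 0" if "x \<in> mcar (P 0)" for x
        by (rule end_factorization[OF X hom0 gh[unfolded eq] gd that])
      then show ?thesis
        using ghom_gr_hom[OF ghom_zero_map[OF Cgm in_add_gmodule[OF X]]] unfolding eq
        by (intro exI[of _ "\<lambda>_. 0"]) simp
    next
      case out
      have "g x = 0" if "x \<in> mcar (C (Suc t))" for x
        using that ghom_zero[OF gh] unfolding C_zero[OF out] mcar_zero_mod by simp
      then show ?thesis
        using ghom_gr_hom[OF ghom_zero_map[OF Cgm in_add_gmodule[OF X]]] by (intro exI[of _ "\<lambda>_. 0"]) simp
    qed
  qed
  have "source_sequence \<Gamma> C F"
    unfolding source_sequence_def using add rad cplx top rest by simp
  then show ?thesis unfolding is_source_of_top_def C_def F_def .
qed

section \<open>Exactness and the sink property from a source sequence\<close>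

text \<open>Undoes the reversal of indices: place \<open>t\<close> of the source sequence is
  occupied by \<open>P (m - t)\<close>.\<close>

lemma
  assumes src: "is_source_of_top \<Gamma> m P f"
  shows source_in_add: "s \<le> m \<Longrightarrow> in_add \<Gamma> (P s)"
    and source_radical: "s < m \<Longrightarrow> radical_map (P (Suc s)) (P s) (f (Suc s))"
    and source_top: "\<lbrakk>m = Suc s; in_add \<Gamma> X; radical_map (P m) X g\<rbrakk>
      \<Longrightarrow> \<exists>h. ghom (P s) X h \<and> (\<forall>x\<in>mcar (P m). g x = h (f m x))"
    and source_middle: "\<lbrakk>Suc s < m; in_add \<Gamma> X; ghom (P (Suc s)) X g;
        \<forall>x\<in>mcar (P (Suc (Suc s))). g (f (Suc (Suc s)) x) = 0\<rbrakk>
      \<Longrightarrow> \<exists>h. ghom (P s) X h \<and> (\<forall>x\<in>mcar (P (Suc s)). g x = h (f (Suc s) x))"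
proof -
  define C where "C = (\<lambda>t. if t \<le> m then P (m - t) else zero_mod)"
  define F where "F = (\<lambda>t. if t < m then f (m - t) else (\<lambda>_. 0))"
  have "source_sequence \<Gamma> C F" using src unfolding is_source_of_top_def C_def F_def .
  then have add: "\<forall>t. in_add \<Gamma> (C t)" and rad: "\<forall>t. radical_map (C t) (C (Suc t)) (F t)"
    and ex: "\<forall>X. in_add \<Gamma> X \<longrightarrow>
        (\<forall>g. radical_map (C 0) X g \<longrightarrow>
             (\<exists>h. gr_hom (C 1) X h \<and> (\<forall>x \<in> mcar (C 0). g x = h (F 0 x)))) \<and>
        (\<forall>t g. gr_hom (C (Suc t)) X g \<and> (\<forall>x \<in> mcar (C t). g (F t x) = 0) \<longrightarrow>
             (\<exists>h. gr_hom (C (Suc (Suc t))) X h \<and>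
                  (\<forall>x \<in> mcar (C (Suc t)). g x = h (F (Suc t) x))))"
    unfolding source_sequence_def by - (elim conjE, assumption)+
  show "in_add \<Gamma> (P s)" if "s \<le> m"
    using spec[OF add, of "m - s"] that by (simp add: C_def)
  show "radical_map (P (Suc s)) (P s) (f (Suc s))" if "s < m"
  proof -
    have "m - (m - Suc s) = Suc s" "Suc (m - Suc s) = m - s" "m - (m - s) = s" using that by auto
    then show ?thesis using spec[OF rad, of "m - Suc s"] that by (simp add: C_def F_def)
  qed
  show "\<exists>h. ghom (P s) X h \<and> (\<forall>x\<in>mcar (P m). g x = h (f m x))"
    if m: "m = Suc s" and X: "in_add \<Gamma> X" and g: "radical_map (P m) X g"
  proof -
    have eq: "C 0 = P m" "C 1 = P s" "F 0 = f m" using m by (simp_all add: C_def F_def)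
    obtain h where h: "gr_hom (P s) X h" "\<forall>x\<in>mcar (P m). g x = h (f m x)"
      using spec[OF conjunct1[OF mp[OF spec[OF ex] X]], of g] g unfolding eq by (elim impE exE conjE)
    then show ?thesis using gr_hom_ghom[OF h(1) gm in_add_gmodule[OF X]] by (intro exI[of _ h] conjI)
  qed
  show "\<exists>h. ghom (P s) X h \<and> (\<forall>x\<in>mcar (P (Suc s)). g x = h (f (Suc s) x))"
    if s: "Suc s < m" and X: "in_add \<Gamma> X" and g: "ghom (P (Suc s)) X g"
      "\<forall>x\<in>mcar (P (Suc (Suc s))). g (f (Suc (Suc s)) x) = 0"
  proof -
    define t where "t = m - Suc (Suc s)"
    have ar: "m - t = Suc (Suc s)" "m - Suc t = Suc s" "m - Suc (Suc t) = s" "Suc t < m" "Suc (Suc t) \<le> m"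
      using s by (auto simp: t_def)
    have eq: "C t = P (Suc (Suc s))" "C (Suc t) = P (Suc s)" "C (Suc (Suc t)) = P s"
      "F t = f (Suc (Suc s))" "F (Suc t) = f (Suc s)"
      using ar by (simp_all add: C_def F_def)
    have cond: "gr_hom (P (Suc s)) X g \<and> (\<forall>x \<in> mcar (P (Suc (Suc s))). g (f (Suc (Suc s)) x) = 0)"
      using g ghom_gr_hom by blast
    obtain h where h: "gr_hom (P s) X h" "\<forall>x\<in>mcar (P (Suc s)). g x = h (f (Suc s) x)"
      using mp[OF spec[OF spec[OF conjunct2[OF mp[OF spec[OF ex] X]], of t], of g, unfolded eq] cond]
      by (elim exE conjE)
    then show ?thesis using gr_hom_ghom[OF h(1) gm in_add_gmodule[OF X]] by (intro exI[of _ h] conjI)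
  qed
qed

text \<open>The extension runs against the direction of the usual comparison of resolutions, so the
  factorizations of a source sequence take the role of projectivity. In the first step the composite
  with the differential is radical by minimality; later it vanishes on the image of the preceding
  term by commutativity.\<close>

lemma chain_extension:
  assumes src: "is_source_of_top \<Gamma> m P f" and bb: "bounded_below (P m)" and \<theta>: "ghom (P m) (P m) \<theta>"
  shows "\<exists>\<Theta>. \<Theta> m = \<theta> \<and> (\<forall>s\<le>m. ghom (P s) (P s) (\<Theta> s)) \<and>
    (\<forall>s<m. \<forall>x\<in>mcar (P (Suc s)). f (Suc s) (\<Theta> (Suc s) x) = \<Theta> s (f (Suc s) x))"
proof -
  \<comment> \<open>\<open>k\<close> counts the places below \<open>m\<close> at which the chain map
    has been built.\<close>
  have "k \<le> m \<Longrightarrow> \<exists>\<Theta>. \<Theta> m = \<theta> \<and> (\<forall>s. m - k \<le> s \<and> s \<le> m \<longrightarrow> ghom (P s) (P s) (\<Theta> s)) \<and>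
    (\<forall>s. m - k \<le> s \<and> s < m \<longrightarrow> (\<forall>x\<in>mcar (P (Suc s)). f (Suc s) (\<Theta> (Suc s) x) = \<Theta> s (f (Suc s) x)))" for k
  proof (induction k)
    case 0 show ?case using \<theta> by (intro exI[of _ "\<lambda>_. \<theta>"]) auto
  next
    case (Suc k)
    then obtain \<Theta> where \<Theta>: "\<Theta> m = \<theta>" "\<forall>s. m - k \<le> s \<and> s \<le> m \<longrightarrow> ghom (P s) (P s) (\<Theta> s)"
      "\<forall>s. m - k \<le> s \<and> s < m \<longrightarrow> (\<forall>x\<in>mcar (P (Suc s)). f (Suc s) (\<Theta> (Suc s) x) = \<Theta> s (f (Suc s) x))"
      by auto
    define s where "s = m - Suc k"
    have s: "m - k = Suc s" "s < m" using Suc.prems by (auto simp: s_def)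
    have \<Theta>s: "ghom (P (Suc s)) (P (Suc s)) (\<Theta> (Suc s))" using \<Theta>(2) s by simp
    let ?g = "\<lambda>x. f (Suc s) (\<Theta> (Suc s) x)"
    have g: "ghom (P (Suc s)) (P s) ?g" by (rule ghom_comp[OF \<Theta>s diff_ghom])
    have X: "in_add \<Gamma> (P s)" by (rule source_in_add[OF src]) (use s in simp)
    have "\<exists>h. ghom (P s) (P s) h \<and> (\<forall>x\<in>mcar (P (Suc s)). ?g x = h (f (Suc s) x))"
    proof (cases "m = Suc s")
      case True
      have "radical_map (P (Suc s)) (P s) ?g"
        by (rule radical_image_radical_map[OF proj _ g]) (use bb True ghom_mcar[OF \<Theta>s] diff_radical in auto)
      then show ?thesis using source_top[OF src True X, of ?g] True by simp
    next
      case False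
      then have sm: "Suc s < m" using s by simp
      have "?g (f (Suc (Suc s)) x) = 0" if x: "x \<in> mcar (P (Suc (Suc s)))" for x
      proof -
        have "\<Theta> (Suc s) (f (Suc (Suc s)) x) = f (Suc (Suc s)) (\<Theta> (Suc (Suc s)) x)"
          using \<Theta>(3) s(1) sm x by simp
        moreover have "\<Theta> (Suc (Suc s)) x \<in> mcar (P (Suc (Suc s)))"
          using \<Theta>(2) s(1) sm x ghom_mcar by (metis Suc_leI le_SucI order_refl)
        ultimately show ?thesis using diff_diff by simp
      qed
      then show ?thesis using source_middle[OF src sm X g] by blast
    qed
    then obtain h where h: "ghom (P s) (P s) h" "\<forall>x\<in>mcar (P (Suc s)). ?g x = h (f (Suc s) x)"
      by (elim exE conjE)
    have split: "m - Suc k \<le> t \<longleftrightarrow> t = s \<or> m - k \<le> t" for t using s Suc.prems by (auto simp: s_def)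
    show ?case
      unfolding split
    proof (intro exI[of _ "\<Theta>(s := h)"] conjI allI impI)
      show "(\<Theta>(s := h)) m = \<theta>" using \<Theta>(1) s by simp
      fix t assume t: "(t = s \<or> m - k \<le> t) \<and> t \<le> m"
      show "ghom (P t) (P t) ((\<Theta>(s := h)) t)" using t h(1) \<Theta>(2) s by auto
    next
      fix t assume t: "(t = s \<or> m - k \<le> t) \<and> t < m"
      show "\<forall>x\<in>mcar (P (Suc t)). f (Suc t) ((\<Theta>(s := h)) (Suc t) x) = (\<Theta>(s := h)) t (f (Suc t) x)"
      proof (cases "t = s")
        case True then show ?thesis using h(2) by simp
      next
        case False
        then have "m - k \<le> t" "Suc t \<noteq> s" using t s by auto
        then show ?thesis using \<Theta>(3) t False by simp
      qed
    qed
  qed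
  from this[of m] show ?thesis by simp
qed

text \<open>Upward induction from the simple module, with \<open>\<Theta> s\<close> as an
  endomorphism of the projective cover of the cycles one place below. Reflection of cycles is
  carried along because, together with bijectivity, it makes every boundary the image of a boundary,
  as \<open>projective_cover_iso\<close> requires in the next step.\<close>

lemma chain_map_bij:
  assumes bb: "\<And>s. s \<le> m \<Longrightarrow> bounded_below (P s)" and \<Theta>: "\<And>s. s \<le> m \<Longrightarrow> ghom (P s) (P s) (\<Theta> s)"
    and comm: "\<And>s x. s < m \<Longrightarrow> x \<in> mcar (P (Suc s)) \<Longrightarrow> f (Suc s) (\<Theta> (Suc s) x) = \<Theta> s (f (Suc s) x)"
    and \<gamma>: "ghom S S \<gamma>" and inj: "inj_on \<gamma> (mcar S)" and surj: "mcar S \<subseteq> \<gamma> ` mcar S"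
    and comm0: "\<And>x. x \<in> mcar (P 0) \<Longrightarrow> \<epsilon> (\<Theta> 0 x) = \<gamma> (\<epsilon> x)"
  shows "bij_betw (\<Theta> m) (mcar (P m)) (mcar (P m))"
proof -
  have ker: "x \<in> graded_radical \<Gamma> (P t)" if "x \<in> cycles_at P f \<epsilon> t" for x t
    using cycles_radical that by blast
  have "s \<le> m \<Longrightarrow> bij_betw (\<Theta> s) (mcar (P s)) (mcar (P s)) \<and>
      (\<forall>x\<in>mcar (P s). \<Theta> s x \<in> cycles_at P f \<epsilon> s \<longrightarrow> x \<in> cycles_at P f \<epsilon> s)" for s
  proof (induction s)
    case 0
    have "bij_betw (\<Theta> 0) (mcar (P 0)) (mcar (P 0))"
    proof (rule projective_cover_iso[OF proj proj bb aug_ghom aug_ghom \<gamma> inj \<Theta> _ _ _ _ coding_first])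
      show "\<epsilon> (\<Theta> 0 x) = \<gamma> (\<epsilon> x)" if "x \<in> mcar (P 0)" for x by (rule comm0[OF that])
      show "\<epsilon> ` mcar (P 0) \<subseteq> (\<lambda>x. \<gamma> (\<epsilon> x)) ` mcar (P 0)"
        using surj unfolding aug_surj[symmetric] image_image .
      show "x \<in> graded_radical \<Gamma> (P 0)" if "x \<in> mcar (P 0)" "\<epsilon> x = 0" for x
        using ker[of x 0] that by (simp add: cycles_at_def)
      show "x \<in> graded_radical \<Gamma> (P 0)" if "x \<in> mcar (P 0)" "\<epsilon> x = 0" for x
        using ker[of x 0] that by (simp add: cycles_at_def)
    qed simp_all
    moreover have "\<epsilon> x = 0" if "x \<in> mcar (P 0)" "\<epsilon> (\<Theta> 0 x) = 0" for x
    proof -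
      have "\<gamma> (\<epsilon> x) = \<gamma> 0" using comm0 that ghom_zero[OF \<gamma>] by simp
      then show ?thesis
        by (rule inj_onD[OF inj]) (use ghom_mcar[OF aug_ghom that(1)] mcar_zero[OF simple_gmodule] in auto)
    qed
    ultimately show ?case by (simp add: cycles_at_def)
  next
    case (Suc s)
    then have bij: "bij_betw (\<Theta> s) (mcar (P s)) (mcar (P s))"
      and cyc: "\<And>x. x \<in> mcar (P s) \<Longrightarrow> \<Theta> s x \<in> cycles_at P f \<epsilon> s \<Longrightarrow> x \<in> cycles_at P f \<epsilon> s" by auto
    have \<Theta>s: "ghom (P s) (P s) (\<Theta> s)" and inj': "inj_on (\<Theta> s) (mcar (P s))"
      using \<Theta> Suc.prems bij bij_betw_imp_inj_on by auto
    have cm: "f (Suc s) (\<Theta> (Suc s) x) = \<Theta> s (f (Suc s) x)" if "x \<in> mcar (P (Suc s))" for x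
      using comm[OF _ that] Suc.prems by simp
    have "bij_betw (\<Theta> (Suc s)) (mcar (P (Suc s))) (mcar (P (Suc s)))"
    proof (rule projective_cover_iso[OF proj proj bb diff_ghom diff_ghom \<Theta>s inj' \<Theta> _ _ _ _ coding_id])
      show "f (Suc s) (\<Theta> (Suc s) x) = \<Theta> s (f (Suc s) x)" if "x \<in> mcar (P (Suc s))" for x by (rule cm[OF that])
      show "f (Suc s) ` mcar (P (Suc s)) \<subseteq> (\<lambda>x. \<Theta> s (f (Suc s) x)) ` mcar (P (Suc s))"
      proof
        fix y assume "y \<in> f (Suc s) ` mcar (P (Suc s))"
        then have y: "y \<in> cycles_at P f \<epsilon> s" unfolding cycles_eq .
        then have "y \<in> mcar (P s)" by (simp add: cycles_at_def)
        then obtain x where x: "x \<in> mcar (P s)" "y = \<Theta> s x" using bij unfolding bij_betw_def by blast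
        then have "x \<in> f (Suc s) ` mcar (P (Suc s))" using cyc y unfolding cycles_eq by simp
        then show "y \<in> (\<lambda>x. \<Theta> s (f (Suc s) x)) ` mcar (P (Suc s))" using x(2) by auto
      qed
      show "x \<in> graded_radical \<Gamma> (P (Suc s))" if "x \<in> mcar (P (Suc s))" "f (Suc s) x = 0" for x
        using ker[of x "Suc s"] that by (simp add: cycles_at_def)
      show "x \<in> graded_radical \<Gamma> (P (Suc s))" if "x \<in> mcar (P (Suc s))" "f (Suc s) x = 0" for x
        using ker[of x "Suc s"] that by (simp add: cycles_at_def)
    qed (use Suc.prems in simp_all)
    moreover have "f (Suc s) x = 0" if x: "x \<in> mcar (P (Suc s))" "f (Suc s) (\<Theta> (Suc s) x) = 0" for x
    proof -
      have "\<Theta> s (f (Suc s) x) = \<Theta> s 0" using cm[OF x(1)] x(2) ghom_zero[OF \<Theta>s] by simp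
      then show ?thesis
        by (rule inj_onD[OF inj']) (use ghom_mcar[OF diff_ghom x(1)] mcar_zero[OF gm] in auto)
    qed
    ultimately show ?case by (simp add: cycles_at_def)
  qed
  then show ?thesis by blast
qed

text \<open>The module is the line through one idempotent, on which \<gamma> is multiplication by a
  scalar.\<close>

lemma simple_endo_dichotomy:
  assumes \<gamma>: "ghom S S \<gamma>"
  shows "(inj_on \<gamma> (mcar S) \<and> mcar S \<subseteq> \<gamma> ` mcar S) \<or> (\<forall>x\<in>mcar S. \<gamma> x = 0)"
proof -
  have e: "idem \<Gamma> i \<in> mcar S" unfolding mcar_simple by (rule CollectI) (rule exI[of _ 1], simp)
  obtain c where c: "\<gamma> (idem \<Gamma> i) = scl \<Gamma> c (idem \<Gamma> i)"
    using ghom_mcar[OF \<gamma> e] unfolding mcar_simple by blast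
  have val: "\<gamma> (scl \<Gamma> d (idem \<Gamma> i)) = scl \<Gamma> (d * c) (idem \<Gamma> i)" for d
  proof -
    have act: "act S (scl \<Gamma> d (idem \<Gamma> i)) x = scl \<Gamma> d (idem \<Gamma> i) * x" for x
      by (simp add: simple_act degree0_part_deg[OF idem_deg0(2)])
    have "\<gamma> (act S (scl \<Gamma> d (idem \<Gamma> i)) (idem \<Gamma> i)) = act S (scl \<Gamma> d (idem \<Gamma> i)) (scl \<Gamma> c (idem \<Gamma> i))"
      using ghom_act[OF \<gamma> e] c by simp
    then show ?thesis unfolding act scl_idem_mult by (simp add: scl_left[symmetric] idem_mult)
  qed
  show ?thesis
  proof (cases "c = 0")
    case True then show ?thesis using val unfolding mcar_simple by auto
  next
    case False
    have "inj_on \<gamma> (mcar S)"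
      using val False idem_nonzero unfolding mcar_simple by (auto intro!: inj_onI)
    moreover have "scl \<Gamma> d (idem \<Gamma> i) \<in> \<gamma> ` mcar S" for d
      by (rule image_eqI[of _ _ "scl \<Gamma> (d / c) (idem \<Gamma> i)"]) (use val False in \<open>auto simp: mcar_simple\<close>)
    ultimately show ?thesis unfolding mcar_simple by blast
  qed
qed

text \<open>A cocycle \<open>g\<close> generating the top Ext, seen as a map from \<open>P (n+1)\<close> to a free object \<open>X\<close>, is not
  radical, as it would otherwise factor through \<open>P n\<close>. So \<open>1 - w g\<close> is not invertible for some \<open>w\<close>. The
  endomorphism \<open>w g\<close> extends to the complex. As \<open>S\<close> is simple, either \<open>w g\<close> or \<open>1 - w g\<close> is invertible,
  hence \<open>w g\<close> is; but \<open>g\<close> vanishes on the boundaries.\<close>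

lemma source_imp_exact:
  assumes iso: "ext_to_algebra_iso \<Gamma> S (Suc n) l j" and src: "is_source_of_top \<Gamma> (Suc n) P f"
    and bb: "\<And>t. t \<le> Suc n \<Longrightarrow> bounded_below (P t)"
    and x: "x \<in> mcar (P (Suc n))" "f (Suc n) x = 0"
  shows "x = 0"
proof -
  let ?T = "P (Suc n)"
  obtain \<phi> where im: "\<phi> ` ext_cocycles \<Gamma> P f (Suc n) (int l) = {idem \<Gamma> j * a | a. a \<in> deg \<Gamma> 0}"
    and ker: "\<forall>g \<in> ext_cocycles \<Gamma> P f (Suc n) (int l).
      \<phi> g = 0 \<longleftrightarrow> g \<in> ext_coboundaries \<Gamma> P f (Suc n) (int l)"
    using ext_iso_data(2)[OF iso] by (elim exE conjE)
  have "idem \<Gamma> j = idem \<Gamma> j * idem \<Gamma> j" by (simp add: idem_mult)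
  then have "idem \<Gamma> j \<in> \<phi> ` ext_cocycles \<Gamma> P f (Suc n) (int l)" unfolding im using idem_deg0(1) by blast
  then obtain g where g: "g \<in> ext_cocycles \<Gamma> P f (Suc n) (int l)" and \<phi>g: "\<phi> g = idem \<Gamma> j" by force
  have not: "g \<notin> ext_coboundaries \<Gamma> P f (Suc n) (int l)" using bspec[OF ker g] \<phi>g idem_nonzero by simp
  have gh: "ghom (shift ?T (int l)) (regular_mod \<Gamma>) g"
    and gd: "\<forall>y\<in>mcar (P (Suc (Suc n))). g (f (Suc (Suc n)) y) = 0" using g unfolding cocycle_iff by auto
  have "fin_generated ?T" using source_in_add[OF src, of "Suc n"] unfolding in_add_def by simp
  from fin_generated_local_unit[OF this gh gm] obtain F where F: "finite F"
    "\<forall>x\<in>mcar ?T. g x * (\<Sum>i\<in>F. idem \<Gamma> i) = g x" by (elim exE conjE)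
  obtain X :: "'a umod" and \<iota> \<kappa> where X: "in_add \<Gamma> X" and \<kappa>: "ghom (shift X (int l)) (regular_mod \<Gamma>) \<kappa>"
    and inv: "\<forall>a. \<kappa> (\<iota> a) = a" and add: "\<forall>x y. \<iota> (x + y) = \<iota> x + \<iota> y"
    and into: "\<forall>(M :: 'a umod) g. gmodule \<Gamma> M \<and> ghom (shift M (int l)) (regular_mod \<Gamma>) g
      \<and> (\<forall>x\<in>mcar M. g x * (\<Sum>i\<in>F. idem \<Gamma> i) = g x) \<longrightarrow> ghom M X (\<lambda>x. \<iota> (g x))"
    using free_object[OF F(1) refl, of "int l"] by (elim exE conjE)
  let ?g = "\<lambda>x. \<iota> (g x)"
  have g': "ghom ?T X ?g" using into[rule_format, of ?T g] gm gh F(2) by simp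
  have \<iota>0: "\<iota> 0 = 0" using add[rule_format, of 0 0] by simp
  have "\<not> radical_map ?T X ?g"
  proof
    assume "radical_map ?T X ?g"
    from source_top[OF src refl X this] obtain h
      where h: "ghom (P n) X h" "\<forall>x\<in>mcar ?T. \<iota> (g x) = h (f (Suc n) x)" by (elim exE conjE)
    \<comment> \<open>Composing the factorization through \<open>P n\<close> with \<kappa> gives a
      map of degree \<open>l\<close> into the algebra again.\<close>
    have "g \<in> ext_coboundaries \<Gamma> P f (Suc n) (int l)"
    proof (rule coboundaryI[OF gh ghom_comp[OF ghom_shift[OF h(1)] \<kappa>]])
      show "g x = \<kappa> (h (f (Suc n) x))" if "x \<in> mcar ?T" for x using bspec[OF h(2) that] inv by metis
    qed
    then show False using not by blast
  qed
  then obtain w where w: "ghom X ?T w" "\<not> bij_betw (\<lambda>x. x - w (\<iota> (g x))) (mcar ?T) (mcar ?T)"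
    unfolding radical_map_iff[OF g'] by blast
  let ?\<theta> = "\<lambda>x. w (\<iota> (g x))"
  obtain \<Theta> where \<Theta>: "\<Theta> (Suc n) = ?\<theta>" "\<forall>s\<le>Suc n. ghom (P s) (P s) (\<Theta> s)"
    "\<forall>s<Suc n. \<forall>x\<in>mcar (P (Suc s)). f (Suc s) (\<Theta> (Suc s) x) = \<Theta> s (f (Suc s) x)"
    using chain_extension[OF src bb[OF order_refl] ghom_comp[OF g' w(1)]] by (elim exE conjE)
  have \<Theta>0: "ghom (P 0) (P 0) (\<Theta> 0)" using \<Theta>(2) by simp
  \<comment> \<open>\<open>\<Theta> 0\<close> preserves the boundaries, which form the kernel of
    \<epsilon>, and so induces an endomorphism \<gamma> of the simple module.\<close>
  have "\<epsilon> (\<Theta> 0 y) = 0" if y: "y \<in> mcar (P 0)" "\<epsilon> y = 0" for y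
  proof -
    have "y \<in> cycles_at P f \<epsilon> 0" using y by (simp add: cycles_at_def)
    then obtain z where z: "z \<in> mcar (P 1)" "y = f 1 z" unfolding cycles_eq by auto
    have "\<Theta> 0 y = f 1 (\<Theta> 1 z)" using \<Theta>(3)[rule_format, of 0 z] z by simp
    moreover have "\<Theta> 1 z \<in> mcar (P 1)" using ghom_mcar[of "P 1" "P 1" "\<Theta> 1" z] \<Theta>(2) z(1) by simp
    ultimately show ?thesis using aug_diff by simp
  qed
  then obtain \<gamma> where \<gamma>: "ghom S S \<gamma>" "\<forall>x\<in>mcar (P 0). \<gamma> (\<epsilon> x) = \<epsilon> (\<Theta> 0 x)"
    using ghom_factor[OF aug_ghom _ ghom_comp[OF \<Theta>0 aug_ghom]] aug_surj by blast
  have \<gamma>_bij: "inj_on \<gamma> (mcar S) \<and> mcar S \<subseteq> \<gamma> ` mcar S"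
  proof (rule ccontr)
    assume "\<not> ?thesis"
    then have z: "\<forall>x\<in>mcar S. \<gamma> x = 0" using simple_endo_dichotomy[OF \<gamma>(1)] by blast
    have \<Theta>d: "ghom (P s) (P s) (\<lambda>x. x - \<Theta> s x)" if "s \<le> Suc n" for s
      by (rule ghom_minus[OF ghom_id[OF gm]]) (use \<Theta>(2) that in simp)
    \<comment> \<open>When \<gamma> is zero, \<open>1 - \<Theta>\<close> induces the identity on the
      simple module, so its top component is bijective, against the choice of
      \<open>w\<close>.\<close>
    have "bij_betw ((\<lambda>s x. x - \<Theta> s x) (Suc n)) (mcar ?T) (mcar ?T)"
    proof (rule chain_map_bij[OF bb \<Theta>d _ ghom_id[OF simple_gmodule]])
      show "f (Suc s) (x - \<Theta> (Suc s) x) = f (Suc s) x - \<Theta> s (f (Suc s) x)"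
        if s: "s < Suc n" and x: "x \<in> mcar (P (Suc s))" for s x
      proof -
        have "ghom (P (Suc s)) (P (Suc s)) (\<Theta> (Suc s))" using \<Theta>(2) s by simp
        then have "\<Theta> (Suc s) x \<in> mcar (P (Suc s))" using x by (rule ghom_mcar)
        from ghom_diff[OF diff_ghom x this] show ?thesis using \<Theta>(3) s x by simp
      qed
      show "\<epsilon> (x - \<Theta> 0 x) = \<epsilon> x" if x: "x \<in> mcar (P 0)" for x
        using ghom_diff[OF aug_ghom x ghom_mcar[OF \<Theta>0 x]] bspec[OF \<gamma>(2) x]
          bspec[OF z ghom_mcar[OF aug_ghom x]] by simp
    qed simp_all
    then show False using w(2) \<Theta>(1) by simp
  qed
  have "bij_betw (\<Theta> (Suc n)) (mcar ?T) (mcar ?T)"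
    by (rule chain_map_bij[OF bb _ _ \<gamma>(1)]) (use \<Theta>(2,3) \<gamma>(2) \<gamma>_bij in simp_all)
  then have inj: "inj_on ?\<theta> (mcar ?T)" unfolding \<Theta>(1) by (rule bij_betw_imp_inj_on)
  have "x \<in> cycles_at P f \<epsilon> (Suc n)" using x by (simp add: cycles_at_def)
  then obtain y where "y \<in> mcar (P (Suc (Suc n)))" "x = f (Suc (Suc n)) y" unfolding cycles_eq by blast
  then have "g x = 0" using gd by simp
  then have "?\<theta> x = ?\<theta> 0" using ghom_zero[OF gh] by simp
  then show "x = 0" by (rule inj_onD[OF inj]) (use x mcar_zero[OF gm] in auto)
qed

text \<open>Otherwise \<open>\<epsilon> \<circ> g\<close> is onto the simple module, and lifting
  \<epsilon> through it gives \<open>w\<close> with \<open>\<epsilon> g w = \<epsilon>\<close>. Then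
  \<open>\<epsilon> g\<close> kills the image of \<open>1 - w g\<close>, which is all of
  \<open>X\<close> since \<open>g\<close> is radical.\<close>

lemma radical_to_bottom:
  assumes g: "ghom X (P 0) g" and rad: "radical_map X (P 0) g" and x: "x \<in> mcar X"
  shows "\<epsilon> (g x) = 0"
proof (rule ccontr)
  assume nz: "\<epsilon> (g x) \<noteq> 0"
  have eg: "ghom X S (\<lambda>x. \<epsilon> (g x))" by (rule ghom_comp[OF g aug_ghom])
  obtain c where c: "\<epsilon> (g x) = scl \<Gamma> c (idem \<Gamma> i)" using ghom_mcar[OF eg x] unfolding mcar_simple by blast
  have "c \<noteq> 0" using nz c by auto
  have "mcar S \<subseteq> (\<lambda>x. \<epsilon> (g x)) ` mcar X"
  proof
    fix s assume "s \<in> mcar S"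
    then obtain d where d: "s = scl \<Gamma> d (idem \<Gamma> i)" unfolding mcar_simple by blast
    let ?a = "scl \<Gamma> (d / c) (idem \<Gamma> i)"
    have "\<epsilon> (g (act X ?a x)) = act S ?a (scl \<Gamma> c (idem \<Gamma> i))" using ghom_act[OF eg x] c by simp
    also have "\<dots> = s"
      unfolding simple_act degree0_part_deg[OF idem_deg0(2)] d using \<open>c \<noteq> 0\<close> by (simp add: scl_idem_mult)
    finally show "s \<in> (\<lambda>x. \<epsilon> (g x)) ` mcar X" using act_mcar[OF ghom_gmodule(1)[OF g] x] by blast
  qed
  then have "\<epsilon> ` mcar (P 0) \<subseteq> (\<lambda>x. \<epsilon> (g x)) ` mcar X" using aug_surj by simp
  from projective_lift[OF proj eg aug_ghom this coding_id coding_first]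
  obtain w where w: "ghom (P 0) X w" "\<forall>y\<in>mcar (P 0). \<epsilon> (g (w y)) = \<epsilon> y" by (elim exE conjE)
  have "bij_betw (\<lambda>x. x - w (g x)) (mcar X) (mcar X)"
    using rad w(1) unfolding radical_map_iff[OF g] by blast
  then obtain z where z: "z \<in> mcar X" "x = z - w (g z)" using x unfolding bij_betw_def by blast
  have wz: "w (g z) \<in> mcar X" by (rule ghom_mcar[OF w(1) ghom_mcar[OF g z(1)]])
  have "\<epsilon> (g x) = \<epsilon> (g z) - \<epsilon> (g (w (g z)))" unfolding z(2) by (rule ghom_diff[OF eg z(1) wz])
  then have "\<epsilon> (g x) = 0" using w(2) ghom_mcar[OF g z(1)] by simp
  then show False using nz by simp
qed

text \<open>Sink sequences ask for lifts of maps out of projectives, which exactness of the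
  resolution provides. The ends need an extra reason: at \<open>P 0\<close> radical maps land in the
  kernel of \<epsilon>, and at the left end the last map is injective.\<close>

lemma sink_of_exact:
  assumes add: "\<And>s. s \<le> Suc n \<Longrightarrow> in_add \<Gamma> (P s)"
    and rad: "\<And>s. s < Suc n \<Longrightarrow> radical_map (P (Suc s)) (P s) (f (Suc s))"
    and inj: "\<And>x. x \<in> mcar (P (Suc n)) \<Longrightarrow> f (Suc n) x = 0 \<Longrightarrow> x = 0"
  shows "is_sink_of_bottom \<Gamma> (Suc n) P f"
proof -
  let ?m = "Suc n"
  define C where "C = (\<lambda>t. if t \<le> ?m then P t else zero_mod)"
  define F where "F = (\<lambda>t. if t < ?m then f (Suc t) else (\<lambda>_. 0))"
  have Cadd: "in_add \<Gamma> (C t)" for t using add zero_mod_in_add by (simp add: C_def)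
  note Cgm = in_add_gmodule[OF Cadd]
  have Crad: "radical_map (C (Suc t)) (C t) (F t)" for t
  proof (cases "t < ?m")
    case True then show ?thesis using rad by (simp add: C_def F_def)
  next
    case False
    then have "F t = (\<lambda>_. 0)" by (simp add: F_def)
    then show ?thesis using radical_map_zero[OF Cgm Cgm] by simp
  qed
  have cplx: "F t (F (Suc t) x) = 0" if x: "x \<in> mcar (C (Suc (Suc t)))" for t x
  proof (cases "Suc t < ?m")
    case True then show ?thesis using diff_diff x by (simp add: C_def F_def)
  next
    case False
    then have "F (Suc t) x = 0" by (simp add: F_def)
    then show ?thesis using ghom_zero[OF diff_ghom] by (simp add: F_def)
  qed
  have lift: "\<exists>h. gr_hom X (P (Suc t)) h \<and> (\<forall>x\<in>mcar X. g x = f (Suc t) (h x))"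
    if X: "in_add \<Gamma> X" and g: "ghom X (P t) g" "\<And>x. x \<in> mcar X \<Longrightarrow> g x \<in> cycles_at P f \<epsilon> t" for X g t
  proof -
    have "g ` mcar X \<subseteq> f (Suc t) ` mcar (P (Suc t))" using g(2) unfolding cycles_eq by blast
    moreover have "gr_projective \<Gamma> X" using X unfolding in_add_def by blast
    ultimately obtain h where h: "ghom X (P (Suc t)) h" "\<forall>x\<in>mcar X. f (Suc t) (h x) = g x"
      using projective_lift[OF _ diff_ghom g(1) _ coding_id coding_id] by blast
    then show ?thesis using ghom_gr_hom[OF h(1)] by (intro exI[of _ h]) simp
  qed
  have bottom: "\<exists>h. gr_hom X (C 1) h \<and> (\<forall>x\<in>mcar X. g x = F 0 (h x))"
    if X: "in_add \<Gamma> X" and g: "radical_map X (C 0) g" for X g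
  proof -
    have g': "radical_map X (P 0) g" using g by (simp add: C_def)
    have gh: "ghom X (P 0) g" by (rule radical_map_ghom[OF g' in_add_gmodule[OF X] gm])
    have "g x \<in> cycles_at P f \<epsilon> 0" if "x \<in> mcar X" for x
      using radical_to_bottom[OF gh g' that] ghom_mcar[OF gh that] by (simp add: cycles_at_def)
    from lift[OF X gh this] show ?thesis by (simp add: C_def F_def)
  qed
  have rest: "\<exists>h. gr_hom X (C (Suc (Suc t))) h \<and> (\<forall>x\<in>mcar X. g x = F (Suc t) (h x))"
    if X: "in_add \<Gamma> X" and g: "gr_hom X (C (Suc t)) g" "\<forall>x\<in>mcar X. F t (g x) = 0" for X t g
  proof -
    have gh: "ghom X (C (Suc t)) g" by (rule gr_hom_ghom[OF g(1) in_add_gmodule[OF X] Cgm])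
    show ?thesis
    proof (cases "Suc t < ?m")
      case True
      have gP: "ghom X (P (Suc t)) g" using gh True by (simp add: C_def)
      have "g x \<in> cycles_at P f \<epsilon> (Suc t)" if "x \<in> mcar X" for x
        using g(2) that True ghom_mcar[OF gP that] by (simp add: cycles_at_def F_def)
      from lift[OF X gP this] show ?thesis using True by (simp add: C_def F_def)
    next
      case False
      have "g x = 0" if x: "x \<in> mcar X" for x
      proof (cases "Suc t = ?m")
        case True
        then have "g x \<in> mcar (P ?m)" "f ?m (g x) = 0"
          using ghom_mcar[OF gh x] g(2) x by (auto simp: C_def F_def)
        then show ?thesis by (rule inj)
      next
        case False
        then have "C (Suc t) = zero_mod" using \<open>\<not> Suc t < ?m\<close> by (simp add: C_def)
        then show ?thesis using ghom_mcar[OF gh x] mcar_zero_mod by auto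
      qed
      then show ?thesis
        using ghom_gr_hom[OF ghom_zero_map[OF in_add_gmodule[OF X] Cgm]] False
        by (intro exI[of _ "\<lambda>_. 0"]) (simp add: F_def)
    qed
  qed
  have "sink_sequence \<Gamma> C F" unfolding sink_sequence_def using Cadd Crad cplx bottom rest by simp
  then show ?thesis unfolding is_sink_of_bottom_def C_def F_def .
qed

end

text \<open>The vanishing of \<open>Hom(S(i), \<Gamma>)\<close> is what a source sequence ending at
  \<open>P 0\<close> asks of the right end: a map out of \<open>P 0\<close> that kills the image of
  \<open>P 1\<close> must vanish. Regularity speaks only of Ext in the degrees 1 to
  \<open>n + 1\<close>.\<close>

theorem lemma7p1:
  fixes \<Gamma> :: "('k::field, 'v, 'a::ring) galg"
    and n l :: nat and q :: enat
    and PP II :: "'v set" and \<nu> :: "'v \<Rightarrow> 'v" and i :: 'v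
    and P :: "nat \<Rightarrow> 'a umod"
    and f :: "nat \<Rightarrow> (nat \<Rightarrow> 'a) \<Rightarrow> nat \<Rightarrow> 'a"
    and \<epsilon> :: "(nat \<Rightarrow> 'a) \<Rightarrow> 'a"
  assumes "n + 1 \<ge> 2" and "q \<ge> 2"
    and "graded_quiver_algebra \<Gamma>"
    and "pq_koszul \<Gamma> q (enat (n + 1))"
    and "partial_AS_regular \<Gamma> n PP II \<nu> l"
    and "i \<notin> II"
    and "minimal_resolution \<Gamma> (simple_mod \<Gamma> i) P f \<epsilon>"
  shows "(hom_to_algebra_zero \<Gamma> (simple_mod \<Gamma> i) \<longrightarrow>
            (is_source_of_top \<Gamma> (n + 1) P f \<longleftrightarrow> exact_at_left_end (n + 1) P f)) \<and>
         (is_source_of_top \<Gamma> (n + 1) P f \<longrightarrow>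
            exact_at_left_end (n + 1) P f \<and> almost_split_sequence \<Gamma> n P f)"
proof -
  interpret minimal_res \<Gamma> i P f \<epsilon>
    by unfold_locales (fact assms(3) assms(7))+
  have "\<forall>i \<in> - II. (\<forall>t. 0 < t \<and> t < n + 1 \<longrightarrow> ext_to_algebra_zero \<Gamma> (simple_mod \<Gamma> i) t) \<and>
        ext_to_algebra_iso \<Gamma> (simple_mod \<Gamma> i) (n + 1) l (\<nu> i)"
    using assms(5) unfolding partial_AS_regular_def by (rule conjunct2)
  then have ext: "\<And>t. 0 < t \<Longrightarrow> t < Suc n \<Longrightarrow> ext_to_algebra_zero \<Gamma> (simple_mod \<Gamma> i) t"
    and iso: "ext_to_algebra_iso \<Gamma> (simple_mod \<Gamma> i) (Suc n) l (\<nu> i)"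
    using assms(6) by simp_all
  have fg: "\<And>t. t \<le> Suc n \<Longrightarrow> fin_generated (P t)" and bb: "\<And>t. t \<le> Suc n \<Longrightarrow> bounded_below (P t)"
    using koszul_fin_generated[OF assms(4,2)] koszul_bounded_below[OF assms(4,2)] by simp_all
  have exact_iff: "exact_at_left_end (Suc n) P f \<longleftrightarrow>
      (\<forall>x\<in>mcar (P (Suc n)). f (Suc n) x = 0 \<longrightarrow> x = 0)"
    using mcar_zero[OF gm] ghom_zero[OF diff_ghom] unfolding exact_at_left_end_def by blast
  have source: "is_source_of_top \<Gamma> (Suc n) P f"
    if "hom_to_algebra_zero \<Gamma> (simple_mod \<Gamma> i)" "exact_at_left_end (Suc n) P f"
    by (rule exact_imp_source[OF iso ext that(1) fg bb]) (use that(2) exact_iff in auto)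
  have exact: "\<forall>x\<in>mcar (P (Suc n)). f (Suc n) x = 0 \<longrightarrow> x = 0" if "is_source_of_top \<Gamma> (Suc n) P f"
    using source_imp_exact[OF iso that bb] by simp
  have sink: "is_sink_of_bottom \<Gamma> (Suc n) P f" if src: "is_source_of_top \<Gamma> (Suc n) P f"
    by (rule sink_of_exact[OF source_in_add[OF src] source_radical[OF src]]) (use exact[OF src] in auto)
  show ?thesis
    unfolding almost_split_sequence_def using source exact sink exact_iff by (simp only: Suc_eq_plus1) blast
qed

end
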